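(* Let $u^{(\sigma)}\in\mathbb R^2$ denote the optimal static control, i.e. the solution of the static problem (S) described in the context, and for $T>0$ let $u^{(\delta,T)}\in (L^2(0,T))^2$ denote the optimal dynamic control, i.e. the solution of the dynamic problem (P$_T$) described in the context with time horizon $T$. Let $r^{(\sigma)}$ and $r^{(\delta,T)}$ denote the corresponding states. There exists a constant $\bar C>0$ that is independent of $T$ such that for all $T>0$ $$\frac1T\int_0^T\left\|u^{(\delta,T)}(\tau)-u^{(\sigma)}\right\|_{\mathbb R^2}^2\,d\tau\le\frac{\bar C}{T}.$$ Thus for all $T>0$ $$\int_0^1\left\|u^{(\delta,T)}(Ts)-u^{(\sigma)}\right\|_{\mathbb R^2}^2\,ds\le\frac{\bar C}{T}.$$ Moreover, there exists a constant $\tilde D>0$ (independent of $T$) such that for all $T>0$ $$\int_0^T\int_0^L\left\|r^{(\delta,T)}(\tau,x)-r^{(\sigma)}(x)\right\|_{\mathbb R^2}^2\,dx\,d\tau\le\tilde D.$$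
   Context: Standing data. Let $L>0$, let $d_-,d_+:[0,L]\to\mathbb R$ be continuously differentiable with $d_-(x)<0<d_+(x)$ for all $x\in[0,L]$, and put $D(x)=\mathrm{diag}(d_+(x),d_-(x))$, $D'(x)=\mathrm{diag}(d_+'(x),d_-'(x))$. Let $M(x)$, $x\in[0,L]$, be a real $2\times2$ matrix depending continuously on $x$, and let $\eta_0\le 0$ be a real number. For real $\mu_+,\mu_-$ let $E(x)=\mathrm{diag}(\exp(-\mu_+x),\exp(\mu_-x))$. It is assumed that: (i) there exist $\mu_+>0$, $\mu_->0$ and $\nu_a<0$ such that for all $x\in[0,L]$ $$\sup_{v:\,v^\top E(x)v=1}v^\top\Big[\tfrac{d}{dx}\big(E(x)D(x)\big)-|\eta_0|\big(E(x)M(x)+M(x)^\top E(x)\big)\Big]v\le\nu_a;$$ (ii) there exist $\mu_+<0$, $\mu_-<0$ and $\nu_0>0$ such that for all $x\in[0,L]$ $$\inf_{v:\,v^\top E(x)v=1}v^\top\Big[E'(x)D(x)-E(x)D'(x)+|\eta_0|\big(E(x)M(x)+M(x)^\top E(x)\big)\Big]v\ge\nu_0.$$ Dynamic system. For $T>0$ and $u=(u_+,u_-)\in H=L^2(0,T)\times L^2(0,T)$, the state $r=(r_+,r_-)^\top$ is the solution $r\in C([0,T],L^2((0,L);\mathbb R^2))$ (in the sense of integration along characteristic curves) of $$r(0,x)=0,\quad r_t+D\,r_x=\eta_0\,M\,r,\quad r_+(t,0)=u_+(t),\quad r_-(t,L)=u_-(t),\qquad (t,x)\in(0,T)\times(0,L).$$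 Its boundary traces satisfy $r_+(\cdot,L),\,r_-(\cdot,0)\in L^2(0,T)$. Objective. Let $f_0(z)=\frac12z^\top A_0z+c_0^\top z$ and $f_L(z)=\frac12z^\top A_Lz+c_L^\top z$ for $z\in\mathbb R^2$, with symmetric positive definite $2\times2$ matrices $A_0,A_L$ and vectors $c_0,c_L\in\mathbb R^2$. Here $\|\cdot\|_{\mathbb R^2}$ is the Euclidean norm. Dynamic problem (P$_T$): minimize over $u\in(L^2(0,T))^2$ $$\int_0^T f_0\big(u_+(t),r_-(t,0)\big)+f_L\big(u_-(t),r_+(t,L)\big)\,dt$$ where $r$ is the state generated by $u$. The state generated by the solution $u^{(\delta,T)}$ is $r^{(\delta,T)}$. Static problem (S): minimize over $u^{(\sigma)}=(u_+^{(\sigma)},u_-^{(\sigma)})^\top\in\mathbb R^2$ $$f_0\big(u_+^{(\sigma)},R_-^{(\sigma)}(0)\big)+f_L\big(u_-^{(\sigma)},R_+^{(\sigma)}(L)\big)$$ where $R^{(\sigma)}=(R_+^{(\sigma)},R_-^{(\sigma)})^\top$ solves the boundary value problem $D\,R_x^{(\sigma)}(x)=\eta_0\,M\,R^{(\sigma)}(x)$ for $x\in(0,L)$, $R_+^{(\sigma)}(0)=u_+^{(\sigma)}$, $R_-^{(\sigma)}(L)=u_-^{(\sigma)}$. The state generated by the solution of (S) is denoted $r^{(\sigma)}$. *)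

theory Defs
  imports "HOL-Analysis.Analysis"
begin

text \<open>
  Vectors of the plane are elements of \<^typ>\<open>real^2\<close>; component 1 carries the index \<open>+\<close> and
  component 2 the index \<open>-\<close>.
\<close>

definition diag2 :: "real \<Rightarrow> real \<Rightarrow> real^2^2" where
  "diag2 a b = vector [vector [a, 0], vector [0, b]]"

definition weight_matrix :: "real \<Rightarrow> real \<Rightarrow> real \<Rightarrow> real^2^2" where
  "weight_matrix \<mu>p \<mu>m x = diag2 (exp (- \<mu>p * x)) (exp (\<mu>m * x))"

definition symmetric_pos_def :: "real^2^2 \<Rightarrow> bool" where
  "symmetric_pos_def A \<longleftrightarrow> transpose A = A \<and> (\<forall>z. z \<noteq> 0 \<longrightarrow> 0 < z \<bullet> (A *v z))"

definition quad_cost :: "real^2^2 \<Rightarrow> real^2 \<Rightarrow> real^2 \<Rightarrow> real" where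
  "quad_cost A c z = 1/2 * (z \<bullet> (A *v z)) + c \<bullet> z"

text \<open>Classes of \<open>L\<^sup>2\<close>-functions are represented by Borel functions; every class has one.\<close>

definition L2_on :: "real set \<Rightarrow> (real \<Rightarrow> real^2) \<Rightarrow> bool" where
  "L2_on S f \<longleftrightarrow> set_borel_measurable lborel S f \<and> set_integrable lborel S (\<lambda>x. (norm (f x))\<^sup>2)"

definition L2_continuous :: "real \<Rightarrow> real \<Rightarrow> (real \<Rightarrow> real \<Rightarrow> real^2) \<Rightarrow> bool" where
  "L2_continuous T L r \<longleftrightarrow>
     (\<forall>t\<in>{0..T}. L2_on {0..L} (r t)) \<and>
     (\<forall>t\<in>{0..T}.
        ((\<lambda>s. LBINT x:{0..L}. (norm (r s x - r t x))\<^sup>2) \<longlongrightarrow> 0) (at t within {0..T}))"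

definition characteristic ::
    "real \<Rightarrow> (real \<Rightarrow> real) \<Rightarrow> real \<Rightarrow> real \<Rightarrow> (real \<Rightarrow> real) \<Rightarrow> bool" where
  "characteristic L d a b \<xi> \<longleftrightarrow>
     (\<forall>s\<in>{a..b}. \<xi> s \<in> {0..L} \<and> (\<xi> has_real_derivative d (\<xi> s)) (at s within {a..b}))"

text \<open>
  The value \<open>v\<close> is obtained at \<open>(t, x)\<close> by integrating the scalar equation
  \<open>q\<^sub>t + d q\<^sub>x = w\<close> along the characteristic curve through \<open>(t, x)\<close>.
  Followed backwards in time, the curve is stopped at the time \<open>t0\<close> where it meets either the
  initial line, on which \<open>q = 0\<close>, or the inflow boundary \<open>x = b\<close>, on which \<open>q = g\<close>. The choice made
  in the corner \<open>t0 = 0\<close>, \<open>\<xi> t0 = b\<close> concerns a single curve only.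
\<close>

definition value_along_characteristic ::
    "real \<Rightarrow> (real \<Rightarrow> real) \<Rightarrow> real \<Rightarrow> (real \<Rightarrow> real) \<Rightarrow> (real \<Rightarrow> real \<Rightarrow> real)
      \<Rightarrow> real \<Rightarrow> real \<Rightarrow> real \<Rightarrow> bool" where
  "value_along_characteristic L d b g w t x v \<longleftrightarrow>
     (\<exists>t0 \<xi>. 0 \<le> t0 \<and> t0 \<le> t \<and> characteristic L d t0 t \<xi> \<and> \<xi> t = x \<and>
        (t0 = 0 \<or> \<xi> t0 = b) \<and>
        set_integrable lborel {t0..t} (\<lambda>s. w s (\<xi> s)) \<and>
        v = (if t0 = 0 then 0 else g t0) + (LBINT s:{t0..t}. w s (\<xi> s)))"

definition integrated_at ::
    "real \<Rightarrow> (real \<Rightarrow> real) \<Rightarrow> (real \<Rightarrow> real) \<Rightarrow> (real \<Rightarrow> real^2^2) \<Rightarrow> real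
      \<Rightarrow> (real \<Rightarrow> real^2) \<Rightarrow> (real \<Rightarrow> real \<Rightarrow> real^2) \<Rightarrow> real \<Rightarrow> real \<Rightarrow> bool" where
  "integrated_at L dp dm M \<eta>0 u r t x \<longleftrightarrow>
     value_along_characteristic L dp 0 (\<lambda>s. u s $ 1) (\<lambda>s y. \<eta>0 * (M y *v r s y) $ 1)
       t x (r t x $ 1) \<and>
     value_along_characteristic L dm L (\<lambda>s. u s $ 2) (\<lambda>s y. \<eta>0 * (M y *v r s y) $ 2)
       t x (r t x $ 2)"

text \<open>
  The state is a path in \<open>C([0,T], L\<^sup>2(0,L))\<close> given by a representative \<open>r t x\<close> on the closed
  rectangle. The last clause of the definition selects the representative whose values on the lines
  \<open>x = 0\<close> and \<open>x = L\<close> are the boundary traces: without it these values would be arbitrary, as the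
  lines are null sets. Together with the clause before it, it also contains the initial condition
  and the boundary conditions, since there the characteristic curve degenerates to a point.
\<close>

definition dynamic_state ::
    "real \<Rightarrow> (real \<Rightarrow> real) \<Rightarrow> (real \<Rightarrow> real) \<Rightarrow> (real \<Rightarrow> real^2^2) \<Rightarrow> real \<Rightarrow> real
      \<Rightarrow> (real \<Rightarrow> real^2) \<Rightarrow> (real \<Rightarrow> real \<Rightarrow> real^2) \<Rightarrow> bool" where
  "dynamic_state L dp dm M \<eta>0 T u r \<longleftrightarrow>
     set_borel_measurable lborel ({0..T} \<times> {0..L}) (\<lambda>(t, x). r t x) \<and>
     L2_continuous T L r \<and>
     (\<forall>t\<in>{0..T}. AE x\<in>{0..L} in lborel. integrated_at L dp dm M \<eta>0 u r t x) \<and>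
     (\<forall>x\<in>{0, L}. AE t\<in>{0..T} in lborel. integrated_at L dp dm M \<eta>0 u r t x)"

definition dynamic_cost ::
    "real \<Rightarrow> (real^2 \<Rightarrow> real) \<Rightarrow> (real^2 \<Rightarrow> real) \<Rightarrow> real
      \<Rightarrow> (real \<Rightarrow> real^2) \<Rightarrow> (real \<Rightarrow> real \<Rightarrow> real^2) \<Rightarrow> real" where
  "dynamic_cost L f0 fL T u r =
     (LBINT t:{0..T}. f0 (vector [u t $ 1, r t 0 $ 2]) + fL (vector [u t $ 2, r t L $ 1]))"

definition dynamic_optimum ::
    "real \<Rightarrow> (real \<Rightarrow> real) \<Rightarrow> (real \<Rightarrow> real) \<Rightarrow> (real \<Rightarrow> real^2^2) \<Rightarrow> real
      \<Rightarrow> (real^2 \<Rightarrow> real) \<Rightarrow> (real^2 \<Rightarrow> real) \<Rightarrow> real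
      \<Rightarrow> (real \<Rightarrow> real^2) \<Rightarrow> (real \<Rightarrow> real \<Rightarrow> real^2) \<Rightarrow> bool" where
  "dynamic_optimum L dp dm M \<eta>0 f0 fL T u r \<longleftrightarrow>
     L2_on {0..T} u \<and> dynamic_state L dp dm M \<eta>0 T u r \<and>
     (\<forall>v s. L2_on {0..T} v \<and> dynamic_state L dp dm M \<eta>0 T v s \<longrightarrow>
        dynamic_cost L f0 fL T u r \<le> dynamic_cost L f0 fL T v s)"

definition static_state ::
    "real \<Rightarrow> (real \<Rightarrow> real) \<Rightarrow> (real \<Rightarrow> real) \<Rightarrow> (real \<Rightarrow> real^2^2) \<Rightarrow> real
      \<Rightarrow> real^2 \<Rightarrow> (real \<Rightarrow> real^2) \<Rightarrow> bool" where
  "static_state L dp dm M \<eta>0 u R \<longleftrightarrow>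
     continuous_on {0..L} R \<and>
     (\<forall>x\<in>{0<..<L}. R differentiable (at x) \<and>
        diag2 (dp x) (dm x) *v vector_derivative R (at x) = \<eta>0 *\<^sub>R (M x *v R x)) \<and>
     R 0 $ 1 = u $ 1 \<and> R L $ 2 = u $ 2"

definition static_cost ::
    "real \<Rightarrow> (real^2 \<Rightarrow> real) \<Rightarrow> (real^2 \<Rightarrow> real) \<Rightarrow> real^2 \<Rightarrow> (real \<Rightarrow> real^2) \<Rightarrow> real" where
  "static_cost L f0 fL u R = f0 (vector [u $ 1, R 0 $ 2]) + fL (vector [u $ 2, R L $ 1])"

definition static_optimum ::
    "real \<Rightarrow> (real \<Rightarrow> real) \<Rightarrow> (real \<Rightarrow> real) \<Rightarrow> (real \<Rightarrow> real^2^2) \<Rightarrow> real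
      \<Rightarrow> (real^2 \<Rightarrow> real) \<Rightarrow> (real^2 \<Rightarrow> real) \<Rightarrow> real^2 \<Rightarrow> (real \<Rightarrow> real^2) \<Rightarrow> bool" where
  "static_optimum L dp dm M \<eta>0 f0 fL u R \<longleftrightarrow>
     static_state L dp dm M \<eta>0 u R \<and>
     (\<forall>v S. static_state L dp dm M \<eta>0 v S \<longrightarrow>
        static_cost L f0 fL u R \<le> static_cost L f0 fL v S)"

end

theory Submission
  imports Defs
begin

text \<open>
  Let \<open>J\<close> be the optimal static cost, \<open>z = r - r\<sigma>\<close> the deviation of a dynamic state and \<open>U\<close> the
  squared \<open>L\<^sup>2\<close>-norm of \<open>u - u\<sigma>\<close> over \<open>[0, T]\<close>. The theorem follows once every admissible
  pair satisfies, with constants \<open>\<kappa>, K' > 0\<close> that do not depend on \<open>T\<close>,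
  \<open>T J + \<kappa> U - K' \<le> cost \<le> T J + K' (1 + U)\<close> (\<open>cost_bounds\<close>): the optimal pair costs at most as much
  as the pair with the control \<open>min t 1 * u\<sigma>\<close>, for which \<open>U \<le> |u\<sigma>|\<^sup>2\<close>, so \<open>U\<close> is bounded for it.

  Since the costs are quadratic, the cost is \<open>T J\<close> plus a term linear in the deviations of controls
  and boundary traces plus a positive definite quadratic term. Two balance laws handle these terms.

  \<^item> Dissipation. Testing the equation for \<open>z\<close> with \<open>E z\<close>, where \<open>E\<close> is the weight from
    condition (i), bounds the final state, the outgoing traces and the space-time integral of \<open>|z|\<^sup>2\<close>
    by \<open>K (1 + U)\<close> (\<open>dissipation_bound\<close>); the summand \<open>1\<close> comes from the initial deviation \<open>- r\<sigma>\<close>.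
  \<^item> Stationarity. The gradient of the costs at the static optimum annihilates the boundary
    values of all static solutions, hence it consists of the boundary values of a solution
    \<open>y = D p\<close> of the adjoint static equation (\<open>static_adjoint\<close>). Testing the equation for \<open>z\<close> with \<open>p\<close>
    turns the linear term, an integral over \<open>[0, T]\<close>, into integrals of \<open>p z\<close> at the two times \<open>0\<close> and
    \<open>T\<close> (\<open>linear_identity\<close>). By Young's inequality and the dissipation bound it is at most
    a small multiple of \<open>U\<close> plus a constant.

  States are only square integrable and are defined by integration along characteristics, so
  both balance laws rest on one identity, \<open>transport_balance\<close>: with the travel time \<open>y\<close> as
  space coordinate a characteristic is the set of all \<open>(t, y)\<close> with a given label \<open>\<sigma> = t - y\<close>; a
  product of two solutions and a weight obeys the product rule for indefinite Lebesgue integrals on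
  each of them, and the result is integrated over \<open>\<sigma>\<close>. The state of the comparison control
  \<open>min t 1 * u\<sigma>\<close>, which starts at \<open>0\<close> in order to match the initial state, is a continuous fixed point
  of the integral equations along characteristics (\<open>dynamic_state_exists\<close>).
\<close>

section \<open>Product rule for indefinite Lebesgue integrals\<close>

lemma borel_measurable_indefinite_integral:
  fixes f :: "real \<Rightarrow> real"
  assumes [measurable]: "f \<in> borel_measurable borel"
  shows "(\<lambda>t. LBINT s:{..t}. f s) \<in> borel_measurable borel"
proof -
  have "(\<lambda>t. \<integral>s. (if s \<le> t then f s else 0) \<partial>lborel) \<in> borel_measurable borel"
    by (rule lborel.borel_measurable_lebesgue_integral) measurable
  moreover have "(\<integral>s. (if s \<le> t then f s else 0) \<partial>lborel) = (LBINT s:{..t}. f s)" for t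
    unfolding set_lebesgue_integral_def by (rule Bochner_Integration.integral_cong) (auto simp: indicator_def)
  ultimately show ?thesis by simp
qed

lemma indefinite_integral_bound:
  fixes f :: "real \<Rightarrow> real"
  assumes "integrable lborel f"
  shows "\<bar>LBINT s:{..t}. f s\<bar> \<le> (LBINT s. \<bar>f s\<bar>)"
proof -
  have "\<bar>LBINT s:{..t}. f s\<bar> \<le> (LBINT s. \<bar>indicat_real {..t} s * f s\<bar>)"
    unfolding set_lebesgue_integral_def by simp
  also have "\<dots> \<le> (LBINT s. \<bar>f s\<bar>)"
    using assms integrable_mult_indicator[of "{..t}" lborel f]
    by (intro integral_mono integrable_abs) (auto simp: indicator_def)
  finally show ?thesis .
qed

lemma integrable_mult_bounded:
  fixes f g :: "'a \<Rightarrow> real"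
  assumes "integrable N f" "g \<in> borel_measurable N" "\<And>x. \<bar>g x\<bar> \<le> B"
  shows "integrable N (\<lambda>x. f x * g x)"
proof (rule Bochner_Integration.integrable_bound)
  show "integrable N (\<lambda>x. B * f x)" using assms by simp
  show "(\<lambda>x. f x * g x) \<in> borel_measurable N" using assms by measurable
  show "AE x in N. norm (f x * g x) \<le> norm (B * f x)"
  proof (rule AE_I2)
    fix x
    have "\<bar>g x\<bar> \<le> \<bar>B\<bar>" using assms(3)[of x] by linarith
    then have "\<bar>f x\<bar> * \<bar>g x\<bar> \<le> \<bar>f x\<bar> * \<bar>B\<bar>" by (rule mult_left_mono) simp
    then show "norm (f x * g x) \<le> norm (B * f x)" by (simp add: abs_mult mult.commute)
  qed
qed

text \<open>
  Fubini's theorem on the two halves \<open>\<tau> \<le> s\<close> and \<open>s < \<tau>\<close> of the plane. This replaces integration by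
  parts, which is needed here for integrands that are merely integrable.
\<close>

lemma integral_product_split:
  fixes f g :: "real \<Rightarrow> real"
  assumes f: "integrable lborel f" and g: "integrable lborel g"
  shows "(LBINT s. f s) * (LBINT s. g s)
    = (LBINT s. f s * (LBINT \<tau>:{..s}. g \<tau>)) + (LBINT s. (LBINT \<tau>:{..s}. f \<tau>) * g s)"
proof -
  have mf[measurable]: "f \<in> borel_measurable borel" and mg[measurable]: "g \<in> borel_measurable borel"
    using f g by auto
  have int: "integrable (lborel \<Otimes>\<^sub>M lborel) (\<lambda>(s, \<tau>). f s * g \<tau>)"
  proof (rule lborel_pair.Fubini_integrable)
    show "(\<lambda>(s, \<tau>). f s * g \<tau>) \<in> borel_measurable (lborel \<Otimes>\<^sub>M lborel)" by measurable
    show "integrable lborel (\<lambda>s. LBINT \<tau>. norm (case (s, \<tau>) of (s, \<tau>) \<Rightarrow> f s * g \<tau>))"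
      using f g by (auto simp: abs_mult)
    show "AE s in lborel. integrable lborel (\<lambda>\<tau>. case (s, \<tau>) of (s, \<tau>) \<Rightarrow> f s * g \<tau>)"
      using g by auto
  qed
  have low: "integrable (lborel \<Otimes>\<^sub>M lborel) (\<lambda>(s, \<tau>). f s * (if \<tau> \<le> s then g \<tau> else 0))"
    by (rule Bochner_Integration.integrable_bound[OF int]) (auto simp: split_beta)
  have up: "integrable (lborel \<Otimes>\<^sub>M lborel) (\<lambda>(s, \<tau>). (if s < \<tau> then f s else 0) * g \<tau>)"
    by (rule Bochner_Integration.integrable_bound[OF int]) (auto simp: split_beta)
  have ind: "(LBINT \<tau>. if \<tau> \<le> s then g \<tau> else 0) = (LBINT \<tau>:{..s}. g \<tau>)" for s and g :: "real \<Rightarrow> real"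
    unfolding set_lebesgue_integral_def by (rule Bochner_Integration.integral_cong) (auto simp: indicator_def)
  have ind': "(LBINT s. if s < \<tau> then f s else 0) = (LBINT s:{..\<tau>}. f s)" for \<tau>
  proof -
    have "(LBINT s. if s < \<tau> then f s else 0) = (LBINT s. if s \<le> \<tau> then f s else 0)"
    proof (rule integral_cong_AE)
      show "AE s in lborel. (if s < \<tau> then f s else 0) = (if s \<le> \<tau> then f s else 0)"
        using AE_lborel_singleton[of \<tau>] by eventually_elim auto
    qed measurable
    then show ?thesis by (simp only: ind)
  qed
  have "(LBINT s. f s) * (LBINT s. g s) = (LBINT s. LBINT \<tau>. f s * g \<tau>)"
    by simp
  also have "\<dots> = integral\<^sup>L (lborel \<Otimes>\<^sub>M lborel) (\<lambda>(s, \<tau>). f s * g \<tau>)"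
    using lborel_pair.integral_fst[OF int] by simp
  also have "\<dots> = integral\<^sup>L (lborel \<Otimes>\<^sub>M lborel)
      (\<lambda>p. (case p of (s, \<tau>) \<Rightarrow> f s * (if \<tau> \<le> s then g \<tau> else 0)) + (case p of (s, \<tau>) \<Rightarrow> (if s < \<tau> then f s else 0) * g \<tau>))"
    by (rule Bochner_Integration.integral_cong) auto
  also have "\<dots> = (LBINT s. LBINT \<tau>. f s * (if \<tau> \<le> s then g \<tau> else 0))
      + (LBINT \<tau>. LBINT s. (if s < \<tau> then f s else 0) * g \<tau>)"
    using lborel_pair.integral_fst[OF low] lborel_pair.integral_snd[OF up] low up by simp
  finally show ?thesis by (simp only: integral_mult_right_zero integral_mult_left_zero ind ind')
qed

text \<open>
  The product rule \<open>(F G)' = f G + F g\<close> for indefinite integrals, obtained from the splitting above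
  by cutting \<open>f\<close> and \<open>g\<close> off at \<open>t\<close>. That \<open>F\<close> and \<open>G\<close> start at \<open>- \<infinity>\<close> makes lower limits unnecessary: later
  the integrands vanish outside the rectangle under consideration.
\<close>

lemma product_rule_indefinite_integral:
  fixes f g :: "real \<Rightarrow> real" and a b :: real
  assumes f: "integrable lborel f" and g: "integrable lborel g"
  defines "F \<equiv> \<lambda>t. a + (LBINT s:{..t}. f s)" and "G \<equiv> \<lambda>t. b + (LBINT s:{..t}. g s)"
  shows "integrable lborel (\<lambda>s. f s * G s + F s * g s)"
    and "F t * G t = a * b + (LBINT s:{..t}. f s * G s + F s * g s)"
proof -
  have mf[measurable]: "f \<in> borel_measurable borel" and mg[measurable]: "g \<in> borel_measurable borel"
    using f g by auto
  have mF[measurable]: "F \<in> borel_measurable borel" and mG[measurable]: "G \<in> borel_measurable borel"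
    unfolding F_def G_def using borel_measurable_indefinite_integral by auto
  have bF: "\<bar>F s\<bar> \<le> \<bar>a\<bar> + (LBINT s. \<bar>f s\<bar>)" and bG: "\<bar>G s\<bar> \<le> \<bar>b\<bar> + (LBINT s. \<bar>g s\<bar>)" for s
    unfolding F_def G_def using indefinite_integral_bound[OF f, of s] indefinite_integral_bound[OF g, of s]
    by linarith+
  have i1: "integrable lborel (\<lambda>s. f s * G s)"
    by (rule integrable_mult_bounded[OF f _ bG]) simp
  have i2: "integrable lborel (\<lambda>s. g s * F s)"
    by (rule integrable_mult_bounded[OF g _ bF]) simp
  show int: "integrable lborel (\<lambda>s. f s * G s + F s * g s)"
    using i1 i2 by (simp add: mult.commute)
  define f' where "f' = (\<lambda>s. indicator {..t} s * f s)"
  define g' where "g' = (\<lambda>s. indicator {..t} s * g s)"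
  have f': "integrable lborel f'" and g': "integrable lborel g'"
    unfolding f'_def g'_def using f g integrable_mult_indicator[of "{..t}" lborel f] integrable_mult_indicator[of "{..t}" lborel g] by auto
  have tr: "indicator {..t} s * (LBINT \<tau>:{..s}. indicator {..t} \<tau> * k \<tau>) = indicator {..t} s * (LBINT \<tau>:{..s}. k \<tau> :: real)" for s and k :: "real \<Rightarrow> real"
  proof (cases "s \<le> t")
    case True
    then have "(LBINT \<tau>:{..s}. indicator {..t} \<tau> * k \<tau>) = (LBINT \<tau>:{..s}. k \<tau> :: real)"
      unfolding set_lebesgue_integral_def by (intro Bochner_Integration.integral_cong) (auto simp: indicator_def)
    then show ?thesis by simp
  qed simp
  have j1: "integrable lborel (\<lambda>s. f' s * G s)" and j2: "integrable lborel (\<lambda>s. g' s * F s)"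
    using integrable_mult_bounded[OF f' _ bG] integrable_mult_bounded[OF g' _ bF] by auto
  have Fs: "(LBINT s:{..t}. f s) = (LBINT s. f' s)" "(LBINT s:{..t}. g s) = (LBINT s. g' s)"
    unfolding set_lebesgue_integral_def f'_def g'_def by simp_all
  have "f' s * (LBINT \<tau>:{..s}. g' \<tau>) = f' s * (G s - b)" for s
    using tr[of s g] unfolding f'_def g'_def G_def by (simp add: mult.assoc mult.left_commute)
  moreover have "(LBINT \<tau>:{..s}. f' \<tau>) * g' s = (F s - a) * g' s" for s
    using tr[of s f] unfolding f'_def g'_def F_def by (simp add: mult.commute mult.left_commute)
  ultimately have "(LBINT s. f' s) * (LBINT s. g' s) = (LBINT s. f' s * (G s - b)) + (LBINT s. (F s - a) * g' s)"
    by (simp only: integral_product_split[OF f' g'])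
  also have "\<dots> = (LBINT s. f' s * G s - b * f' s) + (LBINT s. g' s * F s - a * g' s)"
    by (simp add: algebra_simps)
  also have "\<dots> = (LBINT s. f' s * G s) - b * (LBINT s. f' s) + (LBINT s. g' s * F s) - a * (LBINT s. g' s)"
    using j1 j2 f' g' by simp
  finally have *: "F t * G t = a * b + ((LBINT s. f' s * G s) + (LBINT s. g' s * F s))"
    unfolding F_def G_def Fs by (simp add: algebra_simps)
  also have "(LBINT s. f' s * G s) + (LBINT s. g' s * F s) = (LBINT s. f' s * G s + g' s * F s)"
    using j1 j2 by simp
  also have "\<dots> = (LBINT s:{..t}. f s * G s + F s * g s)"
    unfolding set_lebesgue_integral_def f'_def g'_def by (simp add: algebra_simps)
  finally show "F t * G t = a * b + (LBINT s:{..t}. f s * G s + F s * g s)" .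
qed

section \<open>Transport with unit speed\<close>

lemma integrable_mult_of_squares:
  fixes f g :: "'a \<Rightarrow> real"
  assumes "f \<in> borel_measurable N" "g \<in> borel_measurable N"
    and "integrable N (\<lambda>x. (f x)\<^sup>2)" "integrable N (\<lambda>x. (g x)\<^sup>2)"
  shows "integrable N (\<lambda>x. f x * g x)"
proof (rule Bochner_Integration.integrable_bound)
  show "integrable N (\<lambda>x. (f x)\<^sup>2 + (g x)\<^sup>2)" using assms by simp
  show "(\<lambda>x. f x * g x) \<in> borel_measurable N" using assms by measurable
  show "AE x in N. norm (f x * g x) \<le> norm ((f x)\<^sup>2 + (g x)\<^sup>2)"
  proof (rule AE_I2)
    fix x
    have "2 * (\<bar>f x\<bar> * \<bar>g x\<bar>) \<le> (f x)\<^sup>2 + (g x)\<^sup>2"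
      using sum_squares_bound[of "\<bar>f x\<bar>" "\<bar>g x\<bar>"] by (simp add: power2_eq_square algebra_simps)
    moreover have "0 \<le> \<bar>f x\<bar> * \<bar>g x\<bar>" by simp
    moreover have "norm (f x * g x) = \<bar>f x\<bar> * \<bar>g x\<bar>" by (simp add: abs_mult)
    ultimately show "norm (f x * g x) \<le> norm ((f x)\<^sup>2 + (g x)\<^sup>2)" by simp
  qed
qed

lemma integrable_of_square:
  fixes f :: "'a \<Rightarrow> real"
  assumes "f \<in> borel_measurable N" "integrable N (\<lambda>x. (f x)\<^sup>2)"
    and "A \<in> sets N" "emeasure N A < \<infinity>" "\<And>x. f x \<noteq> 0 \<Longrightarrow> x \<in> A"
  shows "integrable N f"
proof -
  have "(\<lambda>x. (indicator A x)\<^sup>2) = (indicator A :: 'a \<Rightarrow> real)" by (auto simp: indicator_def)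
  then have "integrable N (\<lambda>x. f x * indicator A x)"
    using assms by (intro integrable_mult_of_squares) auto
  moreover have "f x * indicator A x = f x" for x using assms(5)[of x] by (auto simp: indicator_def)
  ultimately show ?thesis by simp
qed

text \<open>
  The shear \<open>(s, \<sigma>) \<mapsto> (s, s - \<sigma>)\<close> preserves area, so integrating over characteristics and then over
  their labels is integrating over the plane.
\<close>

lemma shear_Fubini:
  fixes k :: "real \<Rightarrow> real \<Rightarrow> real"
  assumes k: "integrable (lborel \<Otimes>\<^sub>M lborel) (\<lambda>(s, y). k s y)"
  shows "AE \<sigma> in lborel. integrable lborel (\<lambda>s. k s (s - \<sigma>))"
    and "integrable lborel (\<lambda>\<sigma>. LBINT s. k s (s - \<sigma>))"
    and "(LBINT \<sigma>. LBINT s. k s (s - \<sigma>)) = (LBINT s. LBINT y. k s y)"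
proof -
  have m[measurable]: "(\<lambda>(s, y). k s y) \<in> borel_measurable (borel \<Otimes>\<^sub>M borel)"
    using k borel_measurable_integrable by (auto simp: borel_measurable_integrable cong: measurable_cong_sets)
  have aff: "(LBINT \<sigma>. f (s - \<sigma>)) = (LBINT y. f y)" for f :: "real \<Rightarrow> real" and s
    using lborel_integral_real_affine[of "-1" f s] by simp
  have sh: "integrable (lborel \<Otimes>\<^sub>M lborel) (\<lambda>(s, \<sigma>). k s (s - \<sigma>))"
  proof (rule lborel_pair.Fubini_integrable)
    show "(\<lambda>(s, \<sigma>). k s (s - \<sigma>)) \<in> borel_measurable (lborel \<Otimes>\<^sub>M lborel)" by measurable
    have "integrable lborel (\<lambda>s. LBINT y. norm (k s y))"
      using lborel_pair.integrable_fst[of "\<lambda>s y. norm (k s y)"] integrable_norm[OF k] by (simp add: case_prod_unfold)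
    moreover have "(LBINT \<sigma>. norm (k s (s - \<sigma>))) = (LBINT y. norm (k s y))" for s by (rule aff)
    ultimately show "integrable lborel (\<lambda>s. LBINT \<sigma>. norm (case (s, \<sigma>) of (s, \<sigma>) \<Rightarrow> k s (s - \<sigma>)))"
      by simp
    show "AE s in lborel. integrable lborel (\<lambda>\<sigma>. case (s, \<sigma>) of (s, \<sigma>) \<Rightarrow> k s (s - \<sigma>))"
      using lborel_pair.AE_integrable_fst[OF k]
    proof eventually_elim
      case (elim s)
      show ?case using lborel_integrable_real_affine[OF elim, of "-1" s] by simp
    qed
  qed
  show "AE \<sigma> in lborel. integrable lborel (\<lambda>s. k s (s - \<sigma>))"
    using lborel_pair.AE_integrable_snd[OF sh] .
  show "integrable lborel (\<lambda>\<sigma>. LBINT s. k s (s - \<sigma>))"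
    using lborel_pair.integrable_snd[OF sh] .
  have "(LBINT \<sigma>. LBINT s. k s (s - \<sigma>)) = (LBINT s. LBINT \<sigma>. k s (s - \<sigma>))"
    by (rule lborel_pair.Fubini_integral[OF sh])
  then show "(LBINT \<sigma>. LBINT s. k s (s - \<sigma>)) = (LBINT s. LBINT y. k s y)"
    by (simp only: aff)
qed

text \<open>
  The solution of \<open>q\<^sub>t + q\<^sub>y = w\<close> at time \<open>t\<close> on the characteristic with label \<open>\<sigma> = t - y\<close>. A label
  \<open>\<sigma> \<le> 0\<close> starts at time \<open>0\<close> at the point \<open>- \<sigma>\<close>, a label \<open>\<sigma> > 0\<close> starts at time \<open>\<sigma>\<close> at the boundary \<open>0\<close>; thus
  one function \<open>h\<close> of \<open>\<sigma>\<close> carries both initial and boundary data.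
\<close>

definition along :: "(real \<Rightarrow> real) \<Rightarrow> (real \<Rightarrow> real \<Rightarrow> real) \<Rightarrow> real \<Rightarrow> real \<Rightarrow> real" where
  "along h w \<sigma> t = h \<sigma> + (LBINT s:{..t}. w s (s - \<sigma>))"

text \<open>
  Data and source are cut off to the labels that meet the rectangle and to the rectangle itself, so
  that every integral below extends over the whole line or plane.
\<close>

definition admissible_data :: "real \<Rightarrow> real \<Rightarrow> (real \<Rightarrow> real) \<Rightarrow> (real \<Rightarrow> real \<Rightarrow> real) \<Rightarrow> bool" where
  "admissible_data T Y h w \<longleftrightarrow>
     h \<in> borel_measurable borel \<and> integrable lborel (\<lambda>\<sigma>. (h \<sigma>)\<^sup>2) \<and> (\<forall>\<sigma>. h \<sigma> \<noteq> 0 \<longrightarrow> \<sigma> \<in> {-Y..T}) \<and>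
     (\<lambda>(s, y). w s y) \<in> borel_measurable (borel \<Otimes>\<^sub>M borel) \<and>
     integrable (lborel \<Otimes>\<^sub>M lborel) (\<lambda>(s, y). (w s y)\<^sup>2) \<and>
     (\<forall>s y. w s y \<noteq> 0 \<longrightarrow> s \<in> {0..T} \<and> y \<in> {0..Y}) \<and>
     integrable (lborel \<Otimes>\<^sub>M lborel)
       (\<lambda>(s, y). indicator {0..T} s * indicator {0..Y} y * (along h w (s - y) s)\<^sup>2)"

lemma along_measurable:
  assumes [measurable]: "h \<in> borel_measurable borel" "(\<lambda>(s, y). w s y) \<in> borel_measurable (borel \<Otimes>\<^sub>M borel)"
  shows "(\<lambda>(t, y). along h w (t - y) t) \<in> borel_measurable (borel \<Otimes>\<^sub>M borel)"
proof -
  have "(\<lambda>p. \<integral>s. (if s \<le> fst p then w s (s - (fst p - snd p)) else 0) \<partial>lborel) \<in> borel_measurable (borel \<Otimes>\<^sub>M borel)"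
    by (rule lborel.borel_measurable_lebesgue_integral) measurable
  moreover have "(\<integral>s. (if s \<le> t then w s (s - \<sigma>) else 0) \<partial>lborel) = (LBINT s:{..t}. w s (s - \<sigma>))" for t \<sigma>
    unfolding set_lebesgue_integral_def by (rule Bochner_Integration.integral_cong) (auto simp: indicator_def)
  ultimately show ?thesis unfolding along_def by (simp add: split_beta)
qed

lemma emeasure_rectangle_finite: "emeasure (lborel \<Otimes>\<^sub>M lborel) ({0..T} \<times> {0..Y::real}) < (\<infinity>::ennreal)" for T :: real
  using emeasure_lborel_cbox_finite[of 0 T] emeasure_lborel_cbox_finite[of 0 Y]
  by (simp add: lborel.emeasure_pair_measure_Times ennreal_mult_less_top)

text \<open>
  After leaving the rectangle through the final time or through \<open>y = Y\<close> a characteristic collects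
  nothing, so its exit value is the value at any later time.
\<close>

lemma along_eventually_constant:
  assumes "\<forall>s y. w s y \<noteq> 0 \<longrightarrow> s \<in> {0..T} \<and> y \<in> {0..Y}"
  shows "T \<le> t \<Longrightarrow> along h w \<sigma> t = along h w \<sigma> T"
    and "\<sigma> + Y \<le> t \<Longrightarrow> along h w \<sigma> t = along h w \<sigma> (\<sigma> + Y)"
proof -
  have "(LBINT s:{..t}. w s (s - \<sigma>)) = (LBINT s:{..t'}. w s (s - \<sigma>))"
    if "t' \<le> t" "t' = T \<or> t' = \<sigma> + Y" for t'
    unfolding set_lebesgue_integral_def
  proof (rule Bochner_Integration.integral_cong, rule refl)
    fix s
    show "indicator {..t} s *\<^sub>R w s (s - \<sigma>) = indicator {..t'} s *\<^sub>R w s (s - \<sigma>)"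
    proof (cases "w s (s - \<sigma>) = 0")
      case False
      then have "s \<in> {0..T}" "s - \<sigma> \<in> {0..Y}" using assms by blast+
      then show ?thesis using that by (auto simp: indicator_def)
    qed simp
  qed
  then show "T \<le> t \<Longrightarrow> along h w \<sigma> t = along h w \<sigma> T"
    and "\<sigma> + Y \<le> t \<Longrightarrow> along h w \<sigma> t = along h w \<sigma> (\<sigma> + Y)"
    unfolding along_def by auto
qed

lemma along_eq_0:
  assumes "\<forall>s y. w s y \<noteq> 0 \<longrightarrow> s \<in> {0..T} \<and> y \<in> {0..Y}" "\<forall>\<sigma>. h \<sigma> \<noteq> 0 \<longrightarrow> \<sigma> \<in> {-Y..T}"
    and "\<sigma> \<notin> {-Y..T}"
  shows "along h w \<sigma> t = 0"
proof -
  have w0: "w s (s - \<sigma>) = 0" for s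
  proof (rule ccontr)
    assume "w s (s - \<sigma>) \<noteq> 0"
    then have "s \<in> {0..T}" "s - \<sigma> \<in> {0..Y}" using assms(1) by blast+
    then show False using assms(3) by auto
  qed
  show ?thesis using assms(2,3) unfolding along_def set_lebesgue_integral_def by (auto simp: w0)
qed

text \<open>
  A smooth function of \<open>y\<close> is itself a solution, with source \<open>\<beta>'\<close>. In this form it can serve as a
  factor in the product rule.
\<close>

lemma along_weight:
  fixes \<beta> \<beta>' :: "real \<Rightarrow> real"
  assumes der: "\<And>y. y \<in> {0..Y} \<Longrightarrow> (\<beta> has_real_derivative \<beta>' y) (at y within {0..Y})"
    and cont: "continuous_on {0..Y} \<beta>'" and s: "s \<in> {0..T}" "s - \<sigma> \<in> {0..Y}"
  shows "along (\<lambda>\<sigma>. indicator {-Y..T} \<sigma> * \<beta> (max 0 (- \<sigma>)))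
      (\<lambda>s y. indicator {0..T} s * indicator {0..Y} y * \<beta>' y) \<sigma> s = \<beta> (s - \<sigma>)"
proof -
  let ?a = "max 0 \<sigma>"
  have as: "?a \<le> s" using s by auto
  have "has_bochner_integral lborel (\<lambda>x. indicator {?a..s} x *\<^sub>R \<beta>' (x - \<sigma>)) (\<beta> (s - \<sigma>) - \<beta> (?a - \<sigma>))"
  proof (rule has_bochner_integral_FTC_Icc[OF as])
    show "continuous_on {?a..s} (\<lambda>x. \<beta>' (x - \<sigma>))"
      by (rule continuous_on_compose2[OF cont]) (use s in \<open>auto intro!: continuous_intros\<close>)
    fix x assume x: "?a \<le> x" "x \<le> s"
    then have "x - \<sigma> \<in> {0..Y}" using s by auto
    from DERIV_subset[OF der[OF this]] have
      "(\<beta> has_real_derivative \<beta>' (x - \<sigma>)) (at (x - \<sigma>) within (\<lambda>x. x - \<sigma>) ` {?a..s})"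
      using s by (meson atLeastAtMost_iff diff_mono diff_right_mono image_subsetI max.boundedE order_trans order_refl diff_ge_0_iff_ge)
    then have "((\<lambda>x. \<beta> (x - \<sigma>)) has_real_derivative \<beta>' (x - \<sigma>)) (at x within {?a..s})"
      using DERIV_image_chain[of \<beta> "\<beta>' (x - \<sigma>)" "\<lambda>x. x - \<sigma>" x "{?a..s}" 1]
      by (simp add: o_def DERIV_diff[OF DERIV_ident DERIV_const, simplified] del: image_diff_atLeastAtMost image_minus_const_atLeastAtMost')
    then show "((\<lambda>x. \<beta> (x - \<sigma>)) has_vector_derivative \<beta>' (x - \<sigma>)) (at x within {?a..s})"
      by (simp add: has_real_derivative_iff_has_vector_derivative)
  qed
  then have "(LBINT x. indicator {?a..s} x *\<^sub>R \<beta>' (x - \<sigma>)) = \<beta> (s - \<sigma>) - \<beta> (max 0 (- \<sigma>))"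
    by (auto simp: has_bochner_integral_integral_eq max_def split: if_splits)
  moreover have "(LBINT x:{..s}. indicator {0..T} x * indicator {0..Y} (x - \<sigma>) * \<beta>' (x - \<sigma>))
      = (LBINT x. indicator {?a..s} x *\<^sub>R \<beta>' (x - \<sigma>))"
    unfolding set_lebesgue_integral_def
    by (rule Bochner_Integration.integral_cong) (use s in \<open>auto simp: indicator_def\<close>)
  moreover have "\<sigma> \<in> {-Y..T}" using s by auto
  ultimately show ?thesis unfolding along_def by simp
qed

text \<open>
  On almost every characteristic the product rule, used twice, expresses the exit value of
  \<open>\<beta> q1 q2\<close> by the start value and the integral of its derivative. Integrated over the labels \<open>\<sigma>\<close>, the exit values
  split into the trace at \<open>y = Y\<close> (labels up to \<open>T - Y\<close>) and the final state (labels above), the start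
  values into the initial state and the inflow. Integrability of the exit values is part of the
  result: it is inherited from the right-hand side.
\<close>

lemma transport_balance:
  fixes \<beta> \<beta>' :: "real \<Rightarrow> real"
  assumes T: "0 < T" and Y: "0 < Y"
    and a1: "admissible_data T Y h1 w1" and a2: "admissible_data T Y h2 w2"
    and der: "\<And>y. y \<in> {0..Y} \<Longrightarrow> (\<beta> has_real_derivative \<beta>' y) (at y within {0..Y})"
    and cont: "continuous_on {0..Y} \<beta>'"
  defines "q1 \<equiv> \<lambda>t y. along h1 w1 (t - y) t" and "q2 \<equiv> \<lambda>t y. along h2 w2 (t - y) t"
  defines "k \<equiv> \<lambda>t y. indicator {0..T} t * indicator {0..Y} y *
      (\<beta>' y * (q1 t y * q2 t y) + \<beta> y * (w1 t y * q2 t y + q1 t y * w2 t y))"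
  shows "set_integrable lborel {0..T} (\<lambda>t. \<beta> Y * (q1 t Y * q2 t Y))"
    and "set_integrable lborel {0..Y} (\<lambda>y. \<beta> y * (q1 T y * q2 T y))"
    and "integrable (lborel \<Otimes>\<^sub>M lborel) (\<lambda>(t, y). k t y)"
    and "(LBINT y:{0..Y}. \<beta> y * (q1 T y * q2 T y)) + (LBINT t:{0..T}. \<beta> Y * (q1 t Y * q2 t Y))
      = (LBINT y:{0..Y}. \<beta> y * (h1 (- y) * h2 (- y))) + (LBINT t:{0..T}. \<beta> 0 * (h1 t * h2 t))
        + (LBINT t. LBINT y. k t y)"
proof -
  have mh[measurable]: "h1 \<in> borel_measurable borel" "h2 \<in> borel_measurable borel"
    and mw[measurable]: "(\<lambda>(s, y). w1 s y) \<in> borel_measurable (borel \<Otimes>\<^sub>M borel)"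
      "(\<lambda>(s, y). w2 s y) \<in> borel_measurable (borel \<Otimes>\<^sub>M borel)"
    and sh1: "\<forall>\<sigma>. h1 \<sigma> \<noteq> 0 \<longrightarrow> \<sigma> \<in> {-Y..T}" and sh2: "\<forall>\<sigma>. h2 \<sigma> \<noteq> 0 \<longrightarrow> \<sigma> \<in> {-Y..T}"
    and sw1: "\<forall>s y. w1 s y \<noteq> 0 \<longrightarrow> s \<in> {0..T} \<and> y \<in> {0..Y}"
    and sw2: "\<forall>s y. w2 s y \<noteq> 0 \<longrightarrow> s \<in> {0..T} \<and> y \<in> {0..Y}"
    using a1 a2 unfolding admissible_data_def by auto
  have mq[measurable]: "(\<lambda>(t, y). q1 t y) \<in> borel_measurable (borel \<Otimes>\<^sub>M borel)"
    "(\<lambda>(t, y). q2 t y) \<in> borel_measurable (borel \<Otimes>\<^sub>M borel)"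
    unfolding q1_def q2_def by (rule along_measurable; measurable)+
  have contb: "continuous_on {0..Y} \<beta>"
    using der by (meson DERIV_continuous continuous_on_eq_continuous_within)
  define b where "b y = indicator {0..Y} y * \<beta> y" for y :: real
  define b' where "b' y = indicator {0..Y} y * \<beta>' y" for y :: real
  have mb[measurable]: "b \<in> borel_measurable borel" and mb'[measurable]: "b' \<in> borel_measurable borel"
    using borel_measurable_continuous_on_indicator[of "{0..Y}" \<beta>] borel_measurable_continuous_on_indicator[of "{0..Y}" \<beta>']
      contb cont unfolding b_def b'_def by auto
  obtain C where C: "\<And>y. \<bar>b y\<bar> \<le> C" "\<And>y. \<bar>b' y\<bar> \<le> C"
  proof -
    have "bounded (\<beta> ` {0..Y})" "bounded (\<beta>' ` {0..Y})"
      using contb cont compact_continuous_image compact_imp_bounded by blast+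
    then obtain C1 C2 where "\<And>y. y \<in> {0..Y} \<Longrightarrow> \<bar>\<beta> y\<bar> \<le> C1" "\<And>y. y \<in> {0..Y} \<Longrightarrow> \<bar>\<beta>' y\<bar> \<le> C2"
      unfolding bounded_iff real_norm_def by (metis imageI)
    then show ?thesis
      using that[of "max 0 (max C1 C2)"] unfolding b_def b'_def by (fastforce simp: indicator_def le_max_iff_disj)
  qed
  let ?R = "{0..T} \<times> {0..Y}"
  define Q1 where "Q1 p = indicator ?R p * q1 (fst p) (snd p)" for p :: "real \<times> real"
  define Q2 where "Q2 p = indicator ?R p * q2 (fst p) (snd p)" for p :: "real \<times> real"
  have mQ[measurable]: "Q1 \<in> borel_measurable (lborel \<Otimes>\<^sub>M lborel)" "Q2 \<in> borel_measurable (lborel \<Otimes>\<^sub>M lborel)"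
    unfolding Q1_def Q2_def by measurable
  have iR: "indicator ?R p = (indicator {0..T} (fst p) * indicator {0..Y} (snd p) :: real)" for p
    by (simp add: indicator_times split_beta)
  have sqQ: "integrable (lborel \<Otimes>\<^sub>M lborel) (\<lambda>p. (Q1 p)\<^sup>2)" "integrable (lborel \<Otimes>\<^sub>M lborel) (\<lambda>p. (Q2 p)\<^sup>2)"
  proof -
    have "(\<lambda>p. (Q1 p)\<^sup>2) = (\<lambda>(s, y). indicator {0..T} s * indicator {0..Y} y * (along h1 w1 (s - y) s)\<^sup>2)"
      "(\<lambda>p. (Q2 p)\<^sup>2) = (\<lambda>(s, y). indicator {0..T} s * indicator {0..Y} y * (along h2 w2 (s - y) s)\<^sup>2)"
      unfolding Q1_def Q2_def q1_def q2_def iR by (auto simp: indicator_def fun_eq_iff)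
    then show "integrable (lborel \<Otimes>\<^sub>M lborel) (\<lambda>p. (Q1 p)\<^sup>2)" "integrable (lborel \<Otimes>\<^sub>M lborel) (\<lambda>p. (Q2 p)\<^sup>2)"
      using a1 a2 unfolding admissible_data_def by simp_all
  qed
  have sqw: "integrable (lborel \<Otimes>\<^sub>M lborel) (\<lambda>p. (w1 (fst p) (snd p))\<^sup>2)"
     "integrable (lborel \<Otimes>\<^sub>M lborel) (\<lambda>p. (w2 (fst p) (snd p))\<^sup>2)"
    using a1 a2 unfolding admissible_data_def by (auto simp: case_prod_unfold)
  have i1: "integrable (lborel \<Otimes>\<^sub>M lborel) (\<lambda>p. Q1 p * Q2 p)"
    by (rule integrable_mult_of_squares[OF _ _ sqQ]) measurable
  have i2: "integrable (lborel \<Otimes>\<^sub>M lborel) (\<lambda>p. w1 (fst p) (snd p) * Q2 p)"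
    by (rule integrable_mult_of_squares[OF _ _ sqw(1) sqQ(2)]) measurable
  have i3: "integrable (lborel \<Otimes>\<^sub>M lborel) (\<lambda>p. Q1 p * w2 (fst p) (snd p))"
    by (rule integrable_mult_of_squares[OF _ _ sqQ(1) sqw(2)]) measurable
  have "integrable (lborel \<Otimes>\<^sub>M lborel) (\<lambda>p. (Q1 p * Q2 p) * b' (snd p) +
      (w1 (fst p) (snd p) * Q2 p + Q1 p * w2 (fst p) (snd p)) * b (snd p))"
  proof (rule Bochner_Integration.integrable_add)
    show "integrable (lborel \<Otimes>\<^sub>M lborel) (\<lambda>p. (Q1 p * Q2 p) * b' (snd p))"
      by (rule integrable_mult_bounded[OF i1 _ C(2)]) measurable
    show "integrable (lborel \<Otimes>\<^sub>M lborel) (\<lambda>p. (w1 (fst p) (snd p) * Q2 p + Q1 p * w2 (fst p) (snd p)) * b (snd p))"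
      by (rule integrable_mult_bounded[OF Bochner_Integration.integrable_add[OF i2 i3] _ C(1)]) measurable
  qed
  moreover have k_eq: "(\<lambda>p. (Q1 p * Q2 p) * b' (snd p) +
      (w1 (fst p) (snd p) * Q2 p + Q1 p * w2 (fst p) (snd p)) * b (snd p)) = (\<lambda>(t, y). k t y)"
    unfolding k_def Q1_def Q2_def b_def b'_def iR by (auto simp: indicator_def fun_eq_iff)
  ultimately show kint: "integrable (lborel \<Otimes>\<^sub>M lborel) (\<lambda>(t, y). k t y)" by simp
  have wint: "integrable (lborel \<Otimes>\<^sub>M lborel) (\<lambda>(s, y). w1 s y)" "integrable (lborel \<Otimes>\<^sub>M lborel) (\<lambda>(s, y). w2 s y)"
    by (rule integrable_of_square[where A="?R"]; use sw1 sw2 sqw emeasure_rectangle_finite in \<open>auto simp: split_beta\<close>)+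
  define W where "W s y = indicator {0..T} s * indicator {0..Y} y * \<beta>' y" for s y :: real
  define H where "H \<sigma> = indicator {-Y..T} \<sigma> * \<beta> (max 0 (- \<sigma>))" for \<sigma> :: real
  have Wint: "integrable (lborel \<Otimes>\<^sub>M lborel) (\<lambda>(s, y). W s y)"
  proof -
    have "integrable (lborel \<Otimes>\<^sub>M lborel) (\<lambda>p. indicator ?R p * b' (snd p))"
      by (rule integrable_mult_bounded[OF _ _ C(2)])
        (use emeasure_rectangle_finite in \<open>auto intro!: integrable_real_indicator\<close>)
    moreover have "(\<lambda>p. indicator ?R p * b' (snd p)) = (\<lambda>(s, y). W s y)"
      unfolding iR W_def b'_def by (auto simp: indicator_def fun_eq_iff)
    ultimately show ?thesis by simp
  qed
  have HW: "along H W \<sigma> s = \<beta> (s - \<sigma>)" if "s \<in> {0..T}" "s - \<sigma> \<in> {0..Y}" for s \<sigma>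
    using along_weight[OF der cont that] unfolding H_def W_def by simp
  have sW: "\<forall>s y. W s y \<noteq> 0 \<longrightarrow> s \<in> {0..T} \<and> y \<in> {0..Y}"
    unfolding W_def by (auto simp: indicator_def)
  define Z where "Z \<sigma> = along H W \<sigma> T * (along h1 w1 \<sigma> T * along h2 w2 \<sigma> T)" for \<sigma>
  have Zae: "AE \<sigma> in lborel. Z \<sigma> = H \<sigma> * (h1 \<sigma> * h2 \<sigma>) + (LBINT s. k s (s - \<sigma>))"
    using shear_Fubini(1)[OF wint(1)] shear_Fubini(1)[OF wint(2)] shear_Fubini(1)[OF Wint]
  proof eventually_elim
    case (elim \<sigma>)
    let ?f = "\<lambda>s. w1 s (s - \<sigma>) * along h2 w2 \<sigma> s + along h1 w1 \<sigma> s * w2 s (s - \<sigma>)"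
    have f: "integrable lborel ?f"
      and fe: "along h1 w1 \<sigma> t * along h2 w2 \<sigma> t = h1 \<sigma> * h2 \<sigma> + (LBINT s:{..t}. ?f s)" for t
      using product_rule_indefinite_integral[OF elim(1,2), where a="h1 \<sigma>" and b="h2 \<sigma>"]
      unfolding along_def by blast+
    have "Z \<sigma> = H \<sigma> * (h1 \<sigma> * h2 \<sigma>) + (LBINT s:{..T}. W s (s - \<sigma>) * (h1 \<sigma> * h2 \<sigma> + (LBINT s:{..s}. ?f s)) + along H W \<sigma> s * ?f s)"
      unfolding Z_def fe using product_rule_indefinite_integral(2)[OF elim(3) f, where a="H \<sigma>" and b="h1 \<sigma> * h2 \<sigma>" and t=T]
      by (simp add: along_def[of H W])
    also have "(LBINT s:{..T}. W s (s - \<sigma>) * (h1 \<sigma> * h2 \<sigma> + (LBINT s:{..s}. ?f s)) + along H W \<sigma> s * ?f s) = (LBINT s. k s (s - \<sigma>))"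
      unfolding set_lebesgue_integral_def
    proof (rule Bochner_Integration.integral_cong, rule refl)
      fix s
      show "indicator {..T} s *\<^sub>R (W s (s - \<sigma>) * (h1 \<sigma> * h2 \<sigma> + (LBINT r. indicator {..s} r *\<^sub>R ?f r)) + along H W \<sigma> s * ?f s) = k s (s - \<sigma>)"
      proof (cases "s \<in> {0..T} \<and> s - \<sigma> \<in> {0..Y}")
        case True
        then show ?thesis using HW[of s \<sigma>] fe[of s]
          unfolding k_def W_def q1_def q2_def set_lebesgue_integral_def by simp
      next
        case False
        then have "w1 s (s - \<sigma>) = 0" "w2 s (s - \<sigma>) = 0" "W s (s - \<sigma>) = 0" using sw1 sw2 sW by blast+
        moreover have "k s (s - \<sigma>) = 0" using False unfolding k_def by (auto simp: indicator_def)
        ultimately show ?thesis by simp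
      qed
    qed
    finally show ?case .
  qed
  have sqh: "integrable lborel (\<lambda>\<sigma>. h1 \<sigma> * h2 \<sigma>)"
    using a1 a2 unfolding admissible_data_def by (intro integrable_mult_of_squares) auto
  have Hb: "H \<sigma> * (h1 \<sigma> * h2 \<sigma>) = (h1 \<sigma> * h2 \<sigma>) * b (max 0 (- \<sigma>))" for \<sigma>
  proof (cases "h1 \<sigma> = 0")
    case False
    then have "\<sigma> \<in> {-Y..T}" using sh1 by blast
    then show ?thesis unfolding H_def b_def using Y by (auto simp: indicator_def)
  qed simp
  have Hint: "integrable lborel (\<lambda>\<sigma>. H \<sigma> * (h1 \<sigma> * h2 \<sigma>))"
    unfolding Hb by (rule integrable_mult_bounded[OF sqh _ C(1)]) simp
  have mW[measurable]: "(\<lambda>(s, y). W s y) \<in> borel_measurable (borel \<Otimes>\<^sub>M borel)"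
    using borel_measurable_integrable[OF Wint] by (simp cong: measurable_cong_sets)
  have mH[measurable]: "H \<in> borel_measurable borel"
  proof -
    have "H = (\<lambda>\<sigma>. indicator {-Y..T} \<sigma> * b (max 0 (- \<sigma>)))"
      unfolding H_def b_def using Y by (auto simp: indicator_def fun_eq_iff)
    then show ?thesis by simp
  qed
  have m_along: "(\<lambda>\<sigma>. along h w \<sigma> T) \<in> borel_measurable borel"
    if [measurable]: "h \<in> borel_measurable borel" "(\<lambda>(s, y). w s y) \<in> borel_measurable (borel \<Otimes>\<^sub>M borel)" for h w
  proof -
    have "(\<lambda>\<sigma>. (\<lambda>(t, y). along h w (t - y) t) (T, T - \<sigma>)) \<in> borel_measurable borel"
      using along_measurable[OF that] by measurable
    then show ?thesis by simp
  qed
  have [measurable]: "Z \<in> borel_measurable borel"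
    unfolding Z_def using m_along[OF mH mW] m_along[OF mh(1) mw(1)] m_along[OF mh(2) mw(2)] by measurable
  have kS: "integrable lborel (\<lambda>\<sigma>. LBINT s. k s (s - \<sigma>))" by (rule shear_Fubini(2)[OF kint])
  have Rint: "integrable lborel (\<lambda>\<sigma>. H \<sigma> * (h1 \<sigma> * h2 \<sigma>) + (LBINT s. k s (s - \<sigma>)))" using Hint kS by simp
  have Zint: "integrable lborel Z"
    by (rule integrable_cong_AE_imp[OF Rint]) (use Zae in auto)
  have Zsum: "(LBINT \<sigma>. Z \<sigma>) = (LBINT \<sigma>. H \<sigma> * (h1 \<sigma> * h2 \<sigma>)) + (LBINT t. LBINT y. k t y)"
  proof -
    have "(LBINT \<sigma>. Z \<sigma>) = (LBINT \<sigma>. H \<sigma> * (h1 \<sigma> * h2 \<sigma>) + (LBINT s. k s (s - \<sigma>)))"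
      by (rule integral_cong_AE) (use Zae Rint in auto)
    then show ?thesis using Hint kS shear_Fubini(3)[OF kint] by simp
  qed
  have Z1: "indicator {..T - Y} (t - Y) * Z (t - Y) = indicator {0..T} t *\<^sub>R (\<beta> Y * (q1 t Y * q2 t Y))" for t
  proof (cases "t \<in> {0..T}")
    case True
    have "along H W (t - Y) T = \<beta> Y"
      using along_eventually_constant(2)[OF sW, of "t - Y" T H] HW[of t "t - Y"] True Y by simp
    moreover have "along h1 w1 (t - Y) T = q1 t Y" "along h2 w2 (t - Y) T = q2 t Y"
      using along_eventually_constant(2)[OF sw1, of "t - Y" T h1] along_eventually_constant(2)[OF sw2, of "t - Y" T h2] True
      unfolding q1_def q2_def by auto
    ultimately show ?thesis using True unfolding Z_def by simp
  next
    case False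
    then have "t - Y \<notin> {-Y..T} \<or> t - Y \<notin> {..T - Y}" by auto
    then show ?thesis using along_eq_0[OF sw1 sh1, of "t - Y" T] False unfolding Z_def by auto
  qed
  have Z2: "indicator {T - Y<..} (T - y) * Z (T - y) = indicator {0..<Y} y * (\<beta> y * (q1 T y * q2 T y))" for y
  proof (cases "y \<in> {0..<Y}")
    case True
    then show ?thesis using HW[of T "T - y"] T unfolding Z_def q1_def q2_def by simp
  next
    case False
    then have "T - y \<notin> {-Y..T} \<or> T - y \<notin> {T - Y<..}" by auto
    then show ?thesis using along_eq_0[OF sw1 sh1, of "T - y" T] False unfolding Z_def by auto
  qed
  have ZI: "integrable lborel (\<lambda>\<sigma>. indicator {..T - Y} \<sigma> * Z \<sigma>)" "integrable lborel (\<lambda>\<sigma>. indicator {T - Y<..} \<sigma> * Z \<sigma>)"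
    using integrable_mult_indicator[OF _ Zint, of "{..T - Y}"] integrable_mult_indicator[OF _ Zint, of "{T - Y<..}"] by auto
  show out: "set_integrable lborel {0..T} (\<lambda>t. \<beta> Y * (q1 t Y * q2 t Y))"
    using lborel_integrable_real_affine[OF ZI(1), of 1 "-Y"] unfolding set_integrable_def by (simp add: Z1)
  have oute: "(LBINT \<sigma>. indicator {..T - Y} \<sigma> * Z \<sigma>) = (LBINT t:{0..T}. \<beta> Y * (q1 t Y * q2 t Y))"
    using lborel_integral_real_affine[of 1 "\<lambda>\<sigma>. indicator {..T - Y} \<sigma> * Z \<sigma>" "-Y"]
    unfolding set_lebesgue_integral_def by (simp add: Z1)
  have mT[measurable]: "(\<lambda>y. q1 T y) \<in> borel_measurable borel" "(\<lambda>y. q2 T y) \<in> borel_measurable borel"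
    by measurable
  \<comment> \<open>the label \<open>T - Y\<close>, at which \<open>y = Y\<close> and \<open>t = T\<close>, was counted with the trace\<close>
  have half: "AE y in lborel. indicator {0..<Y} y * (\<beta> y * (q1 T y * q2 T y)) = indicator {0..Y} y *\<^sub>R (\<beta> y * (q1 T y * q2 T y))"
    using AE_lborel_singleton[of Y] by eventually_elim (auto simp: indicator_def)
  have mm: "(\<lambda>y. indicator {0..Y} y *\<^sub>R (\<beta> y * (q1 T y * q2 T y))) \<in> borel_measurable lborel"
  proof -
    have "(\<lambda>y. b y * (q1 T y * q2 T y)) \<in> borel_measurable lborel" by measurable
    then show ?thesis unfolding b_def by (simp add: mult.assoc)
  qed
  have mm': "(\<lambda>y. indicator {0..<Y} y * (\<beta> y * (q1 T y * q2 T y))) \<in> borel_measurable lborel"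
  proof -
    have "(\<lambda>y. indicator {0..<Y} y * (b y * (q1 T y * q2 T y))) \<in> borel_measurable lborel" by measurable
    moreover have "indicator {0..<Y} y * (b y * (q1 T y * q2 T y)) = indicator {0..<Y} y * (\<beta> y * (q1 T y * q2 T y))" for y
      unfolding b_def by (auto simp: indicator_def)
    ultimately show ?thesis by simp
  qed
  have fin: "integrable lborel (\<lambda>y. indicator {0..<Y} y * (\<beta> y * (q1 T y * q2 T y)))"
    using lborel_integrable_real_affine[OF ZI(2), of "-1" T] by (simp add: Z2)
  show "set_integrable lborel {0..Y} (\<lambda>y. \<beta> y * (q1 T y * q2 T y))"
    unfolding set_integrable_def using integrable_cong_AE_imp[OF fin mm] half by simp
  have fine: "(LBINT \<sigma>. indicator {T - Y<..} \<sigma> * Z \<sigma>) = (LBINT y:{0..Y}. \<beta> y * (q1 T y * q2 T y))"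
    using lborel_integral_real_affine[of "-1" "\<lambda>\<sigma>. indicator {T - Y<..} \<sigma> * Z \<sigma>" T] integral_cong_AE[OF mm' mm half]
    unfolding set_lebesgue_integral_def by (simp add: Z2)
  have split: "(LBINT \<sigma>. Z \<sigma>) = (LBINT \<sigma>. indicator {..T - Y} \<sigma> * Z \<sigma>) + (LBINT \<sigma>. indicator {T - Y<..} \<sigma> * Z \<sigma>)"
  proof -
    have "(LBINT \<sigma>. Z \<sigma>) = (LBINT \<sigma>. indicator {..T - Y} \<sigma> * Z \<sigma> + indicator {T - Y<..} \<sigma> * Z \<sigma>)"
      by (rule Bochner_Integration.integral_cong) (auto simp: indicator_def)
    then show ?thesis using ZI by simp
  qed
  let ?S = "\<lambda>\<sigma>. H \<sigma> * (h1 \<sigma> * h2 \<sigma>)"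
  have SI: "integrable lborel (\<lambda>\<sigma>. indicator {..0} \<sigma> * ?S \<sigma>)" "integrable lborel (\<lambda>\<sigma>. indicator {0<..} \<sigma> * ?S \<sigma>)"
    using integrable_mult_indicator[OF _ Hint, of "{..0}"] integrable_mult_indicator[OF _ Hint, of "{0<..}"] by auto
  have "(LBINT \<sigma>. ?S \<sigma>) = (LBINT \<sigma>. indicator {..0} \<sigma> * ?S \<sigma> + indicator {0<..} \<sigma> * ?S \<sigma>)"
    by (rule Bochner_Integration.integral_cong) (auto simp: indicator_def)
  also have "\<dots> = (LBINT \<sigma>. indicator {..0} \<sigma> * ?S \<sigma>) + (LBINT \<sigma>. indicator {0<..} \<sigma> * ?S \<sigma>)" using SI by simp
  also have "(LBINT \<sigma>. indicator {..0} \<sigma> * ?S \<sigma>) = (LBINT y. indicator {..0} (- y) * ?S (- y))"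
    using lborel_integral_real_affine[of "-1" "\<lambda>\<sigma>. indicator {..0} \<sigma> * ?S \<sigma>" 0] by simp
  also have "\<dots> = (LBINT y:{0..Y}. \<beta> y * (h1 (- y) * h2 (- y)))"
    unfolding set_lebesgue_integral_def
  proof (rule Bochner_Integration.integral_cong, rule refl)
    fix y
    show "indicator {..0} (- y) * ?S (- y) = indicator {0..Y} y *\<^sub>R (\<beta> y * (h1 (- y) * h2 (- y)))"
      unfolding H_def using T Y by (auto simp: indicator_def max_def)
  qed
  also have "(LBINT \<sigma>. indicator {0<..} \<sigma> * ?S \<sigma>) = (LBINT t:{0..T}. \<beta> 0 * (h1 t * h2 t))"
    unfolding set_lebesgue_integral_def
  proof (rule integral_cong_AE)
    show "AE t in lborel. indicator {0<..} t * ?S t = indicator {0..T} t *\<^sub>R (\<beta> 0 * (h1 t * h2 t))"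
      using AE_lborel_singleton[of 0] by eventually_elim (use Y in \<open>auto simp: indicator_def H_def max_def\<close>)
  qed measurable
  finally have start: "(LBINT \<sigma>. ?S \<sigma>) = (LBINT y:{0..Y}. \<beta> y * (h1 (- y) * h2 (- y))) + (LBINT t:{0..T}. \<beta> 0 * (h1 t * h2 t))" .
  show "(LBINT y:{0..Y}. \<beta> y * (q1 T y * q2 T y)) + (LBINT t:{0..T}. \<beta> Y * (q1 t Y * q2 t Y))
      = (LBINT y:{0..Y}. \<beta> y * (h1 (- y) * h2 (- y))) + (LBINT t:{0..T}. \<beta> 0 * (h1 t * h2 t))
        + (LBINT t. LBINT y. k t y)"
    using Zsum start split oute fine by simp
qed

section \<open>Travel time along characteristics\<close>

lemma borel_product_measurability:
  fixes f :: "real \<Rightarrow> real \<Rightarrow> real"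
  shows "set_borel_measurable lborel (A \<times> B) (\<lambda>(t, x). f t x)
    \<longleftrightarrow> (\<lambda>(t, x). indicator A t * indicator B x * f t x) \<in> borel_measurable (borel \<Otimes>\<^sub>M borel)"
proof -
  have "(\<lambda>p. indicator (A \<times> B) p *\<^sub>R (case p of (t, x) \<Rightarrow> f t x)) = (\<lambda>(t, x). indicator A t * indicator B x * f t x)"
    by (auto simp: indicator_def fun_eq_iff)
  then show ?thesis unfolding set_borel_measurable_def by (simp add: borel_prod)
qed

lemma set_integrable_product:
  fixes f :: "real \<Rightarrow> real \<Rightarrow> real"
  shows "set_integrable lborel (A \<times> B) (\<lambda>(t, x). f t x)
    \<longleftrightarrow> integrable (lborel \<Otimes>\<^sub>M lborel) (\<lambda>(t, x). indicator A t * indicator B x * f t x)"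
proof -
  have "(\<lambda>p. indicator (A \<times> B) p *\<^sub>R (case p of (t, x) \<Rightarrow> f t x)) = (\<lambda>(t, x). indicator A t * indicator B x * f t x)"
    by (auto simp: indicator_def fun_eq_iff)
  then show ?thesis unfolding set_integrable_def by (simp add: lborel_prod)
qed

lemma set_integral_product:
  fixes f :: "real \<Rightarrow> real \<Rightarrow> real"
  assumes "set_integrable lborel (A \<times> B) (\<lambda>(t, x). f t x)"
  shows "(LBINT p:A \<times> B. (case p of (t, x) \<Rightarrow> f t x)) = (LBINT t:A. LBINT x:B. f t x)"
    and "set_integrable lborel A (\<lambda>t. LBINT x:B. f t x)"
proof -
  have i: "integrable (lborel \<Otimes>\<^sub>M lborel) (\<lambda>(t, x). indicator A t * indicator B x * f t x)"
    using assms unfolding set_integrable_product .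
  show "(LBINT p:A \<times> B. (case p of (t, x) \<Rightarrow> f t x)) = (LBINT t:A. LBINT x:B. f t x)"
  proof -
    have "(\<lambda>p. indicator (A \<times> B) p *\<^sub>R (case p of (t, x) \<Rightarrow> f t x)) = (\<lambda>(t, x). indicator A t * indicator B x * f t x)"
      by (auto simp: indicator_def fun_eq_iff)
    then show ?thesis
      using lborel_pair.integral_fst[OF i] unfolding set_lebesgue_integral_def by (simp add: lborel_prod mult.assoc)
  qed
  show "set_integrable lborel A (\<lambda>t. LBINT x:B. f t x)"
    using lborel_pair.integrable_fst[OF i] unfolding set_lebesgue_integral_def set_integrable_def
    by (simp add: mult.assoc)
qed

text \<open>
  \<open>P x\<close> is the time that a characteristic needs from the inflow end \<open>b\<close> to \<open>x\<close>, \<open>X\<close> is its inverse, \<open>c\<close> is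
  the outflow end and \<open>\<kappa>\<close> the sign of the speed \<open>d\<close>. Both components of the system are instances:
  the first with \<open>b = 0\<close>, \<open>\<kappa> = 1\<close>, the second with \<open>b = L\<close>, \<open>\<kappa> = - 1\<close>.
\<close>

locale travel =
  fixes L Y b c \<kappa> :: real and d P X :: "real \<Rightarrow> real"
  assumes L_pos: "0 < L" and Y_pos: "0 < Y"
    and ends: "b \<in> {0..L}" "c \<in> {0..L}" "P b = 0" "P c = Y"
    and b_c: "{b, c} = {0, L}"
    and d_cont: "continuous_on {0..L} d" and d_sign: "\<And>x. x \<in> {0..L} \<Longrightarrow> 0 < \<kappa> * d x"
    and orientation: "\<kappa> = 1 \<or> \<kappa> = -1"
    and P_in: "\<And>x. x \<in> {0..L} \<Longrightarrow> P x \<in> {0..Y}" and X_in: "\<And>y. y \<in> {0..Y} \<Longrightarrow> X y \<in> {0..L}"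
    and X_P: "\<And>x. x \<in> {0..L} \<Longrightarrow> X (P x) = x" and P_X: "\<And>y. y \<in> {0..Y} \<Longrightarrow> P (X y) = y"
    and P_der: "\<And>x. x \<in> {0..L} \<Longrightarrow> (P has_real_derivative 1 / d x) (at x within {0..L})"
    and X_der: "\<And>y. y \<in> {0..Y} \<Longrightarrow> (X has_real_derivative d (X y)) (at y within {0..Y})"
begin

lemma abs_speed: "x \<in> {0..L} \<Longrightarrow> \<bar>d x\<bar> = \<kappa> * d x"
  using d_sign[of x] orientation by auto

lemma d_nonzero: "x \<in> {0..L} \<Longrightarrow> d x \<noteq> 0"
  using d_sign[of x] by auto

lemma X_0: "X 0 = b" and X_Y: "X Y = c"
  using X_P[OF ends(1)] X_P[OF ends(2)] ends by auto

lemma X_cont: "continuous_on {0..Y} X"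
  using X_der by (meson DERIV_continuous continuous_on_eq_continuous_within)

lemma P_cont: "continuous_on {0..L} P"
  using P_der by (meson DERIV_continuous continuous_on_eq_continuous_within)

text \<open>
  \<open>X\<close> continued by constants beyond \<open>[0, Y]\<close>, which makes it continuous and hence Borel on the whole line.
\<close>

definition Xe :: "real \<Rightarrow> real" where "Xe y = X (max 0 (min Y y))"

lemma Xe_eq: "y \<in> {0..Y} \<Longrightarrow> Xe y = X y"
  unfolding Xe_def by (auto simp: max_def min_def)

lemma Xe_in: "Xe y \<in> {0..L}"
  unfolding Xe_def using X_in[of "max 0 (min Y y)"] Y_pos by (auto simp: max_def min_def)

lemma Xe_continuous: "continuous_on UNIV Xe"
  unfolding Xe_def by (rule continuous_on_compose2[OF X_cont]) (use Y_pos in \<open>auto intro!: continuous_intros\<close>)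

lemma Xe_measurable[measurable]: "Xe \<in> borel_measurable borel"
  using Xe_continuous borel_measurable_continuous_onI by blast

text \<open>
  \<open>P\<close> is differentiable and therefore maps null sets to null sets.
\<close>

lemma AE_change_of_variable:
  assumes "AE x\<in>{0..L} in lborel. Q x"
  shows "AE y\<in>{0..Y} in lborel. Q (X y)"
proof -
  obtain N where N: "N \<in> null_sets lborel" "{x. \<not> (x \<in> {0..L} \<longrightarrow> Q x)} \<subseteq> N"
    using assms unfolding eventually_ae_filter by auto
  have neg: "negligible (N \<inter> {0..L})"
    using N(1) negligible_iff_null_sets negligible_subset null_sets_completionI by (metis inf_le1)
  have "P differentiable_on (N \<inter> {0..L})"
    unfolding differentiable_on_def
  proof
    fix x assume "x \<in> N \<inter> {0..L}"
    then have "(P has_real_derivative 1 / d x) (at x within N \<inter> {0..L})"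
      using DERIV_subset[OF P_der] by blast
    then show "P differentiable (at x within N \<inter> {0..L})"
      using real_differentiable_def by blast
  qed
  then have "negligible (P ` (N \<inter> {0..L}))"
    by (intro negligible_differentiable_image_negligible[OF _ neg]) auto
  then have "AE y in lebesgue. y \<notin> P ` (N \<inter> {0..L})"
    using negligible_iff_null_sets AE_not_in by blast
  then have "AE y in lborel. y \<notin> P ` (N \<inter> {0..L})"
    by (simp add: AE_completion_iff)
  then show ?thesis
  proof eventually_elim
    case (elim y)
    show ?case
    proof
      assume y: "y \<in> {0..Y}"
      have "X y \<notin> N"
      proof
        assume "X y \<in> N"
        then have "P (X y) \<in> P ` (N \<inter> {0..L})" using X_in[OF y] by blast
        then show False using elim P_X[OF y] by simp
      qed
      then show "Q (X y)" using N(2) X_in[OF y] by blast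
    qed
  qed
qed

lemma measurable_change_of_variable:
  fixes F :: "real \<Rightarrow> real"
  assumes "set_borel_measurable lborel {0..L} F"
  shows "set_borel_measurable lborel {0..Y} (\<lambda>y. F (X y))"
proof -
  have "(\<lambda>x. indicator {0..L} x *\<^sub>R F x) \<in> borel_measurable borel"
    using assms unfolding set_borel_measurable_def by simp
  from measurable_compose[OF Xe_measurable this]
  have "(\<lambda>y. indicator {0..Y} y * (indicator {0..L} (Xe y) *\<^sub>R F (Xe y))) \<in> borel_measurable borel"
    by (intro borel_measurable_times) auto
  moreover have "(\<lambda>y. indicator {0..Y} y * (indicator {0..L} (Xe y) *\<^sub>R F (Xe y))) = (\<lambda>y. indicator {0..Y} y *\<^sub>R F (X y))"
  proof
    fix y
    show "indicator {0..Y} y * (indicator {0..L} (Xe y) *\<^sub>R F (Xe y)) = indicator {0..Y} y *\<^sub>R F (X y)"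
      using Xe_in[of y] Xe_eq[of y] by (cases "y \<in> {0..Y}") simp_all
  qed
  ultimately show ?thesis unfolding set_borel_measurable_def by simp
qed

lemma change_of_variable:
  fixes F :: "real \<Rightarrow> real"
  assumes F: "set_borel_measurable lborel {0..L} F"
  shows "set_integrable lborel {0..Y} (\<lambda>y. \<bar>d (X y)\<bar> * F (X y)) \<longleftrightarrow> set_integrable lborel {0..L} F"
    and "(LBINT y:{0..Y}. \<bar>d (X y)\<bar> * F (X y)) = (LBINT x:{0..L}. F x)"
proof -
  have img: "X ` {0..Y} = {0..L}"
  proof
    show "X ` {0..Y} \<subseteq> {0..L}" using X_in by blast
    show "{0..L} \<subseteq> X ` {0..Y}"
    proof
      fix x assume x: "x \<in> {0..L}"
      show "x \<in> X ` {0..Y}" using image_eqI[of x X "P x" "{0..Y}"] X_P[OF x] P_in[OF x] by simp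
    qed
  qed
  have inj: "inj_on X {0..Y}" using P_X by (metis inj_onI)
  have leb: "set_integrable lborel S G \<longleftrightarrow> G absolutely_integrable_on S"
    if "set_borel_measurable lborel S G" for S and G :: "real \<Rightarrow> real"
    using that integrable_completion unfolding set_integrable_def set_borel_measurable_def by blast
  have dX: "set_borel_measurable lborel {0..Y} (\<lambda>y. \<bar>d (X y)\<bar>)"
  proof -
    have "continuous_on {0..Y} (\<lambda>y. d (X y))"
      by (rule continuous_on_compose2[OF d_cont X_cont]) (use X_in in blast)
    then have "continuous_on {0..Y} (\<lambda>y. \<bar>d (X y)\<bar>)" by (rule continuous_on_rabs)
    then show ?thesis
      using borel_measurable_continuous_on_indicator[of "{0..Y}" "\<lambda>y. \<bar>d (X y)\<bar>"] unfolding set_borel_measurable_def by simp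
  qed
  have "set_borel_measurable lborel {0..Y} (\<lambda>y. \<bar>d (X y)\<bar> * F (X y))"
  proof -
    have "(\<lambda>y. (indicator {0..Y} y *\<^sub>R \<bar>d (X y)\<bar>) * (indicator {0..Y} y *\<^sub>R F (X y))) \<in> borel_measurable lborel"
      using dX measurable_change_of_variable[OF F] unfolding set_borel_measurable_def
      by (intro borel_measurable_times)
    moreover have "(\<lambda>y. (indicator {0..Y} y *\<^sub>R \<bar>d (X y)\<bar>) * (indicator {0..Y} y *\<^sub>R F (X y))) =
        (\<lambda>y. indicator {0..Y} y *\<^sub>R (\<bar>d (X y)\<bar> * F (X y)))"
      by (auto simp: indicator_def fun_eq_iff)
    ultimately show ?thesis unfolding set_borel_measurable_def by simp
  qed
  note lebY = leb[OF this] and lebL = leb[OF F]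
  have cov: "(\<lambda>y. \<bar>d (X y)\<bar> * F (X y)) absolutely_integrable_on {0..Y} \<and>
           integral {0..Y} (\<lambda>y. \<bar>d (X y)\<bar> * F (X y)) = B
     \<longleftrightarrow> F absolutely_integrable_on {0..L} \<and> integral {0..L} F = B" for B
    using has_absolute_integral_change_of_variables_1'[OF _ X_der inj, of F B] img by auto
  show iff: "set_integrable lborel {0..Y} (\<lambda>y. \<bar>d (X y)\<bar> * F (X y)) \<longleftrightarrow> set_integrable lborel {0..L} F"
    using cov lebY lebL by blast
  show "(LBINT y:{0..Y}. \<bar>d (X y)\<bar> * F (X y)) = (LBINT x:{0..L}. F x)"
  proof (cases "set_integrable lborel {0..L} F")
    case True
    then show ?thesis using cov[of "integral {0..L} F"] iff lebL
      by (simp add: set_borel_integral_eq_integral(2))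
  next
    case False
    then show ?thesis using iff
      unfolding set_integrable_def set_lebesgue_integral_def by (simp add: not_integrable_integral_eq)
  qed
qed

lemma speed_bounds:
  obtains D where "0 < D" "\<And>x. x \<in> {0..L} \<Longrightarrow> \<bar>d x\<bar> \<le> D" "\<And>x. x \<in> {0..L} \<Longrightarrow> inverse \<bar>d x\<bar> \<le> D"
proof -
  have "continuous_on {0..L} (\<lambda>x. inverse \<bar>d x\<bar>)"
    using d_cont d_nonzero by (auto intro!: continuous_intros)
  then have "bounded (d ` {0..L})" "bounded ((\<lambda>x. inverse \<bar>d x\<bar>) ` {0..L})"
    using d_cont compact_continuous_image compact_imp_bounded by blast+
  then obtain D1 D2 where "\<And>x. x \<in> {0..L} \<Longrightarrow> \<bar>d x\<bar> \<le> D1" "\<And>x. x \<in> {0..L} \<Longrightarrow> \<bar>inverse \<bar>d x\<bar>\<bar> \<le> D2"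
    unfolding bounded_iff real_norm_def by (metis imageI)
  then show ?thesis using that[of "max 1 (max D1 D2)"] by (fastforce simp: le_max_iff_disj)
qed

lemma speed_measurable: "(\<lambda>x. indicator {0..L} x * inverse \<bar>d x\<bar>) \<in> borel_measurable borel"
proof -
  have "continuous_on {0..L} (\<lambda>x. inverse \<bar>d x\<bar>)"
    using d_cont d_nonzero by (auto intro!: continuous_intros)
  then show ?thesis using borel_measurable_continuous_on_indicator[of "{0..L}" "\<lambda>x. inverse \<bar>d x\<bar>"] by simp
qed

text \<open>Dividing by the speed before substituting removes the Jacobian.\<close>

lemma integrable_pullback:
  fixes F :: "real \<Rightarrow> real"
  assumes "set_integrable lborel {0..L} F"
  shows "set_integrable lborel {0..Y} (\<lambda>y. F (X y))"
    and "(LBINT y:{0..Y}. F (X y)) = (LBINT x:{0..L}. inverse \<bar>d x\<bar> * F x)"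
proof -
  obtain D where D: "0 < D" "\<And>x. x \<in> {0..L} \<Longrightarrow> inverse \<bar>d x\<bar> \<le> D" using speed_bounds by metis
  have "integrable lborel (\<lambda>x. (indicator {0..L} x *\<^sub>R F x) * (indicator {0..L} x * inverse \<bar>d x\<bar>))"
    by (rule integrable_mult_bounded[where B=D])
      (use assms D speed_measurable in \<open>auto simp: set_integrable_def indicator_def\<close>)
  moreover have "(\<lambda>x. (indicator {0..L} x *\<^sub>R F x) * (indicator {0..L} x * inverse \<bar>d x\<bar>)) = (\<lambda>x. indicator {0..L} x *\<^sub>R (inverse \<bar>d x\<bar> * F x))"
    by (auto simp: indicator_def fun_eq_iff)
  ultimately have i: "set_integrable lborel {0..L} (\<lambda>x. inverse \<bar>d x\<bar> * F x)"
    unfolding set_integrable_def by simp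
  then have m: "set_borel_measurable lborel {0..L} (\<lambda>x. inverse \<bar>d x\<bar> * F x)"
    unfolding set_borel_measurable_def set_integrable_def by auto
  have e: "\<bar>d (X y)\<bar> * (inverse \<bar>d (X y)\<bar> * F (X y)) = F (X y)" if "y \<in> {0..Y}" for y
    using d_nonzero[OF X_in[OF that]] by simp
  have "set_integrable lborel {0..Y} (\<lambda>y. \<bar>d (X y)\<bar> * (inverse \<bar>d (X y)\<bar> * F (X y)))"
    using change_of_variable(1)[OF m] i by simp
  then show "set_integrable lborel {0..Y} (\<lambda>y. F (X y))"
    using e set_integrable_cong[OF refl refl, of "{0..Y}" "\<lambda>y. \<bar>d (X y)\<bar> * (inverse \<bar>d (X y)\<bar> * F (X y))" "\<lambda>y. F (X y)" lborel]
    by simp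
  show "(LBINT y:{0..Y}. F (X y)) = (LBINT x:{0..L}. inverse \<bar>d x\<bar> * F x)"
    unfolding change_of_variable(2)[OF m, symmetric] using e
    unfolding set_lebesgue_integral_def by (intro Bochner_Integration.integral_cong) (auto simp: indicator_def)
qed

lemma joint_measurable_pullback:
  fixes G :: "real \<Rightarrow> real \<Rightarrow> real"
  assumes "set_borel_measurable lborel ({0..T} \<times> {0..L}) (\<lambda>(t, x). G t x)"
  shows "(\<lambda>(t, y). indicator {0..T} t * indicator {0..Y} y * G t (X y)) \<in> borel_measurable (borel \<Otimes>\<^sub>M borel)"
proof -
  have [measurable]: "(\<lambda>(t, x). indicator {0..T} t * indicator {0..L} x * G t x) \<in> borel_measurable (borel \<Otimes>\<^sub>M borel)"
    using assms unfolding borel_product_measurability .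
  have "(\<lambda>(t, y). indicator {0..Y} y * (indicator {0..T} t * indicator {0..L} (Xe y) * G t (Xe y))) \<in> borel_measurable (borel \<Otimes>\<^sub>M borel)"
    by measurable
  moreover have "(\<lambda>(t, y). indicator {0..Y} y * (indicator {0..T} t * indicator {0..L} (Xe y) * G t (Xe y)))
      = (\<lambda>(t, y). indicator {0..T} t * indicator {0..Y} y * G t (X y))"
  proof (rule ext, clarify)
    fix t y
    show "indicator {0..Y} y * (indicator {0..T} t * indicator {0..L} (Xe y) * G t (Xe y))
      = indicator {0..T} t * indicator {0..Y} y * G t (X y)"
      using Xe_in[of y] Xe_eq[of y] by (cases "y \<in> {0..Y}") simp_all
  qed
  ultimately show ?thesis by simp
qed

lemma joint_integrable_pullback:
  fixes G :: "real \<Rightarrow> real \<Rightarrow> real"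
  assumes G: "set_integrable lborel ({0..T} \<times> {0..L}) (\<lambda>(t, x). G t x)"
  shows "integrable (lborel \<Otimes>\<^sub>M lborel) (\<lambda>(t, y). indicator {0..T} t * indicator {0..Y} y * G t (X y))"
proof (rule lborel_pair.Fubini_integrable)
  obtain D where D: "0 < D" "\<And>x. x \<in> {0..L} \<Longrightarrow> inverse \<bar>d x\<bar> \<le> D" using speed_bounds by metis
  have GL: "integrable (lborel \<Otimes>\<^sub>M lborel) (\<lambda>(t, x). indicator {0..T} t * indicator {0..L} x * G t x)"
    using G unfolding set_integrable_product .
  have mG: "set_borel_measurable lborel ({0..T} \<times> {0..L}) (\<lambda>(t, x). G t x)"
    using G unfolding set_integrable_def set_borel_measurable_def by auto
  have m[measurable]: "(\<lambda>(t, y). indicator {0..T} t * indicator {0..Y} y * G t (X y)) \<in> borel_measurable (borel \<Otimes>\<^sub>M borel)"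
    by (rule joint_measurable_pullback[OF mG])
  show "(\<lambda>(t, y). indicator {0..T} t * indicator {0..Y} y * G t (X y)) \<in> borel_measurable (lborel \<Otimes>\<^sub>M lborel)"
    using m by (simp cong: measurable_cong_sets)
  have sec: "AE t in lborel. t \<in> {0..T} \<longrightarrow> set_integrable lborel {0..L} (G t)"
    using lborel_pair.AE_integrable_fst[OF GL] by eventually_elim (auto simp: set_integrable_def indicator_def)
  show "AE t in lborel. integrable lborel (\<lambda>y. case (t, y) of (t, y) \<Rightarrow> indicator {0..T} t * indicator {0..Y} y * G t (X y))"
    using sec
  proof eventually_elim
    case (elim t)
    show ?case
    proof (cases "t \<in> {0..T}")
      case True
      then show ?thesis using integrable_pullback(1)[of "G t"] elim unfolding set_integrable_def by simp
    qed simp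
  qed
  have I: "integrable lborel (\<lambda>t. D * (LBINT x. norm (indicator {0..T} t * indicator {0..L} x * G t x)))"
    using lborel_pair.integrable_fst[of "\<lambda>t x. norm (indicator {0..T} t * indicator {0..L} x * G t x)"] integrable_norm[OF GL]
    by (simp add: case_prod_unfold)
  show "integrable lborel (\<lambda>t. LBINT y. norm (case (t, y) of (t, y) \<Rightarrow> indicator {0..T} t * indicator {0..Y} y * G t (X y)))"
  proof (rule Bochner_Integration.integrable_bound[OF I])
    show "(\<lambda>t. LBINT y. norm (case (t, y) of (t, y) \<Rightarrow> indicator {0..T} t * indicator {0..Y} y * G t (X y))) \<in> borel_measurable lborel"
      by (rule lborel.borel_measurable_lebesgue_integral) measurable
    show "AE t in lborel. norm (LBINT y. norm (case (t, y) of (t, y) \<Rightarrow> indicator {0..T} t * indicator {0..Y} y * G t (X y)))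
        \<le> norm (D * (LBINT x. norm (indicator {0..T} t * indicator {0..L} x * G t x)))"
      using sec
    proof eventually_elim
      case (elim t)
      show ?case
      proof (cases "t \<in> {0..T}")
        case True
        then have gi: "set_integrable lborel {0..L} (\<lambda>x. \<bar>G t x\<bar>)" using elim set_integrable_abs by blast
        have "(LBINT y. norm (case (t, y) of (t, y) \<Rightarrow> indicator {0..T} t * indicator {0..Y} y * G t (X y)))
            = (LBINT y:{0..Y}. \<bar>G t (X y)\<bar>)"
          using True unfolding set_lebesgue_integral_def by (simp add: abs_mult)
        also have "\<dots> = (LBINT x:{0..L}. inverse \<bar>d x\<bar> * \<bar>G t x\<bar>)"
          by (rule integrable_pullback(2)[OF gi])
        also have "\<dots> \<le> (LBINT x:{0..L}. D * \<bar>G t x\<bar>)"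
          unfolding set_lebesgue_integral_def
        proof (rule integral_mono')
          show "integrable lborel (\<lambda>x. indicator {0..L} x *\<^sub>R (D * \<bar>G t x\<bar>))"
            using set_integrable_mult_right[OF gi, of D] unfolding set_integrable_def by simp
          show "indicator {0..L} x *\<^sub>R (inverse \<bar>d x\<bar> * \<bar>G t x\<bar>) \<le> indicator {0..L} x *\<^sub>R (D * \<bar>G t x\<bar>)" for x
            using D(2)[of x] by (auto simp: indicator_def intro!: mult_right_mono)
          show "0 \<le> indicator {0..L} x *\<^sub>R (D * \<bar>G t x\<bar>)" for x
            using D(1) by (auto simp: indicator_def)
        qed
        also have "\<dots> = D * (LBINT x. norm (indicator {0..T} t * indicator {0..L} x * G t x))"
          using True unfolding set_lebesgue_integral_def by (simp add: abs_mult mult.left_commute)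
        finally have "(LBINT y. norm (case (t, y) of (t, y) \<Rightarrow> indicator {0..T} t * indicator {0..Y} y * G t (X y)))
            \<le> D * (LBINT x. norm (indicator {0..T} t * indicator {0..L} x * G t x))" .
        moreover have "0 \<le> (LBINT y. norm (case (t, y) of (t, y) \<Rightarrow> indicator {0..T} t * indicator {0..Y} y * G t (X y)))"
          by simp
        moreover have "norm p \<le> norm q" if "p \<le> q" "0 \<le> p" for p q :: real using that by simp
        ultimately show ?thesis by blast
      qed simp
    qed
  qed
qed

text \<open>
  The value that \<open>\<rho>\<^sub>t + d \<rho>\<^sub>x = \<omega>\<close> transports to \<open>(t, x)\<close>: the characteristic is at \<open>X (P x - t + s)\<close> at
  time \<open>s\<close> and comes from the initial line if \<open>t \<le> P x\<close>, otherwise from the inflow end.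
\<close>

definition arrival :: "(real \<Rightarrow> real) \<Rightarrow> (real \<Rightarrow> real) \<Rightarrow> (real \<Rightarrow> real \<Rightarrow> real) \<Rightarrow> real \<Rightarrow> real \<Rightarrow> real" where
  "arrival \<rho>0 g \<omega> t x = (if t \<le> P x then \<rho>0 (X (P x - t)) else g (t - P x))
     + (LBINT s:{max 0 (t - P x)..t}. \<omega> s (X (P x - t + s)))"

text \<open>
  The last clause fixes the outgoing trace, which the equations for almost every \<open>x\<close> do not see.
\<close>

definition solution :: "real \<Rightarrow> (real \<Rightarrow> real) \<Rightarrow> (real \<Rightarrow> real) \<Rightarrow> (real \<Rightarrow> real \<Rightarrow> real) \<Rightarrow> (real \<Rightarrow> real \<Rightarrow> real) \<Rightarrow> bool" where
  "solution T \<rho>0 g \<omega> \<rho> \<longleftrightarrow>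
     set_borel_measurable lborel {0..L} \<rho>0 \<and> set_integrable lborel {0..L} (\<lambda>x. (\<rho>0 x)\<^sup>2) \<and>
     set_borel_measurable lborel {0..T} g \<and> set_integrable lborel {0..T} (\<lambda>t. (g t)\<^sup>2) \<and>
     set_borel_measurable lborel ({0..T} \<times> {0..L}) (\<lambda>(t, x). \<omega> t x) \<and>
     set_integrable lborel ({0..T} \<times> {0..L}) (\<lambda>(t, x). (\<omega> t x)\<^sup>2) \<and>
     set_borel_measurable lborel ({0..T} \<times> {0..L}) (\<lambda>(t, x). \<rho> t x) \<and>
     set_integrable lborel ({0..T} \<times> {0..L}) (\<lambda>(t, x). (\<rho> t x)\<^sup>2) \<and>
     (\<forall>t\<in>{0..T}. AE x\<in>{0..L} in lborel. \<rho> t x = arrival \<rho>0 g \<omega> t x) \<and>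
     (AE t\<in>{0..T} in lborel. \<rho> t c = arrival \<rho>0 g \<omega> t c)"

definition label_data :: "real \<Rightarrow> (real \<Rightarrow> real) \<Rightarrow> (real \<Rightarrow> real) \<Rightarrow> real \<Rightarrow> real" where
  "label_data T \<rho>0 g \<sigma> = indicator {-Y..T} \<sigma> * (if \<sigma> \<le> 0 then \<rho>0 (X (- \<sigma>)) else g \<sigma>)"

definition label_source :: "real \<Rightarrow> (real \<Rightarrow> real \<Rightarrow> real) \<Rightarrow> real \<Rightarrow> real \<Rightarrow> real" where
  "label_source T \<omega> s y = indicator {0..T} s * indicator {0..Y} y * \<omega> s (X y)"

text \<open>
  The cut-off data and source reproduce the transported value: on the rectangle the cut-offs are
  invisible.
\<close>

lemma along_arrival:
  assumes t: "t \<in> {0..T}" and y: "y \<in> {0..Y}"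
  shows "along (label_data T \<rho>0 g) (label_source T \<omega>) (t - y) t = arrival \<rho>0 g \<omega> t (X y)"
proof -
  have "(LBINT s:{..t}. label_source T \<omega> s (s - (t - y))) = (LBINT s:{max 0 (t - y)..t}. \<omega> s (X (y - t + s)))"
    unfolding set_lebesgue_integral_def
  proof (rule Bochner_Integration.integral_cong, rule refl)
    fix s
    have e: "s - (t - y) = y - t + s" by simp
    show "indicator {..t} s *\<^sub>R label_source T \<omega> s (s - (t - y)) = indicator {max 0 (t - y)..t} s *\<^sub>R \<omega> s (X (y - t + s))"
      unfolding label_source_def e using t y by (auto simp: indicator_def)
  qed
  then show ?thesis using t y P_X[OF y] unfolding along_def arrival_def label_data_def by auto
qed

lemma solution_admissible:
  assumes sol: "solution T \<rho>0 g \<omega> \<rho>" and T: "0 < T"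
  shows "admissible_data T Y (label_data T \<rho>0 g) (label_source T \<omega>)"
    and "\<And>t. t \<in> {0..T} \<Longrightarrow> AE y\<in>{0..Y} in lborel. along (label_data T \<rho>0 g) (label_source T \<omega>) (t - y) t = \<rho> t (X y)"
    and "AE t\<in>{0..T} in lborel. along (label_data T \<rho>0 g) (label_source T \<omega>) (t - Y) t = \<rho> t c"
proof -
  let ?h = "label_data T \<rho>0 g" and ?w = "label_source T \<omega>"
  note s = sol[unfolded solution_def]
  show ae: "AE y\<in>{0..Y} in lborel. along ?h ?w (t - y) t = \<rho> t (X y)" if t: "t \<in> {0..T}" for t
  proof -
    have "AE x\<in>{0..L} in lborel. \<rho> t x = arrival \<rho>0 g \<omega> t x" using s t by blast
    from AE_change_of_variable[OF this] show ?thesis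
    proof (rule eventually_mono)
      fix y assume "y \<in> {0..Y} \<longrightarrow> \<rho> t (X y) = arrival \<rho>0 g \<omega> t (X y)"
      then show "y \<in> {0..Y} \<longrightarrow> along ?h ?w (t - y) t = \<rho> t (X y)"
        using along_arrival[OF t, of y \<rho>0 g \<omega>] by (metis (no_types))
    qed
  qed
  have "AE t\<in>{0..T} in lborel. \<rho> t c = arrival \<rho>0 g \<omega> t c" using s by blast
  then show "AE t\<in>{0..T} in lborel. along ?h ?w (t - Y) t = \<rho> t c"
  proof (rule eventually_mono)
    fix t assume e: "t \<in> {0..T} \<longrightarrow> \<rho> t c = arrival \<rho>0 g \<omega> t c"
    have "Y \<in> {0..Y}" using Y_pos by simp
    then show "t \<in> {0..T} \<longrightarrow> along ?h ?w (t - Y) t = \<rho> t c"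
      using e along_arrival[of t T Y \<rho>0 g \<omega>] X_Y by simp
  qed
  have mr: "(\<lambda>y. indicator {0..Y} y * \<rho>0 (X y)) \<in> borel_measurable borel"
    using measurable_change_of_variable[of \<rho>0] s unfolding set_borel_measurable_def by simp
  have mg: "(\<lambda>t. indicator {0..T} t * g t) \<in> borel_measurable borel"
    using s unfolding set_borel_measurable_def by simp
  have he: "?h \<sigma> = indicator {..0} \<sigma> * (indicator {0..Y} (- \<sigma>) * \<rho>0 (X (- \<sigma>))) + indicator {0<..} \<sigma> * (indicator {0..T} \<sigma> * g \<sigma>)" for \<sigma>
    unfolding label_data_def using T Y_pos by (auto simp: indicator_def)
  have mh: "?h \<in> borel_measurable borel"
    unfolding he[abs_def] using mr mg by measurable
  have "integrable lborel (\<lambda>\<sigma>. indicator {0..Y} \<sigma> *\<^sub>R (\<rho>0 (X \<sigma>))\<^sup>2)"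
    using integrable_pullback(1)[of "\<lambda>x. (\<rho>0 x)\<^sup>2"] s unfolding set_integrable_def by blast
  from lborel_integrable_real_affine[OF this, of "-1" 0]
  have h1: "integrable lborel (\<lambda>\<sigma>. indicator {0..Y} (- \<sigma>) *\<^sub>R (\<rho>0 (X (- \<sigma>)))\<^sup>2)" by simp
  have h2: "integrable lborel (\<lambda>t. indicator {0..T} t *\<^sub>R (g t)\<^sup>2)"
    using s unfolding set_integrable_def by blast
  have hh: "integrable lborel (\<lambda>\<sigma>. (?h \<sigma>)\<^sup>2)"
  proof (rule Bochner_Integration.integrable_bound[OF Bochner_Integration.integrable_add[OF h1 h2]])
    show "(\<lambda>\<sigma>. (?h \<sigma>)\<^sup>2) \<in> borel_measurable lborel" using mh by simp
  qed (auto simp: he indicator_def)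
  have mw: "(\<lambda>(s, y). ?w s y) \<in> borel_measurable (borel \<Otimes>\<^sub>M borel)"
    using joint_measurable_pullback[of T \<omega>] s unfolding label_source_def by blast
  have iw: "integrable (lborel \<Otimes>\<^sub>M lborel) (\<lambda>(s, y). (?w s y)\<^sup>2)"
  proof -
    have "(\<lambda>(s, y). (?w s y)\<^sup>2) = (\<lambda>(t, y). indicator {0..T} t * indicator {0..Y} y * (\<omega> t (X y))\<^sup>2)"
      unfolding label_source_def by (auto simp: indicator_def fun_eq_iff)
    then show ?thesis using joint_integrable_pullback[of T "\<lambda>t x. (\<omega> t x)\<^sup>2"] s by simp
  qed
  have mq[measurable]: "(\<lambda>(t, y). along ?h ?w (t - y) t) \<in> borel_measurable (borel \<Otimes>\<^sub>M borel)"
    by (rule along_measurable[OF mh mw])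
  have ir: "integrable (lborel \<Otimes>\<^sub>M lborel) (\<lambda>(t, y). indicator {0..T} t * indicator {0..Y} y * (\<rho> t (X y))\<^sup>2)"
    using joint_integrable_pullback[of T "\<lambda>t x. (\<rho> t x)\<^sup>2"] s by simp
  define A where "A = (\<lambda>(t, y). indicator {0..T} t * indicator {0..Y} y * (\<rho> t (X y))\<^sup>2)"
  define B where "B = (\<lambda>(t, y). indicator {0..T} t * indicator {0..Y} y * (along ?h ?w (t - y) t)\<^sup>2)"
  have mA: "A \<in> borel_measurable (lborel \<Otimes>\<^sub>M lborel)"
    using borel_measurable_integrable[OF ir] unfolding A_def .
  have "B \<in> borel_measurable (borel \<Otimes>\<^sub>M borel)"
    unfolding B_def by measurable
  then have mB: "B \<in> borel_measurable (lborel \<Otimes>\<^sub>M lborel)" by simp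
  have BA: "AE y in lborel. B (t, y) = A (t, y)" for t
  proof (cases "t \<in> {0..T}")
    case True
    have *: "B (t, y) = A (t, y)" if "y \<in> {0..Y} \<longrightarrow> along ?h ?w (t - y) t = \<rho> t (X y)" for y
    proof (cases "y \<in> {0..Y}")
      case True
      then show ?thesis unfolding A_def B_def split using mp[OF that True] by (simp only:)
    next
      case False
      then have "indicator {0..Y} y = (0::real)" by simp
      then show ?thesis unfolding A_def B_def split by (simp only: mult_zero_left mult_zero_right)
    qed
    show ?thesis by (rule eventually_mono[OF ae[OF True]]) (fact *)
  next
    case False
    then have "indicator {0..T} t = (0::real)" by simp
    then have "B (t, y) = A (t, y)" for y
      unfolding A_def B_def split by (simp only: mult_zero_left)
    then show ?thesis by (intro AE_I2)
  qed
  have "AE p in lborel \<Otimes>\<^sub>M lborel. B p = A p"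
    by (rule lborel_pair.AE_pair_measure[where P="\<lambda>p. B p = A p", OF borel_measurable_eq[OF mB mA]]) (intro AE_I2 BA)
  moreover have "integrable (lborel \<Otimes>\<^sub>M lborel) A" using ir unfolding A_def .
  ultimately have iB: "integrable (lborel \<Otimes>\<^sub>M lborel) B"
    using integrable_cong_AE[OF mB mA] by simp
  have "\<forall>\<sigma>. ?h \<sigma> \<noteq> 0 \<longrightarrow> \<sigma> \<in> {-Y..T}"
    unfolding label_data_def by (auto simp: indicator_def)
  moreover have "\<forall>s y. ?w s y \<noteq> 0 \<longrightarrow> s \<in> {0..T} \<and> y \<in> {0..Y}"
    unfolding label_source_def by (auto simp: indicator_def)
  ultimately show "admissible_data T Y ?h ?w"
    unfolding admissible_data_def using mh hh mw iw iB[unfolded B_def] by (intro conjI)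
qed

end

section \<open>Balance law for one component\<close>

lemma set_borel_measurable_section:
  fixes f :: "real \<Rightarrow> real \<Rightarrow> real"
  assumes "set_borel_measurable lborel (A \<times> B) (\<lambda>(t, x). f t x)"
  shows "t \<in> A \<Longrightarrow> set_borel_measurable lborel B (f t)"
    and "x \<in> B \<Longrightarrow> set_borel_measurable lborel A (\<lambda>t. f t x)"
proof -
  have [measurable]: "(\<lambda>(t, x). indicator A t * indicator B x * f t x) \<in> borel_measurable (borel \<Otimes>\<^sub>M borel)"
    using assms unfolding borel_product_measurability .
  have "(\<lambda>x. indicator A t * indicator B x * f t x) \<in> borel_measurable borel"
    by measurable
  then show "t \<in> A \<Longrightarrow> set_borel_measurable lborel B (f t)"
    unfolding set_borel_measurable_def by simp
  have "(\<lambda>t. indicator A t * indicator B x * f t x) \<in> borel_measurable borel"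
    by measurable
  then show "x \<in> B \<Longrightarrow> set_borel_measurable lborel A (\<lambda>t. f t x)"
    unfolding set_borel_measurable_def by simp
qed

lemma set_borel_measurable_arith:
  fixes f g :: "'a \<Rightarrow> real"
  assumes "set_borel_measurable N A f" "set_borel_measurable N A g"
  shows "set_borel_measurable N A (\<lambda>x. f x + g x)" "set_borel_measurable N A (\<lambda>x. f x * g x)"
    "set_borel_measurable N A (\<lambda>x. f x - g x)"
proof -
  let ?f = "\<lambda>x. indicator A x *\<^sub>R f x" and ?g = "\<lambda>x. indicator A x *\<^sub>R g x"
  have m: "?f \<in> borel_measurable N" "?g \<in> borel_measurable N"
    using assms unfolding set_borel_measurable_def by auto
  have "(\<lambda>x. indicator A x *\<^sub>R (f x + g x)) = (\<lambda>x. ?f x + ?g x)"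
    "(\<lambda>x. indicator A x *\<^sub>R (f x * g x)) = (\<lambda>x. ?f x * ?g x)"
    "(\<lambda>x. indicator A x *\<^sub>R (f x - g x)) = (\<lambda>x. ?f x - ?g x)"
    by (auto simp: indicator_def fun_eq_iff)
  then show "set_borel_measurable N A (\<lambda>x. f x + g x)" "set_borel_measurable N A (\<lambda>x. f x * g x)"
    "set_borel_measurable N A (\<lambda>x. f x - g x)"
    using borel_measurable_add[OF m] borel_measurable_times[OF m] borel_measurable_diff[OF m]
    unfolding set_borel_measurable_def by simp_all
qed

lemma set_integral_cong_AE_on:
  fixes f g :: "'a \<Rightarrow> real"
  assumes f: "set_borel_measurable N A f" and g: "set_borel_measurable N A g" and ae: "AE x\<in>A in N. f x = g x"
  shows "(LINT x:A|N. f x) = (LINT x:A|N. g x)"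
    and "set_integrable N A f \<longleftrightarrow> set_integrable N A g"
proof -
  have "AE x in N. indicator A x *\<^sub>R f x = indicator A x *\<^sub>R g x"
    using ae by eventually_elim (simp add: indicator_def)
  then show "(LINT x:A|N. f x) = (LINT x:A|N. g x)" "set_integrable N A f \<longleftrightarrow> set_integrable N A g"
    using integral_cong_AE[of "\<lambda>x. indicator A x *\<^sub>R f x" N "\<lambda>x. indicator A x *\<^sub>R g x"]
      integrable_cong_AE[of "\<lambda>x. indicator A x *\<^sub>R f x" N "\<lambda>x. indicator A x *\<^sub>R g x"] f g
    unfolding set_lebesgue_integral_def set_integrable_def set_borel_measurable_def by blast+
qed

lemma set_borel_measurable_continuous_interval:
  fixes f :: "real \<Rightarrow> real"
  shows "continuous_on {a..b} f \<Longrightarrow> set_borel_measurable lborel {a..b} f"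
  unfolding set_borel_measurable_def
  using borel_measurable_continuous_on_indicator[of "{a..b}" f] by simp

context travel
begin

text \<open>
  The weight \<open>e\<close> on \<open>[0, L]\<close> becomes \<open>\<beta> = e |d|\<close> in the travel time coordinate, because of the Jacobian
  \<open>|d|\<close>. Its derivative is \<open>(e d)' |d|\<close>, again with the Jacobian.
\<close>

lemma weight_along_characteristic:
  assumes ed: "\<And>x. x \<in> {0..L} \<Longrightarrow> ((\<lambda>x. e x * d x) has_real_derivative k x) (at x within {0..L})"
    and y: "y \<in> {0..Y}"
  shows "((\<lambda>y. \<kappa> * (e (X y) * d (X y))) has_real_derivative \<kappa> * (k (X y) * d (X y))) (at y within {0..Y})"
proof -
  have "((\<lambda>x. e x * d x) has_real_derivative k (X y)) (at (X y) within X ` {0..Y})"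
    by (rule DERIV_subset[OF ed[OF X_in[OF y]]]) (use X_in in blast)
  from DERIV_image_chain[OF this X_der[OF y]]
  have "((\<lambda>y. e (X y) * d (X y)) has_real_derivative k (X y) * d (X y)) (at y within {0..Y})"
    by (simp add: o_def)
  then show ?thesis by (rule DERIV_cmult)
qed

text \<open>
  The integrated form of \<open>(e \<rho>1 \<rho>2)\<^sub>t + (e d \<rho>1 \<rho>2)\<^sub>x = (e d)' \<rho>1 \<rho>2 + e (\<omega>1 \<rho>2 + \<rho>1 \<omega>2)\<close>. It is used with
  \<open>\<rho>1 = \<rho>2\<close> for the energy and with \<open>\<rho>2 = 1\<close> for the linear functional.
\<close>

lemma balance:
  assumes T: "0 < T"
    and s1: "solution T \<rho>01 g1 \<omega>1 \<rho>1" and s2: "solution T \<rho>02 g2 \<omega>2 \<rho>2"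
    and e: "continuous_on {0..L} e" and k: "continuous_on {0..L} k"
    and ed: "\<And>x. x \<in> {0..L} \<Longrightarrow> ((\<lambda>x. e x * d x) has_real_derivative k x) (at x within {0..L})"
  shows "set_integrable lborel {0..T} (\<lambda>t. \<rho>1 t c * \<rho>2 t c)"
    and "(LBINT x:{0..L}. e x * (\<rho>1 T x * \<rho>2 T x)) + \<kappa> * (e c * d c) * (LBINT t:{0..T}. \<rho>1 t c * \<rho>2 t c)
      = (LBINT x:{0..L}. e x * (\<rho>01 x * \<rho>02 x)) + \<kappa> * (e b * d b) * (LBINT t:{0..T}. g1 t * g2 t)
       + (LBINT t:{0..T}. LBINT x:{0..L}. k x * (\<rho>1 t x * \<rho>2 t x) + e x * (\<omega>1 t x * \<rho>2 t x + \<rho>1 t x * \<omega>2 t x))"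
proof -
  let ?h1 = "label_data T \<rho>01 g1" and ?w1 = "label_source T \<omega>1"
  let ?h2 = "label_data T \<rho>02 g2" and ?w2 = "label_source T \<omega>2"
  define \<beta> where "\<beta> y = \<kappa> * (e (X y) * d (X y))" for y
  define \<beta>' where "\<beta>' y = \<kappa> * (k (X y) * d (X y))" for y
  define Q1 where "Q1 t y = along ?h1 ?w1 (t - y) t" for t y
  define Q2 where "Q2 t y = along ?h2 ?w2 (t - y) t" for t y
  note a1 = solution_admissible[OF s1 T] and a2 = solution_admissible[OF s2 T]
  have der: "(\<beta> has_real_derivative \<beta>' y) (at y within {0..Y})" if "y \<in> {0..Y}" for y
    using weight_along_characteristic[OF ed that] unfolding \<beta>_def \<beta>'_def by simp
  have cX: "continuous_on {0..Y} (\<lambda>y. f (X y))" if "continuous_on {0..L} f" for f :: "real \<Rightarrow> real"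
    by (rule continuous_on_compose2[OF that X_cont]) (use X_in in blast)
  have cont: "continuous_on {0..Y} \<beta>'"
    unfolding \<beta>'_def by (intro continuous_intros cX k d_cont)
  note tb = transport_balance[OF T Y_pos a1(1) a2(1) der cont, folded Q1_def Q2_def]
  have \<beta>e: "\<beta> y = \<bar>d (X y)\<bar> * e (X y)" and \<beta>'e: "\<beta>' y = \<bar>d (X y)\<bar> * k (X y)" if "y \<in> {0..Y}" for y
    unfolding \<beta>_def \<beta>'_def using abs_speed[OF X_in[OF that]] by simp_all
  have mr1: "set_borel_measurable lborel ({0..T} \<times> {0..L}) (\<lambda>(t, x). \<rho>1 t x)" and mr2: "set_borel_measurable lborel ({0..T} \<times> {0..L}) (\<lambda>(t, x). \<rho>2 t x)"
    and mo1: "set_borel_measurable lborel ({0..T} \<times> {0..L}) (\<lambda>(t, x). \<omega>1 t x)" and mo2: "set_borel_measurable lborel ({0..T} \<times> {0..L}) (\<lambda>(t, x). \<omega>2 t x)"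
    and m0: "set_borel_measurable lborel {0..L} \<rho>01" "set_borel_measurable lborel {0..L} \<rho>02"
    and mg: "set_borel_measurable lborel {0..T} g1" "set_borel_measurable lborel {0..T} g2"
    using s1 s2 unfolding solution_def by blast+
  note ms = set_borel_measurable_section
  note me = set_borel_measurable_continuous_interval[OF e] and mk = set_borel_measurable_continuous_interval[OF k]
  have Qc: "AE t\<in>{0..T} in lborel. Q1 t Y * Q2 t Y = \<rho>1 t c * \<rho>2 t c"
    using a1(3) a2(3) unfolding Q1_def Q2_def by eventually_elim simp
  have mc: "set_borel_measurable lborel {0..T} (\<lambda>t. \<rho>1 t c * \<rho>2 t c)"
    by (intro set_borel_measurable_arith ms(2)[OF mr1] ms(2)[OF mr2] ends)
  have iQ: "set_integrable lborel {0..T} (\<lambda>t. Q1 t Y * Q2 t Y)"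
    using transport_balance(1)[OF T Y_pos a1(1) a2(1), of "\<lambda>_. 1" "\<lambda>_. 0", folded Q1_def Q2_def] by simp
  then have mQ: "set_borel_measurable lborel {0..T} (\<lambda>t. Q1 t Y * Q2 t Y)"
    unfolding set_integrable_def set_borel_measurable_def by auto
  show "set_integrable lborel {0..T} (\<lambda>t. \<rho>1 t c * \<rho>2 t c)"
    using set_integral_cong_AE_on(2)[OF mQ mc Qc] iQ by blast
  have out: "(LBINT t:{0..T}. Q1 t Y * Q2 t Y) = (LBINT t:{0..T}. \<rho>1 t c * \<rho>2 t c)"
    by (rule set_integral_cong_AE_on(1)[OF mQ mc Qc])
  have inner: "(LBINT y:{0..Y}. q y) = (LBINT x:{0..L}. F x)"
    if q: "set_borel_measurable lborel {0..Y} q" and F: "set_borel_measurable lborel {0..L} F"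
      and ae: "AE y\<in>{0..Y} in lborel. q y = \<bar>d (X y)\<bar> * F (X y)" for q F
  proof -
    have "set_borel_measurable lborel {0..Y} (\<lambda>y. \<bar>d (X y)\<bar> * F (X y))"
      by (intro set_borel_measurable_arith measurable_change_of_variable[OF F] set_borel_measurable_continuous_interval
          continuous_on_rabs cX d_cont)
    from set_integral_cong_AE_on(1)[OF q this ae] change_of_variable(2)[OF F]
    show ?thesis by simp
  qed
  have T0: "T \<in> {0..T}" using T by simp
  have fin: "(LBINT y:{0..Y}. \<beta> y * (Q1 T y * Q2 T y)) = (LBINT x:{0..L}. e x * (\<rho>1 T x * \<rho>2 T x))"
  proof (rule inner)
    show "set_borel_measurable lborel {0..Y} (\<lambda>y. \<beta> y * (Q1 T y * Q2 T y))"
      using tb(2) unfolding set_integrable_def set_borel_measurable_def by auto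
    show "set_borel_measurable lborel {0..L} (\<lambda>x. e x * (\<rho>1 T x * \<rho>2 T x))"
      by (intro set_borel_measurable_arith me ms(1)[OF mr1 T0] ms(1)[OF mr2 T0])
    show "AE y\<in>{0..Y} in lborel. \<beta> y * (Q1 T y * Q2 T y) = \<bar>d (X y)\<bar> * (e (X y) * (\<rho>1 T (X y) * \<rho>2 T (X y)))"
      using a1(2)[OF T0] a2(2)[OF T0] unfolding Q1_def Q2_def by eventually_elim (simp add: \<beta>e)
  qed
  have start: "(LBINT y:{0..Y}. \<beta> y * (?h1 (- y) * ?h2 (- y))) = (LBINT x:{0..L}. e x * (\<rho>01 x * \<rho>02 x))"
  proof -
    have m: "set_borel_measurable lborel {0..L} (\<lambda>x. e x * (\<rho>01 x * \<rho>02 x))"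
      by (intro set_borel_measurable_arith me m0)
    have "(LBINT y:{0..Y}. \<beta> y * (?h1 (- y) * ?h2 (- y))) = (LBINT y:{0..Y}. \<bar>d (X y)\<bar> * (e (X y) * (\<rho>01 (X y) * \<rho>02 (X y))))"
      by (rule set_lebesgue_integral_cong) (use T in \<open>auto simp: label_data_def \<beta>e\<close>)
    then show ?thesis using change_of_variable(2)[OF m] by simp
  qed
  have inflow: "(LBINT t:{0..T}. ?h1 t * ?h2 t) = (LBINT t:{0..T}. g1 t * g2 t)"
    unfolding set_lebesgue_integral_def
  proof (rule integral_cong_AE)
    show "AE t in lborel. indicator {0..T} t *\<^sub>R (?h1 t * ?h2 t) = indicator {0..T} t *\<^sub>R (g1 t * g2 t)"
      using AE_lborel_singleton[of 0] by eventually_elim (use Y_pos in \<open>auto simp: label_data_def indicator_def\<close>)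
    show "(\<lambda>t. indicator {0..T} t *\<^sub>R (?h1 t * ?h2 t)) \<in> borel_measurable lborel"
      using a1(1) a2(1) unfolding admissible_data_def by auto
    show "(\<lambda>t. indicator {0..T} t *\<^sub>R (g1 t * g2 t)) \<in> borel_measurable lborel"
      using set_borel_measurable_arith(2)[OF mg] unfolding set_borel_measurable_def .
  qed
  let ?K = "\<lambda>t y. indicator {0..T} t * indicator {0..Y} y *
      (\<beta>' y * (Q1 t y * Q2 t y) + \<beta> y * (?w1 t y * Q2 t y + Q1 t y * ?w2 t y))"
  let ?G = "\<lambda>t x. k x * (\<rho>1 t x * \<rho>2 t x) + e x * (\<omega>1 t x * \<rho>2 t x + \<rho>1 t x * \<omega>2 t x)"
  have mK: "(\<lambda>(t, y). ?K t y) \<in> borel_measurable (borel \<Otimes>\<^sub>M borel)"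
    using borel_measurable_integrable[OF tb(3)] by simp
  have source: "(LBINT t. LBINT y. ?K t y) = (LBINT t:{0..T}. LBINT x:{0..L}. ?G t x)"
    unfolding set_lebesgue_integral_def[of lborel "{0..T}"]
  proof (rule Bochner_Integration.integral_cong, rule refl)
    fix t
    show "(LBINT y. ?K t y) = indicator {0..T} t *\<^sub>R (LBINT x:{0..L}. ?G t x)"
    proof (cases "t \<in> {0..T}")
      case True
      then have "(LBINT y. ?K t y) = (LBINT y:{0..Y}. \<beta>' y * (Q1 t y * Q2 t y) + \<beta> y * (?w1 t y * Q2 t y + Q1 t y * ?w2 t y))"
        unfolding set_lebesgue_integral_def by simp
      also have "\<dots> = (LBINT x:{0..L}. ?G t x)"
      proof (rule inner)
        have "(\<lambda>y. (\<lambda>(t, y). ?K t y) (t, y)) \<in> borel_measurable borel"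
          using mK by measurable
        then show "set_borel_measurable lborel {0..Y} (\<lambda>y. \<beta>' y * (Q1 t y * Q2 t y) + \<beta> y * (?w1 t y * Q2 t y + Q1 t y * ?w2 t y))"
          unfolding set_borel_measurable_def using True by simp
        show "set_borel_measurable lborel {0..L} (?G t)"
          by (intro set_borel_measurable_arith me mk ms(1)[OF mr1 True] ms(1)[OF mr2 True] ms(1)[OF mo1 True] ms(1)[OF mo2 True])
        show "AE y\<in>{0..Y} in lborel. \<beta>' y * (Q1 t y * Q2 t y) + \<beta> y * (?w1 t y * Q2 t y + Q1 t y * ?w2 t y) = \<bar>d (X y)\<bar> * ?G t (X y)"
          using a1(2)[OF True] a2(2)[OF True] unfolding Q1_def Q2_def
          by eventually_elim (use True in \<open>simp add: \<beta>e \<beta>'e label_source_def distrib_left mult.left_commute\<close>)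
      qed
      finally show ?thesis using True by simp
    qed simp
  qed
  have ce: "\<beta> Y = \<kappa> * (e c * d c)" "\<beta> 0 = \<kappa> * (e b * d b)"
    unfolding \<beta>_def X_Y X_0 by simp_all
  show "(LBINT x:{0..L}. e x * (\<rho>1 T x * \<rho>2 T x)) + \<kappa> * (e c * d c) * (LBINT t:{0..T}. \<rho>1 t c * \<rho>2 t c)
      = (LBINT x:{0..L}. e x * (\<rho>01 x * \<rho>02 x)) + \<kappa> * (e b * d b) * (LBINT t:{0..T}. g1 t * g2 t)
       + (LBINT t:{0..T}. LBINT x:{0..L}. ?G t x)"
    using tb(4) unfolding fin start source set_integral_mult_right out inflow ce .
qed

end

section \<open>Square integrable fields and broad solutions\<close>

definition L2_rect :: "real \<Rightarrow> real \<Rightarrow> (real \<Rightarrow> real \<Rightarrow> real) \<Rightarrow> bool" where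
  "L2_rect T L f \<longleftrightarrow> set_borel_measurable lborel ({0..T} \<times> {0..L}) (\<lambda>(t, x). f t x)
     \<and> set_integrable lborel ({0..T} \<times> {0..L}) (\<lambda>(t, x). (f t x)\<^sup>2)"

definition square_integrable :: "'a measure \<Rightarrow> 'a set \<Rightarrow> ('a \<Rightarrow> real) \<Rightarrow> bool" where
  "square_integrable N A f \<longleftrightarrow> set_borel_measurable N A f \<and> set_integrable N A (\<lambda>x. (f x)\<^sup>2)"

lemma L2_rect_square_integrable:
  "L2_rect T L f \<longleftrightarrow> square_integrable lborel ({0..T} \<times> {0..L}) (\<lambda>(t, x). f t x)"
  unfolding L2_rect_def square_integrable_def by (simp add: case_prod_unfold)

lemma square_integrable_iff:
  "square_integrable N A f \<longleftrightarrow> (\<lambda>x. indicator A x * f x) \<in> borel_measurable N \<and> integrable N (\<lambda>x. (indicator A x * f x)\<^sup>2)"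
proof -
  have "(\<lambda>x. (indicator A x * f x)\<^sup>2) = (\<lambda>x. indicator A x *\<^sub>R (f x)\<^sup>2)"
    by (auto simp: indicator_def fun_eq_iff)
  then show ?thesis unfolding square_integrable_def set_borel_measurable_def set_integrable_def by simp
qed

lemma square_integrable_add:
  assumes "square_integrable N A f" "square_integrable N A g"
  shows "square_integrable N A (\<lambda>x. f x + g x)"
proof -
  let ?f = "\<lambda>x. indicator A x * f x" and ?g = "\<lambda>x. indicator A x * g x"
  have m: "?f \<in> borel_measurable N" "?g \<in> borel_measurable N" and i: "integrable N (\<lambda>x. (?f x)\<^sup>2)" "integrable N (\<lambda>x. (?g x)\<^sup>2)"
    using assms unfolding square_integrable_iff by auto
  have "integrable N (\<lambda>x. (?f x)\<^sup>2 + (?g x)\<^sup>2 + 2 * (?f x * ?g x))"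
    by (intro Bochner_Integration.integrable_add integrable_mult_right impI i integrable_mult_of_squares[OF m i])
  then have "integrable N (\<lambda>x. (?f x + ?g x)\<^sup>2)" by (simp add: power2_sum mult.assoc)
  moreover have "(\<lambda>x. ?f x + ?g x) \<in> borel_measurable N" using m by (rule borel_measurable_add)
  ultimately show ?thesis unfolding square_integrable_iff by (simp add: distrib_left)
qed

lemma square_integrable_mult_bounded:
  assumes f: "square_integrable N A f" and g: "set_borel_measurable N A g" and b: "\<And>x. x \<in> A \<Longrightarrow> \<bar>g x\<bar> \<le> B"
  shows "square_integrable N A (\<lambda>x. g x * f x)"
proof -
  let ?f = "\<lambda>x. indicator A x * f x" and ?g = "\<lambda>x. indicator A x * g x"
  have m: "?f \<in> borel_measurable N" "?g \<in> borel_measurable N" and i: "integrable N (\<lambda>x. (?f x)\<^sup>2)"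
    using f g unfolding square_integrable_iff set_borel_measurable_def by auto
  have e: "(\<lambda>x. ?g x * ?f x) = (\<lambda>x. indicator A x * (g x * f x))"
    by (auto simp: indicator_def fun_eq_iff)
  have "integrable N (\<lambda>x. (?f x)\<^sup>2 * (?g x)\<^sup>2)"
  proof (rule integrable_mult_bounded[OF i])
    show "(\<lambda>x. (?g x)\<^sup>2) \<in> borel_measurable N" using borel_measurable_power[OF m(2)] .
    show "\<bar>(?g x)\<^sup>2\<bar> \<le> B\<^sup>2" for x
      using b[of x] by (auto simp: indicator_def abs_le_square_iff[symmetric])
  qed
  then have "integrable N (\<lambda>x. (indicator A x * (g x * f x))\<^sup>2)"
    unfolding e[symmetric, THEN fun_cong] by (simp add: power_mult_distrib mult.commute)
  moreover have "(\<lambda>x. indicator A x * (g x * f x)) \<in> borel_measurable N"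
    unfolding e[symmetric] using borel_measurable_times[OF m(2,1)] .
  ultimately show ?thesis unfolding square_integrable_iff by simp
qed

lemma square_integrable_scale:
  "square_integrable N A f \<Longrightarrow> square_integrable N A (\<lambda>x. k * f x)"
  unfolding square_integrable_iff
  by (auto simp: power_mult_distrib mult.left_commute[of _ k])

lemma square_integrable_diff:
  "square_integrable N A f \<Longrightarrow> square_integrable N A g \<Longrightarrow> square_integrable N A (\<lambda>x. f x - g x)"
  using square_integrable_add[of N A f "\<lambda>x. -1 * g x"] square_integrable_scale[of N A g "-1"] by simp

lemma square_integrable_bounded:
  assumes "set_borel_measurable N A g" "\<And>x. x \<in> A \<Longrightarrow> \<bar>g x\<bar> \<le> B" "A \<in> sets N" "emeasure N A < \<infinity>"
  shows "square_integrable N A g"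
proof -
  have "(\<lambda>x. (indicator A x * (1::real))\<^sup>2) = indicator A" by (auto simp: indicator_def fun_eq_iff)
  then have "square_integrable N A (\<lambda>_. 1)"
    unfolding square_integrable_iff using assms(3,4) by simp
  from square_integrable_mult_bounded[OF this assms(1,2)] show ?thesis by simp
qed

lemma square_integrable_mult:
  assumes "square_integrable N A f" "square_integrable N A g"
  shows "set_integrable N A (\<lambda>x. f x * g x)"
proof -
  have "integrable N (\<lambda>x. (indicator A x * f x) * (indicator A x * g x))"
    using assms unfolding square_integrable_iff by (intro integrable_mult_of_squares) auto
  moreover have "(indicator A x * f x) * (indicator A x * g x) = indicator A x *\<^sub>R (f x * g x)" for x
    by (auto simp: indicator_def)
  ultimately show ?thesis unfolding set_integrable_def by simp
qed

lemma continuous_bounded_interval: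
  fixes f :: "real \<Rightarrow> real"
  assumes "continuous_on {a..b} f"
  obtains B where "\<And>x. x \<in> {a..b} \<Longrightarrow> \<bar>f x\<bar> \<le> B"
proof -
  have "bounded (f ` {a..b})" using compact_continuous_image[OF assms] compact_imp_bounded by blast
  then show ?thesis using that unfolding bounded_iff real_norm_def by (metis imageI)
qed

lemma square_integrable_continuous:
  fixes f :: "real \<Rightarrow> real"
  assumes f: "continuous_on {a..b} f"
  shows "square_integrable lborel {a..b} f"
proof -
  obtain B where "\<And>x. x \<in> {a..b} \<Longrightarrow> \<bar>f x\<bar> \<le> B" using continuous_bounded_interval[OF f] by blast
  then show ?thesis
    using square_integrable_bounded[of lborel "{a..b}" f B] set_borel_measurable_continuous_interval[OF f]
      emeasure_lborel_cbox_finite[of a b] by simp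
qed

lemma set_borel_measurable_space_function:
  fixes m :: "real \<Rightarrow> real"
  assumes "set_borel_measurable lborel {0..L} m"
  shows "set_borel_measurable lborel ({0..T::real} \<times> {0..L}) (\<lambda>(t, x). m x)"
proof -
  have m: "(\<lambda>x. indicator {0..L} x * m x) \<in> borel_measurable borel"
    using assms unfolding set_borel_measurable_def by simp
  have i: "(indicator {0..T} :: real \<Rightarrow> real) \<in> borel_measurable borel" by simp
  have "(\<lambda>(t, x). indicator {0..T} t * (indicator {0..L} x * m x)) \<in> borel_measurable (borel \<Otimes>\<^sub>M borel)"
    using borel_measurable_times[OF measurable_compose[OF measurable_fst i] measurable_compose[OF measurable_snd m]]
    by (simp add: case_prod_unfold)
  then show ?thesis unfolding borel_product_measurability by (simp add: mult.assoc)
qed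

lemma L2_rect_add: "L2_rect T L f \<Longrightarrow> L2_rect T L g \<Longrightarrow> L2_rect T L (\<lambda>t x. f t x + g t x)"
  using square_integrable_add[of lborel "{0..T} \<times> {0..L}" "\<lambda>(t, x). f t x" "\<lambda>(t, x). g t x"]
  unfolding L2_rect_square_integrable by (simp add: case_prod_unfold)

lemma L2_rect_diff: "L2_rect T L f \<Longrightarrow> L2_rect T L g \<Longrightarrow> L2_rect T L (\<lambda>t x. f t x - g t x)"
  using square_integrable_diff[of lborel "{0..T} \<times> {0..L}" "\<lambda>(t, x). f t x" "\<lambda>(t, x). g t x"]
  unfolding L2_rect_square_integrable by (simp add: case_prod_unfold)

lemma L2_rect_mult_continuous:
  assumes f: "L2_rect T L f" and m: "continuous_on {0..L} m"
  shows "L2_rect T L (\<lambda>t x. m x * f t x)"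
proof -
  obtain B where "\<And>x. x \<in> {0..L} \<Longrightarrow> \<bar>m x\<bar> \<le> B" using continuous_bounded_interval[OF m] by blast
  then show ?thesis
    using square_integrable_mult_bounded[OF f[unfolded L2_rect_square_integrable]
        set_borel_measurable_space_function[OF set_borel_measurable_continuous_interval[OF m]], of B]
    unfolding L2_rect_square_integrable by (auto simp: case_prod_unfold)
qed

lemma L2_rect_one: "L2_rect T L (\<lambda>t x. 1)"
proof -
  have "set_borel_measurable lborel ({0..T} \<times> {0..L}) (\<lambda>_. 1::real)"
    using set_borel_measurable_space_function[of L "\<lambda>_. 1" T] set_borel_measurable_continuous_interval[of 0 L "\<lambda>_. 1"]
    by (simp add: case_prod_unfold)
  then have "square_integrable lborel ({0..T} \<times> {0..L}) (\<lambda>_. 1)"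
    using emeasure_rectangle_finite[of T L]
    by (intro square_integrable_bounded[where B=1]) (auto simp: lborel_prod intro!: borel_closed closed_Times)
  then show ?thesis unfolding L2_rect_square_integrable by (simp add: case_prod_unfold)
qed

lemma L2_rect_continuous: "continuous_on {0..L} m \<Longrightarrow> L2_rect T L (\<lambda>t x. m x)"
  using L2_rect_mult_continuous[OF L2_rect_one, of L m T] by simp

context travel
begin

text \<open>
  Along a characteristic the travel time \<open>P\<close> grows with speed \<open>1\<close>.
\<close>

lemma characteristic_unique:
  assumes c: "characteristic L d t0 t \<xi>" and "\<xi> t = x" and s: "s \<in> {t0..t}"
  shows "P (\<xi> s) = P x - t + s" "\<xi> s = X (P x - t + s)"
proof -
  have in_L: "\<xi> s \<in> {0..L}" and der: "(\<xi> has_real_derivative d (\<xi> s)) (at s within {t0..t})" if "s \<in> {t0..t}" for s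
    using c that unfolding characteristic_def by blast+
  have "((\<lambda>s. P (\<xi> s) - s) has_real_derivative 0) (at s within {t0..t})" if s: "s \<in> {t0..t}" for s
  proof -
    have "(P has_real_derivative 1 / d (\<xi> s)) (at (\<xi> s) within \<xi> ` {t0..t})"
      by (rule DERIV_subset[OF P_der[OF in_L[OF s]]]) (use in_L in blast)
    from DERIV_image_chain[OF this der[OF s]]
    have "((\<lambda>s. P (\<xi> s)) has_real_derivative 1) (at s within {t0..t})"
      using d_nonzero[OF in_L[OF s]] by (simp add: o_def)
    from DERIV_diff[OF this DERIV_ident] show ?thesis by simp
  qed
  then obtain k where k: "\<And>s. s \<in> {t0..t} \<Longrightarrow> P (\<xi> s) - s = k"
    using has_field_derivative_zero_constant[of "{t0..t}" "\<lambda>s. P (\<xi> s) - s"] by (metis convex_real_interval(5))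
  have "t \<in> {t0..t}" using s by simp
  from k[OF this] k[OF s] show "P (\<xi> s) = P x - t + s" using assms(2) by simp
  then show "\<xi> s = X (P x - t + s)" using X_P[OF in_L[OF s]] by metis
qed

lemma characteristic_exists:
  assumes x: "x \<in> {0..L}" and t: "0 \<le> t"
  shows "characteristic L d (max 0 (t - P x)) t (\<lambda>s. X (P x - t + s))"
  unfolding characteristic_def
proof (intro ballI conjI)
  fix s assume s: "s \<in> {max 0 (t - P x)..t}"
  have y: "P x - t + r \<in> {0..Y}" if "r \<in> {max 0 (t - P x)..t}" for r using that P_in[OF x] unfolding atLeastAtMost_iff max.bounded_iff by linarith
  show "X (P x - t + s) \<in> {0..L}" using X_in[OF y[OF s]] .
  have "(X has_real_derivative d (X (P x - t + s))) (at (P x - t + s) within (\<lambda>s. P x - t + s) ` {max 0 (t - P x)..t})"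
    by (rule DERIV_subset[OF X_der[OF y[OF s]]]) (use y in blast)
  moreover have "((\<lambda>s. P x - t + s) has_real_derivative 1) (at s within {max 0 (t - P x)..t})"
    by (auto intro!: derivative_eq_intros)
  ultimately show "((\<lambda>s. X (P x - t + s)) has_real_derivative d (X (P x - t + s))) (at s within {max 0 (t - P x)..t})"
    using DERIV_image_chain[of X _ "\<lambda>s. P x - t + s" s "{max 0 (t - P x)..t}" 1] by (simp add: o_def)
qed

text \<open>
  Uniqueness of characteristics determines the starting time: it is \<open>0\<close> or the time \<open>t - P x\<close> of
  entrance, whichever is later.
\<close>

lemma value_along_characteristic_iff:
  assumes x: "x \<in> {0..L}" and t: "0 \<le> t"
  shows "value_along_characteristic L d b g w t x v \<longleftrightarrow>
     set_integrable lborel {max 0 (t - P x)..t} (\<lambda>s. w s (X (P x - t + s))) \<and>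
     v = (if t \<le> P x then 0 else g (t - P x)) + (LBINT s:{max 0 (t - P x)..t}. w s (X (P x - t + s)))"
    (is "?L \<longleftrightarrow> ?R")
proof
  assume ?L
  then obtain t0 \<xi> where t0: "0 \<le> t0" "t0 \<le> t" and c: "characteristic L d t0 t \<xi>" and e: "\<xi> t = x"
    and st: "t0 = 0 \<or> \<xi> t0 = b" and i: "set_integrable lborel {t0..t} (\<lambda>s. w s (\<xi> s))"
    and v: "v = (if t0 = 0 then 0 else g t0) + (LBINT s:{t0..t}. w s (\<xi> s))"
    unfolding value_along_characteristic_def by blast
  note u = characteristic_unique[OF c e]
  have "\<xi> t0 \<in> {0..L}" using c t0 unfolding characteristic_def by simp
  then have "0 \<le> P x - t + t0" using P_in[of "\<xi> t0"] u(1)[of t0] t0 by simp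
  moreover have "t0 = 0 \<or> P x - t + t0 = 0" using st u(1)[of t0] t0 ends by auto
  ultimately have t0e: "t0 = max 0 (t - P x)" using t0 by linarith
  have "set_integrable lborel {t0..t} (\<lambda>s. w s (X (P x - t + s))) \<longleftrightarrow> set_integrable lborel {t0..t} (\<lambda>s. w s (\<xi> s))"
    by (rule set_integrable_cong) (use u(2) in auto)
  moreover have "(LBINT s:{t0..t}. w s (\<xi> s)) = (LBINT s:{t0..t}. w s (X (P x - t + s)))"
    by (rule set_lebesgue_integral_cong) (use u(2) in auto)
  moreover have "(if t0 = 0 then 0 else g t0) = (if t \<le> P x then 0 else g (t - P x))"
    using t0e by auto
  ultimately show ?R using i v t0e by simp
next
  assume R: ?R
  let ?t0 = "max 0 (t - P x)" and ?\<xi> = "\<lambda>s. X (P x - t + s)"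
  show ?L unfolding value_along_characteristic_def
  proof (rule exI[of _ ?t0], rule exI[of _ ?\<xi>], intro conjI)
    show "0 \<le> ?t0" "?t0 \<le> t" using t P_in[OF x] by auto
    show "characteristic L d ?t0 t ?\<xi>" by (rule characteristic_exists[OF x t])
    show "?\<xi> t = x" using X_P[OF x] by simp
    show "?t0 = 0 \<or> ?\<xi> ?t0 = b" using X_0 by (auto simp: max_def)
    show "set_integrable lborel {?t0..t} (\<lambda>s. w s (?\<xi> s))" using R by simp
    show "v = (if ?t0 = 0 then 0 else g ?t0) + (LBINT s:{?t0..t}. w s (?\<xi> s))" using R by (auto simp: max_def)
  qed
qed

lemma profile_along_characteristic:
  fixes R W :: "real \<Rightarrow> real"
  assumes Rc: "continuous_on {0..L} R" and Wc: "continuous_on {0..L} W"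
    and Rd: "\<And>x. x \<in> {0<..<L} \<Longrightarrow> (R has_real_derivative W x / d x) (at x)"
    and x: "x \<in> {0..L}" and t: "0 \<le> t"
  shows "set_integrable lborel {max 0 (t - P x)..t} (\<lambda>s. W (X (P x - t + s)))"
    and "(LBINT s:{max 0 (t - P x)..t}. W (X (P x - t + s))) = R x - (if t \<le> P x then R (X (P x - t)) else R b)"
proof -
  let ?a = "max 0 (t - P x)"
  have at: "?a \<le> t" using t P_in[OF x] by auto
  have y: "P x - t + r \<in> {0..Y}" if "r \<in> {?a..t}" for r using that P_in[OF x] unfolding atLeastAtMost_iff max.bounded_iff by linarith
  have cc: "continuous_on {?a..t} (\<lambda>s. f (X (P x - t + s)))" if f: "continuous_on {0..L} f" for f :: "real \<Rightarrow> real"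
  proof -
    have "continuous_on {?a..t} (\<lambda>s. X (P x - t + s))"
      by (rule continuous_on_compose2[OF X_cont]) (intro continuous_intros, use y in blast)
    from continuous_on_compose2[OF f this] show ?thesis using X_in y by blast
  qed
  show i: "set_integrable lborel {?a..t} (\<lambda>s. W (X (P x - t + s)))"
    by (rule borel_integrable_atLeastAtMost') (rule cc[OF Wc])
  have "((\<lambda>s. W (X (P x - t + s))) has_integral (R (X (P x - t + t)) - R (X (P x - t + ?a)))) {?a..t}"
  proof (rule fundamental_theorem_of_calculus_interior[OF at cc[OF Rc]])
    fix s assume s: "s \<in> {?a<..<t}"
    have ys: "P x - t + s \<in> {0<..<Y}" using s P_in[OF x] by auto
    have xs: "X (P x - t + s) \<in> {0..L}" using X_in ys by auto
    have "X (P x - t + s) \<noteq> 0" "X (P x - t + s) \<noteq> L"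
    proof -
      have "P (X (P x - t + s)) = P x - t + s" using P_X ys by auto
      then have "X (P x - t + s) \<noteq> b" "X (P x - t + s) \<noteq> c" using ends ys by auto
      moreover have "{0, L} = {b, c}" using b_c by auto
      ultimately show "X (P x - t + s) \<noteq> 0" "X (P x - t + s) \<noteq> L" by auto
    qed
    then have "X (P x - t + s) \<in> {0<..<L}" using xs by auto
    note Rx = Rd[OF this]
    have "(X has_real_derivative d (X (P x - t + s))) (at (P x - t + s))"
      using X_der[of "P x - t + s"] ys by (simp add: at_within_Icc_at)
    moreover have "((\<lambda>s. P x - t + s) has_real_derivative 1) (at s)" by (auto intro!: derivative_eq_intros)
    ultimately have "((\<lambda>s. X (P x - t + s)) has_real_derivative d (X (P x - t + s))) (at s)"
      using DERIV_chain2[of X _ "\<lambda>s. P x - t + s" s 1 UNIV] by simp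
    from DERIV_chain2[OF Rx this]
    show "((\<lambda>s. R (X (P x - t + s))) has_vector_derivative W (X (P x - t + s))) (at s)"
      using d_nonzero[OF xs] by (simp add: has_real_derivative_iff_has_vector_derivative)
  qed
  then have "(LBINT s:{?a..t}. W (X (P x - t + s))) = R (X (P x)) - R (X (P x - t + ?a))"
    using set_borel_integral_eq_integral(2)[OF i] by (simp add: integral_unique)
  then show "(LBINT s:{?a..t}. W (X (P x - t + s))) = R x - (if t \<le> P x then R (X (P x - t)) else R b)"
    using X_P[OF x] X_0 by (auto simp: max_def)
qed

text \<open>
  A stationary profile is transported with its own source (\<open>profile_along_characteristic\<close>), so
  subtracting it turns zero initial data into \<open>- R\<close> and keeps the form of the equation. The subtraction is
  made on single characteristics, where integrability of \<open>w\<close> is part of the hypothesis \<open>val\<close>.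
\<close>

lemma solution_minus_profile:
  fixes R W :: "real \<Rightarrow> real"
  assumes T: "0 < T" and Rc: "continuous_on {0..L} R" and Wc: "continuous_on {0..L} W"
    and Rd: "\<And>x. x \<in> {0<..<L} \<Longrightarrow> (R has_real_derivative W x / d x) (at x)"
    and g: "square_integrable lborel {0..T} g" and w: "L2_rect T L w" and \<rho>: "L2_rect T L \<rho>"
    and val: "\<And>t. t \<in> {0..T} \<Longrightarrow> AE x\<in>{0..L} in lborel. value_along_characteristic L d b g w t x (\<rho> t x)"
    and out: "AE t\<in>{0..T} in lborel. value_along_characteristic L d b g w t c (\<rho> t c)"
  shows "solution T (\<lambda>x. - R x) (\<lambda>t. g t - R b) (\<lambda>t x. w t x - W x) (\<lambda>t x. \<rho> t x - R x)"
proof -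
  have key: "\<rho> t x - R x = arrival (\<lambda>x. - R x) (\<lambda>t. g t - R b) (\<lambda>t x. w t x - W x) t x"
    if v: "value_along_characteristic L d b g w t x (\<rho> t x)" and x: "x \<in> {0..L}" and t: "t \<in> {0..T}" for t x
  proof -
    have t0: "0 \<le> t" using t by simp
    note pr = profile_along_characteristic[OF Rc Wc Rd x t0]
    show ?thesis
      using v[unfolded value_along_characteristic_iff[OF x t0]] pr
      unfolding arrival_def by (auto simp: set_integral_diff)
  qed
  have R2: "square_integrable lborel {0..L} (\<lambda>x. - R x)"
    using square_integrable_continuous[of 0 L "\<lambda>x. - R x"] Rc by (auto intro: continuous_intros)
  have g2: "square_integrable lborel {0..T} (\<lambda>t. g t - R b)"
    by (intro square_integrable_diff g square_integrable_continuous) simp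
  have w2: "L2_rect T L (\<lambda>t x. w t x - W x)" and \<rho>2: "L2_rect T L (\<lambda>t x. \<rho> t x - R x)"
    by (intro L2_rect_diff w \<rho> L2_rect_continuous Rc Wc)+
  have a1: "AE x\<in>{0..L} in lborel. \<rho> t x - R x = arrival (\<lambda>x. - R x) (\<lambda>t. g t - R b) (\<lambda>t x. w t x - W x) t x" if t: "t \<in> {0..T}" for t
    by (rule eventually_mono[OF val[OF t]]) (use key t in blast)
  have a2: "AE t\<in>{0..T} in lborel. \<rho> t c - R c = arrival (\<lambda>x. - R x) (\<lambda>t. g t - R b) (\<lambda>t x. w t x - W x) t c"
    by (rule eventually_mono[OF out]) (use key ends in blast)
  show ?thesis
    unfolding solution_def
    using R2 g2 w2 \<rho>2 a1 a2 unfolding square_integrable_def L2_rect_def by (intro conjI ballI) simp_all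
qed

lemma solution_one: "solution T (\<lambda>_. 1) (\<lambda>_. 1) (\<lambda>_ _. 0) (\<lambda>_ _. 1)"
proof -
  have "L2_rect T L (\<lambda>_ _. 0)" using L2_rect_continuous[of L "\<lambda>_. 0" T] by simp
  moreover have "arrival (\<lambda>_. 1) (\<lambda>_. 1) (\<lambda>_ _. 0) t x = 1" for t x
    unfolding arrival_def set_lebesgue_integral_def by simp
  ultimately show ?thesis
    using L2_rect_one[of T L] square_integrable_continuous[of 0 L "\<lambda>_. 1"] square_integrable_continuous[of 0 T "\<lambda>_. 1"]
    unfolding solution_def square_integrable_def L2_rect_def by simp
qed

end

section \<open>Construction of the characteristics\<close>

text \<open>
  \<open>P\<close> is the integral of \<open>1 / d\<close>. It is strictly increasing, and its inverse satisfies the equation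
  \<open>X' = d X\<close> of the characteristics.
\<close>

lemma travel_rightward:
  fixes d :: "real \<Rightarrow> real"
  assumes L: "0 < L" and cd: "continuous_on {0..L} d" and pos: "\<And>x. x \<in> {0..L} \<Longrightarrow> 0 < d x"
  obtains Y P X where "travel L Y 0 L 1 d P X"
proof -
  define P where "P x = integral {0..x} (\<lambda>x. 1 / d x)" for x
  have ci: "continuous_on {0..L} (\<lambda>x. 1 / d x)"
    by (intro continuous_intros cd) (use pos in force)
  have der: "(P has_real_derivative 1 / d x) (at x within {0..L})" if "x \<in> {0..L}" for x
    unfolding P_def by (rule integral_has_real_derivative[OF ci that])
  have cP: "continuous_on {0..L} P"
    using der by (meson DERIV_continuous continuous_on_eq_continuous_within)
  have mono: "P x < P y" if "x \<in> {0..L}" "y \<in> {0..L}" "x < y" for x y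
  proof (rule DERIV_pos_imp_increasing_open[OF that(3)])
    show "\<exists>D. (P has_real_derivative D) (at z) \<and> 0 < D" if z: "x < z" "z < y" for z
    proof -
      have zz: "0 < z" "z < L" using z \<open>x \<in> {0..L}\<close> \<open>y \<in> {0..L}\<close> by auto
      then have "(P has_real_derivative 1 / d z) (at z)" using der[of z] at_within_Icc_at[of 0 z L] by simp
      moreover have "0 < 1 / d z" using pos[of z] zz by simp
      ultimately show ?thesis by blast
    qed
    show "continuous_on {x..y} P" by (rule continuous_on_subset[OF cP]) (use that in auto)
  qed
  have P0: "P 0 = 0" unfolding P_def by simp
  have inj: "inj_on P {0..L}"
    by (rule linorder_inj_onI) (use mono in fastforce)+
  have range: "P ` {0..L} = {0..P L}"
  proof
    have "P x \<in> {0..P L}" if "x \<in> {0..L}" for x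
      using mono[of 0 x] mono[of x L] that P0 L by (cases "x = 0"; cases "x = L") auto
    then show "P ` {0..L} \<subseteq> {0..P L}" by blast
    show "{0..P L} \<subseteq> P ` {0..L}"
    proof
      fix y assume "y \<in> {0..P L}"
      then have "\<exists>x\<ge>0. x \<le> L \<and> P x = y" using L P0 by (intro IVT' cP) auto
      then show "y \<in> P ` {0..L}" by (auto intro: image_eqI)
    qed
  qed
  define X where "X = inv_into {0..L} P"
  have XP: "X (P x) = x" if "x \<in> {0..L}" for x
    unfolding X_def using inv_into_f_f[OF inj that] .
  have PX: "P (X y) = y" and Xin: "X y \<in> {0..L}" if "y \<in> {0..P L}" for y
    unfolding X_def using that range f_inv_into_f[of y P "{0..L}"] inv_into_into[of y P "{0..L}"] by auto
  have cX: "continuous_on {0..P L} X"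
    using continuous_on_inv[OF cP compact_Icc] XP range by metis
  have Xd: "(X has_real_derivative d (X y)) (at y within {0..P L})" if y: "y \<in> {0..P L}" for y
  proof -
    have nz: "d (X y) \<noteq> 0" using pos[OF Xin[OF y]] by simp
    have "(X has_derivative (*) (d (X y))) (at (P (X y)) within P ` {0..L})"
    proof (rule has_derivative_inverse_within)
      show "(P has_derivative (*) (1 / d (X y))) (at (X y) within {0..L})"
        using der[OF Xin[OF y]] unfolding has_field_derivative_def .
      show "continuous (at (P (X y)) within P ` {0..L}) X"
        unfolding range PX[OF y] using cX y continuous_on_eq_continuous_within by blast
      show "X y \<in> {0..L}" by (rule Xin[OF y])
      show "linear ((*) (d (X y)))" by (simp add: bounded_linear.linear bounded_linear_mult_right)
      show "(*) (d (X y)) \<circ> (*) (1 / d (X y)) = id" using nz by (auto simp: fun_eq_iff)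
      show "X (P x) = x" if "x \<in> {0..L}" for x by (rule XP[OF that])
    qed
    then show ?thesis unfolding range PX[OF y] has_field_derivative_def .
  qed
  have "travel L (P L) 0 L 1 d P X"
  proof
    show "0 < P L" using mono[of 0 L] L P0 by simp
    show "P x \<in> {0..P L}" if "x \<in> {0..L}" for x using range that by blast
  qed (use L P0 cd pos XP PX Xin der Xd in auto)
  then show ?thesis by (rule that)
qed

text \<open>
  The reflection \<open>x \<mapsto> L - x\<close> reduces a negative speed to a positive one.
\<close>

lemma travel_leftward:
  fixes d :: "real \<Rightarrow> real"
  assumes L: "0 < L" and cd: "continuous_on {0..L} d" and neg: "\<And>x. x \<in> {0..L} \<Longrightarrow> d x < 0"
  obtains Y P X where "travel L Y L 0 (-1) d P X"
proof -
  have refl: "continuous_on {0..L} (\<lambda>x. - d (L - x))"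
    by (intro continuous_intros continuous_on_compose2[OF cd]) auto
  obtain Y P X where tr: "travel L Y 0 L 1 (\<lambda>x. - d (L - x)) P X"
    using travel_rightward[OF L refl] neg by force
  interpret r: travel L Y 0 L 1 "\<lambda>x. - d (L - x)" P X by (rule tr)
  have mem: "L - x \<in> {0..L}" if "x \<in> {0..L}" for x using that by auto
  have "travel L Y L 0 (-1) d (\<lambda>x. P (L - x)) (\<lambda>y. L - X y)"
  proof
    show "((\<lambda>x. P (L - x)) has_real_derivative 1 / d x) (at x within {0..L})" if x: "x \<in> {0..L}" for x
    proof -
      have "(P has_real_derivative 1 / - d (L - (L - x))) (at (L - x) within (\<lambda>x. L - x) ` {0..L})"
        by (rule DERIV_subset[OF r.P_der[OF mem[OF x]]]) (use mem in blast)
      moreover have "((\<lambda>x. L - x) has_real_derivative -1) (at x within {0..L})"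
        by (auto intro!: derivative_eq_intros)
      ultimately have "(P \<circ> (\<lambda>x. L - x) has_real_derivative 1 / - d (L - (L - x)) * (-1)) (at x within {0..L})"
        by (rule DERIV_image_chain)
      then show ?thesis by (simp add: o_def)
    qed
    show "((\<lambda>y. L - X y) has_real_derivative d (L - X y)) (at y within {0..Y})" if y: "y \<in> {0..Y}" for y
      using DERIV_diff[OF DERIV_const r.X_der[OF y], of L] by simp
    show "P (L - x) \<in> {0..Y}" if "x \<in> {0..L}" for x by (rule r.P_in[OF mem[OF that]])
    show "L - X (P (L - x)) = x" if "x \<in> {0..L}" for x using r.X_P[OF mem[OF that]] by simp
    show "L - X y \<in> {0..L}" if "y \<in> {0..Y}" for y using mem[OF r.X_in[OF that]] .
  qed (use L r.Y_pos r.ends r.P_X neg cd in auto)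
  then show ?thesis by (rule that)
qed

section \<open>Regularity of dynamic states\<close>

lemma set_integral_nonneg_real:
  fixes f :: "'a \<Rightarrow> real"
  assumes "\<And>x. x \<in> A \<Longrightarrow> 0 \<le> f x"
  shows "0 \<le> (LINT x:A|N. f x)"
  unfolding set_lebesgue_integral_def by (rule integral_nonneg_AE) (use assms in \<open>auto simp: indicator_def\<close>)

text \<open>
  Continuity bounds the norm near every time, and finitely many of these neighbourhoods cover
  \<open>[0, T]\<close>.
\<close>

lemma L2_continuous_bounded:
  assumes cont: "L2_continuous T L r"
  obtains B where "\<And>t. t \<in> {0..T} \<Longrightarrow> (LBINT x:{0..L}. (norm (r t x))\<^sup>2) \<le> B"
proof -
  define N where "N t = (LBINT x:{0..L}. (norm (r t x))\<^sup>2)" for t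
  have L2: "L2_on {0..L} (r t)" if "t \<in> {0..T}" for t using cont that unfolding L2_continuous_def by blast
  have local: "\<exists>e>0. \<forall>s\<in>{0..T}. dist s t < e \<longrightarrow> N s \<le> 2 + 2 * N t" if t: "t \<in> {0..T}" for t
  proof -
    have lim: "((\<lambda>s. LBINT x:{0..L}. (norm (r s x - r t x))\<^sup>2) \<longlongrightarrow> 0) (at t within {0..T})"
      using cont t unfolding L2_continuous_def by blast
    have "\<forall>\<^sub>F s in at t within {0..T}. dist (LBINT x:{0..L}. (norm (r s x - r t x))\<^sup>2) 0 < 1"
      by (rule tendstoD[OF lim]) simp
    then obtain e where e: "e > 0" "\<And>s. s \<in> {0..T} \<Longrightarrow> s \<noteq> t \<Longrightarrow> dist s t < e \<Longrightarrow> (LBINT x:{0..L}. (norm (r s x - r t x))\<^sup>2) < 1"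
      unfolding eventually_at dist_real_def by fastforce
    have "N s \<le> 2 + 2 * N t" if s: "s \<in> {0..T}" "dist s t < e" for s
    proof (cases "s = t")
      case True
      have "0 \<le> N t" unfolding N_def by (rule set_integral_nonneg_real) simp
      then show ?thesis using True by simp
    next
      case False
      let ?s = "\<lambda>x. indicator {0..L} x *\<^sub>R r s x" and ?t = "\<lambda>x. indicator {0..L} x *\<^sub>R r t x"
      have m: "?s \<in> borel_measurable lborel" "?t \<in> borel_measurable lborel"
        and is_: "set_integrable lborel {0..L} (\<lambda>x. (norm (r s x))\<^sup>2)" and it: "set_integrable lborel {0..L} (\<lambda>x. (norm (r t x))\<^sup>2)"
        using L2[OF s(1)] L2[OF t] unfolding L2_on_def set_borel_measurable_def by auto
      have pw: "(norm (a - b))\<^sup>2 \<le> 2 * (norm a)\<^sup>2 + 2 * (norm b)\<^sup>2" for a b :: "real^2"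
        using norm_triangle_ineq4[of a b] power_mono[of "norm (a - b)" "norm a + norm b" 2] sum_squares_bound[of "norm a" "norm b"]
        by (simp add: power2_sum)
      have id: "set_integrable lborel {0..L} (\<lambda>x. (norm (r s x - r t x))\<^sup>2)"
        unfolding set_integrable_def
      proof (rule Bochner_Integration.integrable_bound)
        show "integrable lborel (\<lambda>x. 2 * (indicator {0..L} x *\<^sub>R (norm (r s x))\<^sup>2) + 2 * (indicator {0..L} x *\<^sub>R (norm (r t x))\<^sup>2))"
          using is_ it unfolding set_integrable_def by (intro Bochner_Integration.integrable_add integrable_mult_right) auto
        have "(\<lambda>x. (norm (?s x - ?t x))\<^sup>2) \<in> borel_measurable lborel"
          by (intro borel_measurable_power borel_measurable_norm borel_measurable_diff m measurable_compose[OF _ borel_measurable_norm])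
        moreover have "(\<lambda>x. (norm (?s x - ?t x))\<^sup>2) = (\<lambda>x. indicator {0..L} x *\<^sub>R (norm (r s x - r t x))\<^sup>2)"
          by (auto simp: indicator_def fun_eq_iff)
        ultimately show "(\<lambda>x. indicator {0..L} x *\<^sub>R (norm (r s x - r t x))\<^sup>2) \<in> borel_measurable lborel" by simp
        show "AE x in lborel. norm (indicator {0..L} x *\<^sub>R (norm (r s x - r t x))\<^sup>2)
            \<le> norm (2 * (indicator {0..L} x *\<^sub>R (norm (r s x))\<^sup>2) + 2 * (indicator {0..L} x *\<^sub>R (norm (r t x))\<^sup>2))"
          using pw by (intro AE_I2) (auto simp: indicator_def)
      qed
      have "N s \<le> (LBINT x:{0..L}. 2 * (norm (r s x - r t x))\<^sup>2 + 2 * (norm (r t x))\<^sup>2)"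
        unfolding N_def
      proof (rule set_integral_mono[OF is_])
        show "set_integrable lborel {0..L} (\<lambda>x. 2 * (norm (r s x - r t x))\<^sup>2 + 2 * (norm (r t x))\<^sup>2)"
          using id it by (intro set_integral_add set_integrable_mult_right impI)
        show "(norm (r s x))\<^sup>2 \<le> 2 * (norm (r s x - r t x))\<^sup>2 + 2 * (norm (r t x))\<^sup>2" for x
          using pw[of "r s x - r t x" "- r t x"] by simp
      qed
      also have "\<dots> = 2 * (LBINT x:{0..L}. (norm (r s x - r t x))\<^sup>2) + 2 * N t"
        unfolding N_def using id it by (subst set_integral_add) auto
      also have "\<dots> \<le> 2 + 2 * N t" using e(2)[OF s(1) False s(2)] by simp
      finally show ?thesis .
    qed
    then show ?thesis using e(1) by blast
  qed
  then obtain e where e: "\<And>t. t \<in> {0..T} \<Longrightarrow> e t > 0" "\<And>t s. t \<in> {0..T} \<Longrightarrow> s \<in> {0..T} \<Longrightarrow> dist s t < e t \<Longrightarrow> N s \<le> 2 + 2 * N t"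
    by metis
  obtain I where I: "I \<subseteq> {0..T}" "finite I" "{0..T} \<subseteq> (\<Union>t\<in>I. ball t (e t))"
  proof (rule compactE_image[OF compact_Icc[of 0 T]])
    show "\<And>t. t \<in> {0..T} \<Longrightarrow> open (ball t (e t))" by simp
    show "{0..T} \<subseteq> (\<Union>t\<in>{0..T}. ball t (e t))" using e(1) by force
  qed (use that in blast)
  have "N s \<le> (\<Sum>t\<in>I. 2 + 2 * N t)" if s: "s \<in> {0..T}" for s
  proof -
    obtain t where t: "t \<in> I" "dist s t < e t" using I(3) s by (auto simp: dist_commute)
    have "N s \<le> 2 + 2 * N t" using e(2) t I(1) s by blast
    also have "\<dots> \<le> (\<Sum>t\<in>I. 2 + 2 * N t)"
    proof (rule member_le_sum[OF t(1) _ I(2)])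
      fix t show "0 \<le> 2 + 2 * N t" unfolding N_def using set_integral_nonneg_real[of "{0..L}" "\<lambda>x. (norm (r t x))\<^sup>2" lborel] by simp
    qed
    finally show ?thesis .
  qed
  then show ?thesis using that unfolding N_def by blast
qed

lemma L2_rect_component:
  assumes m: "set_borel_measurable lborel ({0..T} \<times> {0..L}) (\<lambda>(t, x). r t x)" and c: "L2_continuous T L r"
  shows "L2_rect T L (\<lambda>t x. (r t x :: real^2) $ i)"
proof -
  have "(\<lambda>p. (indicator ({0..T} \<times> {0..L}) p *\<^sub>R (case p of (t, x) \<Rightarrow> r t x)) $ i) \<in> borel_measurable lborel"
    using m unfolding set_borel_measurable_def
    by (rule measurable_compose[OF _ borel_measurable_continuous_onI[OF continuous_on_component[OF continuous_on_id]]])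
  then have mi: "set_borel_measurable lborel ({0..T} \<times> {0..L}) (\<lambda>(t, x). r t x $ i)"
    unfolding set_borel_measurable_def by (simp add: case_prod_unfold)
  let ?f = "\<lambda>t x. indicator {0..T} t * indicator {0..L} x * (r t x $ i)"
  have mf[measurable]: "(\<lambda>(t, x). ?f t x) \<in> borel_measurable (borel \<Otimes>\<^sub>M borel)"
    using mi unfolding borel_product_measurability .
  have sec: "set_integrable lborel {0..L} (\<lambda>x. (r t x $ i)\<^sup>2)" and le: "(LBINT x:{0..L}. (r t x $ i)\<^sup>2) \<le> (LBINT x:{0..L}. (norm (r t x))\<^sup>2)"
    if t: "t \<in> {0..T}" for t
  proof -
    have L2: "set_integrable lborel {0..L} (\<lambda>x. (norm (r t x))\<^sup>2)" using c t unfolding L2_continuous_def L2_on_def by blast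
    have "(\<lambda>x. indicator {0..L} x * (r t x $ i)) \<in> borel_measurable lborel"
      using set_borel_measurable_section(1)[OF mi t] unfolding set_borel_measurable_def by (simp only: real_scaleR_def)
    then have "(\<lambda>x. (indicator {0..L} x * (r t x $ i))\<^sup>2) \<in> borel_measurable lborel" by (rule borel_measurable_power)
    moreover have "(\<lambda>x. (indicator {0..L} x * (r t x $ i))\<^sup>2) = (\<lambda>x. indicator {0..L} x *\<^sub>R (r t x $ i)\<^sup>2)"
      by (auto simp: indicator_def fun_eq_iff)
    ultimately have m2: "(\<lambda>x. indicator {0..L} x *\<^sub>R (r t x $ i)\<^sup>2) \<in> borel_measurable lborel" by simp
    have cb: "(r t x $ i)\<^sup>2 \<le> (norm (r t x))\<^sup>2" for x
      using power_mono[OF component_le_norm_cart[of "r t x" i] abs_ge_zero, of 2] by (simp only: power2_abs)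
    show "set_integrable lborel {0..L} (\<lambda>x. (r t x $ i)\<^sup>2)"
      unfolding set_integrable_def
    proof (rule Bochner_Integration.integrable_bound[OF L2[unfolded set_integrable_def] m2], rule AE_I2)
      fix x
      show "norm (indicator {0..L} x *\<^sub>R (r t x $ i)\<^sup>2) \<le> norm (indicator {0..L} x *\<^sub>R (norm (r t x))\<^sup>2)"
        using cb[of x] by (cases "x \<in> {0..L}") simp_all
    qed
    from set_integral_mono[OF this L2 cb]
    show "(LBINT x:{0..L}. (r t x $ i)\<^sup>2) \<le> (LBINT x:{0..L}. (norm (r t x))\<^sup>2)" .
  qed
  obtain B where B: "\<And>t. t \<in> {0..T} \<Longrightarrow> (LBINT x:{0..L}. (norm (r t x))\<^sup>2) \<le> B"
    using L2_continuous_bounded[OF c] by blast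
  let ?q = "\<lambda>t x. indicator {0..T} t * indicator {0..L} x * (r t x $ i)\<^sup>2"
  have qe: "(\<lambda>(t, x). ?q t x) = (\<lambda>(t, x). (?f t x)\<^sup>2)" by (auto simp: indicator_def fun_eq_iff)
  have mq[measurable]: "(\<lambda>(t, x). ?q t x) \<in> borel_measurable (borel \<Otimes>\<^sub>M borel)"
    unfolding qe by measurable
  have "integrable (lborel \<Otimes>\<^sub>M lborel) (\<lambda>(t, x). ?q t x)"
  proof (rule lborel_pair.Fubini_integrable)
    show "(\<lambda>(t, x). ?q t x) \<in> borel_measurable (lborel \<Otimes>\<^sub>M lborel)" using mq by simp
    show "AE t in lborel. integrable lborel (\<lambda>x. case (t, x) of (t, x) \<Rightarrow> ?q t x)"
    proof (rule AE_I2)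
      fix t show "integrable lborel (\<lambda>x. case (t, x) of (t, x) \<Rightarrow> ?q t x)"
        using sec[of t] by (cases "t \<in> {0..T}") (simp_all add: set_integrable_def)
    qed
    show "integrable lborel (\<lambda>t. LBINT x. norm (case (t, x) of (t, x) \<Rightarrow> ?q t x))"
    proof (rule Bochner_Integration.integrable_bound)
      show "integrable lborel (\<lambda>t. indicator {0..T} t * B)"
        using emeasure_lborel_cbox_finite[of 0 T] by (intro integrable_mult_left integrable_real_indicator) auto
      show "(\<lambda>t. LBINT x. norm (case (t, x) of (t, x) \<Rightarrow> ?q t x)) \<in> borel_measurable lborel"
        by (rule lborel.borel_measurable_lebesgue_integral) measurable
      show "AE t in lborel. norm (LBINT x. norm (case (t, x) of (t, x) \<Rightarrow> ?q t x)) \<le> norm (indicator {0..T} t * B)"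
      proof (rule AE_I2)
        fix t
        show "norm (LBINT x. norm (case (t, x) of (t, x) \<Rightarrow> ?q t x)) \<le> norm (indicator {0..T} t * B)"
        proof (cases "t \<in> {0..T}")
          case True
          then have "(LBINT x. norm (case (t, x) of (t, x) \<Rightarrow> ?q t x)) = (LBINT x:{0..L}. (r t x $ i)\<^sup>2)"
            unfolding set_lebesgue_integral_def by (simp add: abs_mult)
          moreover have "0 \<le> (LBINT x:{0..L}. (r t x $ i)\<^sup>2)" by (rule set_integral_nonneg_real) simp
          ultimately show ?thesis using le[OF True] B[OF True] True by simp
        qed simp
      qed
    qed
  qed
  then show ?thesis unfolding L2_rect_def set_integrable_product using mi by blast
qed

section \<open>Linear integral equations\<close>

text \<open>
  The weight \<open>\<omega>\<close> will be an exponential that grows along the direction of integration. With it an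
  integral operator of Volterra type contracts on the whole domain, however long this is.
\<close>

lemma weighted_contraction_fixed_point:
  fixes \<Phi> :: "('a::metric_space \<Rightarrow> 'b::banach) \<Rightarrow> 'a \<Rightarrow> 'b" and \<omega> :: "'a \<Rightarrow> real"
  assumes K: "compact K" and cont: "\<And>f. continuous_on K f \<Longrightarrow> continuous_on K (\<Phi> f)"
    and \<omega>: "\<And>z. z \<in> K \<Longrightarrow> m \<le> \<omega> z \<and> \<omega> z \<le> W" and m: "0 < m"
    and contr: "\<And>f g B z. continuous_on K f \<Longrightarrow> continuous_on K g \<Longrightarrow> 0 \<le> B \<Longrightarrow>
      (\<And>z. z \<in> K \<Longrightarrow> norm (f z - g z) \<le> B * \<omega> z) \<Longrightarrow> z \<in> K \<Longrightarrow> norm (\<Phi> f z - \<Phi> g z) \<le> B / 2 * \<omega> z"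
  obtains f where "continuous_on K f" "\<And>z. z \<in> K \<Longrightarrow> \<Phi> f z = f z"
proof -
  define F where "F n = (\<Phi> ^^ n) (\<lambda>_. 0)" for n
  have F0: "F 0 = (\<lambda>_. 0)" and FS: "F (Suc n) = \<Phi> (F n)" for n unfolding F_def by auto
  have cF: "continuous_on K (F n)" for n by (induction n) (simp_all add: F0 FS cont)
  have "bounded (F 1 ` K)" using compact_continuous_image[OF cF K] compact_imp_bounded by blast
  then obtain C where "\<forall>v\<in>F 1 ` K. norm v \<le> C" unfolding bounded_iff ..
  then have C: "\<And>z. z \<in> K \<Longrightarrow> norm (F 1 z) \<le> C" by blast
  define B where "B = \<bar>C\<bar> / m"
  have B0: "0 \<le> B" unfolding B_def using m by simp
  have step: "norm (F (Suc n) z - F n z) \<le> B * (1/2)^n * \<omega> z" if "z \<in> K" for n z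
    using that
  proof (induction n arbitrary: z)
    case 0
    have "norm (F 1 z) \<le> \<bar>C\<bar>" using C[OF 0] by simp
    also have "\<dots> = B * m" unfolding B_def using m by simp
    also have "\<dots> \<le> B * \<omega> z" using \<omega>[OF 0] B0 by (intro mult_left_mono) auto
    finally show ?case by (simp add: F0)
  next
    case (Suc n)
    have "norm (\<Phi> (F (Suc n)) z - \<Phi> (F n) z) \<le> B * (1/2)^n / 2 * \<omega> z"
      by (rule contr[OF cF cF _ Suc.IH Suc.prems]) (use B0 in auto)
    then show ?case by (simp add: FS)
  qed
  have W0: "0 \<le> \<bar>W\<bar>" by simp
  define f where "f z = (\<Sum>i. F (Suc i) z - F i z)" for z
  have "uniform_limit K (\<lambda>n z. \<Sum>i<n. F (Suc i) z - F i z) f sequentially"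
    unfolding f_def[abs_def]
  proof (rule Weierstrass_m_test)
    show "norm (F (Suc n) z - F n z) \<le> B * (1/2)^n * \<bar>W\<bar>" if "z \<in> K" for n z
    proof -
      have "B * (1/2)^n * \<omega> z \<le> B * (1/2)^n * \<bar>W\<bar>" using \<omega>[OF that] B0 by (intro mult_left_mono) auto
      then show ?thesis using step[OF that, of n] by linarith
    qed
    show "summable (\<lambda>n. B * (1/2)^n * \<bar>W\<bar>)"
      by (intro summable_mult summable_mult2 summable_geometric) simp
  qed
  moreover have "(\<Sum>i<n. F (Suc i) z - F i z) = F n z" for n z
    using sum_lessThan_telescope[of "\<lambda>i. F i z" n] by (simp add: F0)
  ultimately have lim: "uniform_limit K F f sequentially" by simp
  have cf: "continuous_on K f"
    by (rule uniform_limit_theorem[OF _ lim]) (use cF in auto)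
  have "\<Phi> f z = f z" if z: "z \<in> K" for z
  proof -
    have "(\<lambda>n. F n z) \<longlonglongrightarrow> f z" by (rule tendsto_uniform_limitI[OF lim z])
    then have l1: "(\<lambda>n. F (Suc n) z) \<longlonglongrightarrow> f z" by (rule LIMSEQ_Suc)
    have "(\<lambda>n. F (Suc n) z) \<longlonglongrightarrow> \<Phi> f z"
    proof (rule LIMSEQ_I)
      fix r :: real assume r: "0 < r"
      let ?e = "r * m / (\<bar>W\<bar> + 1)"
      have e0: "0 < ?e" using r m by simp
      from uniform_limitD[OF lim e0] obtain N where N: "\<And>n z. n \<ge> N \<Longrightarrow> z \<in> K \<Longrightarrow> dist (F n z) (f z) < ?e"
        unfolding eventually_sequentially by blast
      have "norm (F (Suc n) z - \<Phi> f z) < r" if n: "n \<ge> N" for n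
      proof -
        have em: "0 \<le> ?e / m" using less_imp_le[OF divide_pos_pos[OF e0 m]] .
        then have em2: "0 \<le> ?e / m / 2" by (rule divide_nonneg_pos) simp
        have "norm (\<Phi> (F n) z - \<Phi> f z) \<le> (?e / m) / 2 * \<omega> z"
        proof (rule contr[OF cF cf _ _ z])
          show "0 \<le> ?e / m" by (rule em)
          fix z assume z: "z \<in> K"
          have "norm (F n z - f z) \<le> ?e" using N[OF n z] by (simp add: dist_norm)
          also have "\<dots> = ?e / m * m" using m by simp
          also have "\<dots> \<le> ?e / m * \<omega> z" by (rule mult_left_mono[OF _ em]) (use \<omega>[OF z] in simp)
          finally show "norm (F n z - f z) \<le> ?e / m * \<omega> z" .
        qed
        also have "\<dots> \<le> (?e / m) / 2 * \<bar>W\<bar>" by (rule mult_left_mono[OF _ em2]) (use \<omega>[OF z] in linarith)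
        also have "\<dots> = r * (\<bar>W\<bar> / (\<bar>W\<bar> + 1)) / 2" using m by simp
        also have "\<dots> < r"
        proof -
          have "\<bar>W\<bar> / (\<bar>W\<bar> + 1) \<le> 1" by simp
          then have "r * (\<bar>W\<bar> / (\<bar>W\<bar> + 1)) \<le> r * 1" by (rule mult_left_mono) (use r in simp)
          then have "r * (\<bar>W\<bar> / (\<bar>W\<bar> + 1)) / 2 \<le> r * 1 / 2" by (rule divide_right_mono) simp
          also have "\<dots> < r" using r by simp
          finally show ?thesis .
        qed
        finally show ?thesis by (simp add: FS)
      qed
      then show "\<exists>N. \<forall>n\<ge>N. norm (F (Suc n) z - \<Phi> f z) < r" by blast
    qed
    then show ?thesis using l1 LIMSEQ_unique by blast
  qed
  then show ?thesis using cf that by blast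
qed

lemma matrix_vector_2:
  fixes A :: "real^2^2"
  shows "(A *v v) $ 1 = A $ 1 $ 1 * v $ 1 + A $ 1 $ 2 * v $ 2" "(A *v v) $ 2 = A $ 2 $ 1 * v $ 1 + A $ 2 $ 2 * v $ 2"
  by (simp_all add: matrix_vector_mult_def sum_2)

lemma norm_le_components_2: "norm (v :: real^2) \<le> \<bar>v $ 1\<bar> + \<bar>v $ 2\<bar>"
  using norm_le_l1_cart[of v] by (simp add: sum_2)

lemma continuous_on_entry:
  fixes A :: "real \<Rightarrow> real^2^2"
  shows "continuous_on S A \<Longrightarrow> continuous_on S (\<lambda>x. A x $ i $ j)"
  by (intro continuous_intros)

lemma matrix_vector_bound:
  fixes A :: "real \<Rightarrow> real^2^2"
  assumes "continuous_on {a..b} A"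
  obtains C where "0 < C" "\<And>x v i. x \<in> {a..b} \<Longrightarrow> \<bar>(A x *v v) $ i\<bar> \<le> C * norm v"
    "\<And>x v. x \<in> {a..b} \<Longrightarrow> norm (A x *v v) \<le> C * norm v"
proof -
  have "\<exists>B. \<forall>x\<in>{a..b}. \<bar>A x $ i $ j\<bar> \<le> B" for i j
    using continuous_bounded_interval[OF continuous_on_entry[OF assms]] by metis
  then obtain B where B: "\<And>i j x. x \<in> {a..b} \<Longrightarrow> \<bar>A x $ i $ j\<bar> \<le> B i j" by metis
  define C where "C = 1 + \<bar>B 1 1\<bar> + \<bar>B 1 2\<bar> + \<bar>B 2 1\<bar> + \<bar>B 2 2\<bar>"
  have C0: "0 < C" unfolding C_def by simp
  have c: "\<bar>(A x *v v) $ 1\<bar> + \<bar>(A x *v v) $ 2\<bar> \<le> C * norm v" if x: "x \<in> {a..b}" for x v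
  proof -
    have e: "\<bar>A x $ i $ j * v $ j\<bar> \<le> \<bar>B i j\<bar> * norm v" for i j
      unfolding abs_mult using B[OF x, of i j] component_le_norm_cart[of v j] by (intro mult_mono) auto
    have "\<bar>(A x *v v) $ 1\<bar> + \<bar>(A x *v v) $ 2\<bar> \<le> \<bar>B 1 1\<bar> * norm v + \<bar>B 1 2\<bar> * norm v + \<bar>B 2 1\<bar> * norm v + \<bar>B 2 2\<bar> * norm v"
      unfolding matrix_vector_2 using e[of 1 1] e[of 1 2] e[of 2 1] e[of 2 2] by linarith
    also have "\<dots> \<le> C * norm v" unfolding C_def by (simp add: algebra_simps)
    finally show ?thesis .
  qed
  show ?thesis
  proof (rule that[OF C0])
    show "\<bar>(A x *v v) $ i\<bar> \<le> C * norm v" if "x \<in> {a..b}" for x v i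
      using c[OF that, of v] exhaust_2[of i] by fastforce
    show "norm (A x *v v) \<le> C * norm v" if "x \<in> {a..b}" for x v
      using c[OF that, of v] norm_le_components_2[of "A x *v v"] by linarith
  qed
qed

lemma continuous_matrix_vector:
  fixes A :: "'a::topological_space \<Rightarrow> real^2^2"
  assumes "continuous_on S A" "continuous_on S f"
  shows "continuous_on S (\<lambda>x. A x *v f x)"
  unfolding matrix_vector_mult_def by (intro continuous_intros assms)

text \<open>
  The weight \<open>exp (2 C x)\<close> gives the factor \<open>1/2\<close>, since \<open>C \<integral> exp (2 C \<xi>) d\<xi> \<le> exp (2 C x) / 2\<close>.
\<close>

lemma linear_ode_solution:
  fixes A :: "real \<Rightarrow> real^2^2"
  assumes L: "0 < L" and A: "continuous_on {0..L} A"
  obtains S where "S 0 = s0" "\<And>x. x \<in> {0..L} \<Longrightarrow> (S has_vector_derivative A x *v S x) (at x within {0..L})"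
proof -
  obtain C where C: "0 < C" "\<And>x v. x \<in> {0..L} \<Longrightarrow> norm (A x *v v) \<le> C * norm v"
    using matrix_vector_bound[OF A] by metis
  define \<Phi> where "\<Phi> f x = s0 + integral {0..x} (\<lambda>\<xi>. A \<xi> *v f \<xi>)" for f :: "real \<Rightarrow> real^2" and x
  define \<omega> where "\<omega> x = exp (2 * C * x)" for x
  have cI: "continuous_on {0..L} (\<lambda>\<xi>. A \<xi> *v f \<xi>)" if "continuous_on {0..L} f" for f :: "real \<Rightarrow> real^2"
    by (rule continuous_matrix_vector[OF A that])
  obtain S where S: "continuous_on {0..L} S" "\<And>x. x \<in> {0..L} \<Longrightarrow> \<Phi> S x = S x"
  proof (rule weighted_contraction_fixed_point[of "{0..L}" \<Phi> 1 \<omega> "exp (2 * C * L)"])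
    show "continuous_on {0..L} (\<Phi> f)" if "continuous_on {0..L} f" for f
      unfolding \<Phi>_def[abs_def] by (intro continuous_intros indefinite_integral_continuous_1 integrable_continuous_interval cI[OF that])
    show "1 \<le> \<omega> z \<and> \<omega> z \<le> exp (2 * C * L)" if "z \<in> {0..L}" for z
      unfolding \<omega>_def using that C(1) by auto
    fix f g :: "real \<Rightarrow> real^2" and B z
    assume f: "continuous_on {0..L} f" and g: "continuous_on {0..L} g" and B: "0 \<le> B"
      and fg: "\<And>z. z \<in> {0..L} \<Longrightarrow> norm (f z - g z) \<le> B * \<omega> z" and z: "z \<in> {0..L}"
    have sub: "{0..z} \<subseteq> {0..L}" using z by auto
    have i: "(\<lambda>\<xi>. A \<xi> *v h \<xi>) integrable_on {0..z}" if "continuous_on {0..L} h" for h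
      by (rule integrable_continuous_interval, rule continuous_on_subset[OF cI[OF that] sub])
    have e: "((\<lambda>\<xi>. C * B * exp (2 * C * \<xi>)) has_integral (B / 2 * exp (2 * C * z) - B / 2 * exp (2 * C * 0))) {0..z}"
      by (rule fundamental_theorem_of_calculus)
        (use z C(1) in \<open>auto intro!: derivative_eq_intros simp: has_real_derivative_iff_has_vector_derivative[symmetric]\<close>)
    have "\<Phi> f z - \<Phi> g z = integral {0..z} (\<lambda>\<xi>. A \<xi> *v f \<xi> - A \<xi> *v g \<xi>)"
      unfolding \<Phi>_def using i[OF f] i[OF g] by (simp add: integral_diff)
    also have "norm \<dots> \<le> integral {0..z} (\<lambda>\<xi>. C * B * exp (2 * C * \<xi>))"
    proof (rule integral_norm_bound_integral)
      show "(\<lambda>\<xi>. A \<xi> *v f \<xi> - A \<xi> *v g \<xi>) integrable_on {0..z}" using i[OF f] i[OF g] by (rule integrable_diff)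
      show "(\<lambda>\<xi>. C * B * exp (2 * C * \<xi>)) integrable_on {0..z}" using e by blast
      fix \<xi> assume "\<xi> \<in> {0..z}"
      then have x: "\<xi> \<in> {0..L}" using sub by blast
      have "norm (A \<xi> *v f \<xi> - A \<xi> *v g \<xi>) = norm (A \<xi> *v (f \<xi> - g \<xi>))"
        by (simp add: matrix_vector_mult_diff_distrib)
      also have "\<dots> \<le> C * (B * \<omega> \<xi>)"
        using C(2)[OF x, of "f \<xi> - g \<xi>"] mult_left_mono[OF fg[OF x], of C] C(1) by linarith
      finally show "norm (A \<xi> *v f \<xi> - A \<xi> *v g \<xi>) \<le> C * B * exp (2 * C * \<xi>)" unfolding \<omega>_def by (simp add: mult.assoc)
    qed
    also have "\<dots> = B / 2 * exp (2 * C * z) - B / 2" using integral_unique[OF e] by simp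
    also have "\<dots> \<le> B / 2 * \<omega> z" unfolding \<omega>_def using B by simp
    finally show "norm (\<Phi> f z - \<Phi> g z) \<le> B / 2 * \<omega> z" .
  qed auto
  show ?thesis
  proof (rule that)
    show "S 0 = s0" using S(2)[of 0] L unfolding \<Phi>_def by simp
    fix x assume x: "x \<in> {0..L}"
    have "(\<Phi> S has_vector_derivative A x *v S x) (at x within {0..L})"
      unfolding \<Phi>_def[abs_def]
      using has_vector_derivative_add[OF has_vector_derivative_const integral_has_vector_derivative[OF cI[OF S(1)] x]] by simp
    then show "(S has_vector_derivative A x *v S x) (at x within {0..L})"
      by (rule has_vector_derivative_transform[OF x, rotated]) (use S(2) in auto)
  qed
qed

section \<open>Existence of dynamic states\<close>

context travel
begin

text \<open>
  The contribution of the source to the transported value, as an operator on continuous fields.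
\<close>

definition duhamel :: "(real \<Rightarrow> real \<Rightarrow> real) \<Rightarrow> real \<Rightarrow> real \<Rightarrow> real" where
  "duhamel W t x = (LBINT s:{max 0 (t - P x)..t}. W s (X (P x - t + s)))"

lemma along_in_rectangle:
  assumes t: "t \<in> {0..T}" and x: "x \<in> {0..L}" and s: "s \<in> {max 0 (t - P x)..t}"
  shows "(s, X (P x - t + s)) \<in> {0..T} \<times> {0..L}"
proof -
  have "P x - t + s \<in> {0..Y}" using s P_in[OF x] unfolding atLeastAtMost_iff max.bounded_iff by linarith
  then show ?thesis using X_in s t by auto
qed

lemma continuous_along:
  assumes W: "continuous_on ({0..T} \<times> {0..L}) (\<lambda>z. W (fst z) (snd z))" and t: "t \<in> {0..T}" and x: "x \<in> {0..L}"
  shows "continuous_on {max 0 (t - P x)..t} (\<lambda>s. W s (X (P x - t + s)) :: real)"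
proof -
  have "continuous_on {max 0 (t - P x)..t} (\<lambda>s. X (P x - t + s))"
  proof (rule continuous_on_compose2[OF X_cont])
    show "(\<lambda>s. P x - t + s) ` {max 0 (t - P x)..t} \<subseteq> {0..Y}"
      using P_in[OF x] by auto
  qed (intro continuous_intros)
  then have "continuous_on {max 0 (t - P x)..t} (\<lambda>s. (s, X (P x - t + s)))"
    by (intro continuous_intros)
  from continuous_on_compose2[OF W this] along_in_rectangle[OF t x]
  show ?thesis by (simp add: image_subset_iff)
qed

lemma integrable_along:
  assumes "continuous_on ({0..T} \<times> {0..L}) (\<lambda>z. W (fst z) (snd z))" "t \<in> {0..T}" "x \<in> {0..L}"
  shows "set_integrable lborel {max 0 (t - P x)..t} (\<lambda>s. W s (X (P x - t + s)) :: real)"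
  by (rule borel_integrable_atLeastAtMost'[OF continuous_along[OF assms]])

text \<open>
  The substitution \<open>s = t - min t (P x) * \<theta>\<close> moves the dependence on \<open>(t, x)\<close> from the limits of
  integration into the integrand, which makes continuity in \<open>(t, x)\<close> evident.
\<close>

lemma duhamel_rescaled:
  assumes x: "x \<in> {0..L}" and t: "0 \<le> t"
  shows "duhamel W t x = min t (P x) * (LBINT \<theta>:{0..1}. W (t - min t (P x) * \<theta>) (X (P x - min t (P x) * \<theta>)))"
proof -
  let ?m = "min t (P x)"
  have m0: "0 \<le> ?m" using t P_in[OF x] by simp
  have me: "max 0 (t - P x) = t - ?m" by (simp add: min_def max_def)
  show ?thesis
  proof (cases "?m = 0")
    case True
    have "(LBINT s:{t..t}. W s (X (P x - t + s))) = 0"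
      unfolding set_lebesgue_integral_def
    proof (rule integral_eq_zero_AE)
      show "AE s in lborel. indicator {t..t} s *\<^sub>R W s (X (P x - t + s)) = 0"
        using AE_lborel_singleton[of t] by eventually_elim (simp add: indicator_def)
    qed
    then show ?thesis unfolding duhamel_def me using True by simp
  next
    case False
    then have mp: "0 < ?m" using m0 by linarith
    have ind: "indicator {t - ?m..t} (t + - ?m * \<theta>) = (indicator {0..1} \<theta> :: real)" for \<theta>
    proof -
      have "t + - m * \<theta> \<in> {t - m..t} \<longleftrightarrow> \<theta> \<in> {0..1}" if "0 < m" for m :: real
        using that mult_le_cancel_left_pos[OF that, of \<theta> 1] by (auto simp: zero_le_mult_iff)
      from this[OF mp] show ?thesis unfolding indicator_def by (simp only:)
    qed
    have "duhamel W t x = \<bar>- ?m\<bar> *\<^sub>R (LBINT \<theta>. indicator {t - ?m..t} (t + - ?m * \<theta>) *\<^sub>R W (t + - ?m * \<theta>) (X (P x - t + (t + - ?m * \<theta>))))"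
      unfolding duhamel_def me set_lebesgue_integral_def
      by (rule lborel_integral_real_affine) (metis mp less_irrefl neg_equal_0_iff_equal)
    also have "\<dots> = ?m * (LBINT \<theta>:{0..1}. W (t - ?m * \<theta>) (X (P x - ?m * \<theta>)))"
      unfolding ind set_lebesgue_integral_def using abs_of_pos[OF mp] by simp
    finally show ?thesis .
  qed
qed

lemma duhamel_continuous:
  assumes W: "continuous_on ({0..T} \<times> {0..L}) (\<lambda>z. W (fst z) (snd z))"
  shows "continuous_on ({0..T} \<times> {0..L}) (\<lambda>z. duhamel W (fst z) (snd z))"
proof -
  let ?K = "{0..T} \<times> {0..L}"
  let ?m = "\<lambda>z. min (fst z) (P (snd z))"
  let ?g = "\<lambda>z \<theta>. W (fst z - ?m z * \<theta>) (X (P (snd z) - ?m z * \<theta>))"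
  have bnd: "0 \<le> ?m z" "?m z * \<theta> \<le> fst z" "0 \<le> ?m z * \<theta>" "?m z * \<theta> \<le> P (snd z)" if z: "z \<in> ?K" "\<theta> \<in> {0..1}" for z \<theta>
  proof -
    show m: "0 \<le> ?m z" using z P_in by auto
    then have "?m z * \<theta> \<le> ?m z" using z mult_left_mono[of \<theta> 1 "?m z"] by simp
    then show "?m z * \<theta> \<le> fst z" "?m z * \<theta> \<le> P (snd z)" by auto
    show "0 \<le> ?m z * \<theta>" using m z by simp
  qed
  have cP: "continuous_on ?K (\<lambda>z. P (snd z))"
    by (rule continuous_on_compose2[OF P_cont]) (auto intro!: continuous_intros)
  have cm: "continuous_on ?K ?m" by (intro continuous_intros cP)
  have cP': "continuous_on (?K \<times> {0..1}) (\<lambda>p. P (snd (fst p)))"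
    by (rule continuous_on_compose2[OF cP]) (auto intro!: continuous_intros)
  have cm': "continuous_on (?K \<times> {0..1}) (\<lambda>p. ?m (fst p))"
    by (rule continuous_on_compose2[OF cm]) (auto intro!: continuous_intros)
  have cX: "continuous_on (?K \<times> {0..1}) (\<lambda>p. X (P (snd (fst p)) - ?m (fst p) * snd p))"
  proof (rule continuous_on_compose2[OF X_cont])
    show "continuous_on (?K \<times> {0..1}) (\<lambda>p. P (snd (fst p)) - ?m (fst p) * snd p)"
      by (intro continuous_intros cP' cm')
    show "(\<lambda>p. P (snd (fst p)) - ?m (fst p) * snd p) ` (?K \<times> {0..1}) \<subseteq> {0..Y}"
    proof (rule image_subsetI)
      fix p :: "(real \<times> real) \<times> real" assume p: "p \<in> ?K \<times> {0..1}"
      then have "fst p \<in> ?K" "snd p \<in> {0..1}" by auto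
      note b = bnd[OF this]
      have "P (snd (fst p)) \<in> {0..Y}" using P_in p by auto
      then show "P (snd (fst p)) - ?m (fst p) * snd p \<in> {0..Y}" using b by simp
    qed
  qed
  have in_K: "(fst z - ?m z * \<theta>, X (P (snd z) - ?m z * \<theta>)) \<in> ?K" if z: "z \<in> ?K" "\<theta> \<in> {0..1}" for z \<theta>
  proof -
    have "P (snd z) \<in> {0..Y}" using P_in z by auto
    then have "P (snd z) - ?m z * \<theta> \<in> {0..Y}" using bnd[OF z] by simp
    then have "X (P (snd z) - ?m z * \<theta>) \<in> {0..L}" by (rule X_in)
    moreover have "fst z - ?m z * \<theta> \<in> {0..T}" using bnd[OF z] z by auto
    ultimately show ?thesis by blast
  qed
  have cg: "continuous_on (?K \<times> {0..1}) (\<lambda>(z, \<theta>). ?g z \<theta>)"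
  proof -
    have "continuous_on (?K \<times> {0..1}) (\<lambda>p. (fst (fst p) - ?m (fst p) * snd p, X (P (snd (fst p)) - ?m (fst p) * snd p)))"
      by (intro continuous_intros cX cm')
    moreover have "(\<lambda>p. (fst (fst p) - ?m (fst p) * snd p, X (P (snd (fst p)) - ?m (fst p) * snd p))) ` (?K \<times> {0..1}) \<subseteq> ?K"
      using in_K by (intro image_subsetI) (simp add: mem_Times_iff)
    ultimately have "continuous_on (?K \<times> {0..1}) (\<lambda>p. ?g (fst p) (snd p))"
      using continuous_on_compose2[OF W, of "?K \<times> {0..1}" "\<lambda>p. (fst (fst p) - ?m (fst p) * snd p, X (P (snd (fst p)) - ?m (fst p) * snd p))"] by simp
    then show ?thesis by (simp add: case_prod_unfold)
  qed
  have "continuous_on ?K (\<lambda>z. integral (cbox 0 1) (?g z))"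
    by (rule integral_continuous_on_param) (use cg in simp)
  then have "continuous_on ?K (\<lambda>z. ?m z * integral {0..1} (?g z))"
    by (intro continuous_on_mult cm) simp
  moreover have "duhamel W (fst z) (snd z) = ?m z * integral {0..1} (?g z)" if z: "z \<in> ?K" for z
  proof -
    have "continuous_on {0..1} (?g z)"
    proof -
      have "continuous_on {0..1} (\<lambda>\<theta>. (z, \<theta>))" by (intro continuous_intros)
      from continuous_on_compose2[OF cg this] z show ?thesis by (simp add: image_subset_iff)
    qed
    then have si: "set_integrable lborel {0..1} (?g z)" by (rule borel_integrable_atLeastAtMost')
    have "snd z \<in> {0..L}" "0 \<le> fst z" using z by auto
    from duhamel_rescaled[OF this, of W] show ?thesis unfolding set_borel_integral_eq_integral(2)[OF si] .
  qed
  ultimately show ?thesis by simp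
qed

lemma duhamel_bound:
  assumes W: "continuous_on ({0..T} \<times> {0..L}) (\<lambda>z. W (fst z) (snd z))"
    and b: "\<And>s y. s \<in> {0..T} \<Longrightarrow> y \<in> {0..L} \<Longrightarrow> \<bar>W s y\<bar> \<le> C * exp (lam * s)"
    and lam: "0 < lam" and t: "t \<in> {0..T}" and x: "x \<in> {0..L}" and C: "0 \<le> C"
  shows "\<bar>duhamel W t x\<bar> \<le> C / lam * exp (lam * t)"
proof -
  let ?a = "max 0 (t - P x)"
  have at: "?a \<le> t" using t P_in[OF x] by auto
  have "has_bochner_integral lborel (\<lambda>s. indicator {?a..t} s *\<^sub>R (C * exp (lam * s))) (C / lam * exp (lam * t) - C / lam * exp (lam * ?a))"
  proof (rule has_bochner_integral_FTC_Icc[OF at])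
    show "continuous_on {?a..t} (\<lambda>s. C * exp (lam * s))" by (intro continuous_intros)
    show "((\<lambda>s. C / lam * exp (lam * s)) has_vector_derivative C * exp (lam * s)) (at s within {?a..t})" for s
      unfolding has_real_derivative_iff_has_vector_derivative[symmetric]
      using lam by (auto intro!: derivative_eq_intros)
  qed
  then have e: "set_integrable lborel {?a..t} (\<lambda>s. C * exp (lam * s))"
      "(LBINT s:{?a..t}. C * exp (lam * s)) = C / lam * exp (lam * t) - C / lam * exp (lam * ?a)"
    unfolding set_integrable_def set_lebesgue_integral_def
    by (auto simp: has_bochner_integral_iff)
  have i: "set_integrable lborel {?a..t} (\<lambda>s. \<bar>W s (X (P x - t + s))\<bar>)"
    using integrable_along[OF W t x] by (rule set_integrable_abs)
  have "\<bar>duhamel W t x\<bar> \<le> (LBINT s:{?a..t}. \<bar>W s (X (P x - t + s))\<bar>)"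
    unfolding duhamel_def set_lebesgue_integral_def
    using integral_abs_bound[of lborel "\<lambda>s. indicator {?a..t} s *\<^sub>R W s (X (P x - t + s))"] by (simp add: abs_mult)
  also have "\<dots> \<le> (LBINT s:{?a..t}. C * exp (lam * s))"
  proof (rule set_integral_mono[OF i e(1)])
    fix s assume s: "s \<in> {?a..t}"
    show "\<bar>W s (X (P x - t + s))\<bar> \<le> C * exp (lam * s)"
      using along_in_rectangle[OF t x s] by (intro b) auto
  qed
  also have "\<dots> \<le> C / lam * exp (lam * t)" unfolding e(2) using C lam by simp
  finally show ?thesis .
qed

lemma duhamel_diff:
  assumes W: "continuous_on ({0..T} \<times> {0..L}) (\<lambda>z. W (fst z) (snd z))"
    and V: "continuous_on ({0..T} \<times> {0..L}) (\<lambda>z. V (fst z) (snd z))"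
    and t: "t \<in> {0..T}" and x: "x \<in> {0..L}"
  shows "duhamel W t x - duhamel V t x = duhamel (\<lambda>s y. W s y - V s y) t x"
  unfolding duhamel_def using integrable_along[OF W t x] integrable_along[OF V t x]
  by (simp add: set_integral_diff)

lemma inflow_continuous:
  fixes g :: "real \<Rightarrow> real"
  assumes g: "continuous_on {0..T} g"
  shows "continuous_on ({0..T} \<times> {0..L}) (\<lambda>z. g (max 0 (fst z - P (snd z))))"
proof (rule continuous_on_compose2[OF g])
  have cP: "continuous_on ({0..T} \<times> {0..L}) (\<lambda>z. P (snd z))"
    by (rule continuous_on_compose2[OF P_cont]) (auto intro!: continuous_intros)
  show "continuous_on ({0..T} \<times> {0..L}) (\<lambda>z. max 0 (fst z - P (snd z)))"
    by (intro continuous_intros cP)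
  show "(\<lambda>z. max 0 (fst z - P (snd z))) ` ({0..T} \<times> {0..L}) \<subseteq> {0..T}"
    using P_in by (force simp: max_def)
qed

end

lemma vec2_continuous:
  fixes f g :: "'a::t2_space \<Rightarrow> real"
  assumes "continuous_on S f" "continuous_on S g"
  shows "continuous_on S (\<lambda>z. (\<chi> i. if i = 1 then f z else g z) :: real^2)"
proof (rule continuous_on_vec_lambda)
  fix i :: 2
  show "continuous_on S (\<lambda>z. if i = 1 then f z else g z)"
    using assms by (cases "i = 1") auto
qed

lemma L2_continuous_of_continuous:
  fixes r :: "real \<Rightarrow> real \<Rightarrow> real^2"
  assumes c: "continuous_on ({0..T} \<times> {0..L}) (\<lambda>z. r (fst z) (snd z))"
  shows "L2_continuous T L r"
proof -
  have sec: "continuous_on {0..L} (r t)" if t: "t \<in> {0..T}" for t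
  proof -
    have "continuous_on {0..L} (\<lambda>x. (t, x))" by (intro continuous_intros)
    from continuous_on_compose2[OF c this] t show ?thesis by (simp add: image_subset_iff)
  qed
  have L2: "L2_on {0..L} (r t)" if t: "t \<in> {0..T}" for t
  proof -
    have "(\<lambda>x. indicator {0..L} x *\<^sub>R r t x) \<in> borel_measurable borel"
      by (rule borel_measurable_continuous_on_indicator[OF _ sec[OF t]]) simp
    moreover have "set_integrable lborel {0..L} (\<lambda>x. (norm (r t x))\<^sup>2)"
      by (rule borel_integrable_atLeastAtMost') (intro continuous_intros sec[OF t])
    ultimately show ?thesis unfolding L2_on_def set_borel_measurable_def by simp
  qed
  have lim: "((\<lambda>s. LBINT x:{0..L}. (norm (r s x - r t x))\<^sup>2) \<longlongrightarrow> 0) (at t within {0..T})" if t: "t \<in> {0..T}" for t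
  proof -
    have "continuous_on ({0..T} \<times> {0..L}) (\<lambda>z. r t (snd z))"
      by (rule continuous_on_compose2[OF sec[OF t]]) (auto intro!: continuous_intros)
    then have "continuous_on ({0..T} \<times> {0..L}) (\<lambda>z. (norm (r (fst z) (snd z) - r t (snd z)))\<^sup>2)"
      by (intro continuous_intros c)
    then have "continuous_on {0..T} (\<lambda>s. integral (cbox 0 L) (\<lambda>x. (norm (r s x - r t x))\<^sup>2))"
      by (intro integral_continuous_on_param) (simp add: case_prod_unfold)
    then have c1: "continuous_on {0..T} (\<lambda>s. integral {0..L} (\<lambda>x. (norm (r s x - r t x))\<^sup>2))" by simp
    have "(LBINT x:{0..L}. (norm (r s x - r t x))\<^sup>2) = integral {0..L} (\<lambda>x. (norm (r s x - r t x))\<^sup>2)" if s: "s \<in> {0..T}" for s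
    proof -
      have "set_integrable lborel {0..L} (\<lambda>x. (norm (r s x - r t x))\<^sup>2)"
        by (rule borel_integrable_atLeastAtMost') (intro continuous_intros sec[OF t] sec[OF s])
      then show ?thesis by (rule set_borel_integral_eq_integral(2))
    qed
    note eq = this
    have c2: "continuous_on {0..T} (\<lambda>s. LBINT x:{0..L}. (norm (r s x - r t x))\<^sup>2)"
      by (rule continuous_on_eq[OF c1 eq[symmetric]])
    have "(LBINT x:{0..L}. (norm (r t x - r t x))\<^sup>2) = 0" unfolding set_lebesgue_integral_def by simp
    with c2[unfolded continuous_on_def, THEN bspec, OF t] show ?thesis by (simp only:)
  qed
  show ?thesis unfolding L2_continuous_def using L2 lim by blast
qed

text \<open>
  Picard iteration in the space of continuous fields with the weight \<open>exp (lam * t)\<close>. Continuity of \<open>u\<close> and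
  \<open>u 0 = 0\<close> ensure that the data fit together at the corners, so that the iteration stays among
  continuous fields and the equations hold at every point.
\<close>

lemma dynamic_state_exists:
  fixes M :: "real \<Rightarrow> real^2^2" and u :: "real \<Rightarrow> real^2"
  assumes tp: "travel L Yp 0 L 1 dp Pp Xp" and tm: "travel L Ym L 0 (-1) dm Pm Xm"
    and M: "continuous_on {0..L} M" and u: "continuous_on {0..T} u" and u0: "u 0 = 0"
  obtains r where "dynamic_state L dp dm M \<eta>0 T u r"
proof -
  interpret p: travel L Yp 0 L 1 dp Pp Xp by (rule tp)
  interpret m: travel L Ym L 0 "-1" dm Pm Xm by (rule tm)
  let ?K = "{0..T} \<times> {0..L}"
  define N where "N f i s y = \<eta>0 * (M y *v f (s, y)) $ i" for f :: "real \<times> real \<Rightarrow> real^2" and i s y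
  define \<Phi> where "\<Phi> f z = (\<chi> i::2. if i = 1
      then u (max 0 (fst z - Pp (snd z))) $ 1 + p.duhamel (N f 1) (fst z) (snd z)
      else u (max 0 (fst z - Pm (snd z))) $ 2 + m.duhamel (N f 2) (fst z) (snd z))" for f :: "real \<times> real \<Rightarrow> real^2" and z
  obtain C where C: "0 < C" "\<And>x v i. x \<in> {0..L} \<Longrightarrow> \<bar>(M x *v v) $ i\<bar> \<le> C * norm v"
    using matrix_vector_bound[OF M] by metis
  \<comment> \<open>each component contributes \<open>|\<eta>0| C / lam\<close>, and both together must not exceed \<open>1/2\<close>\<close>
  define lam where "lam = 4 * \<bar>\<eta>0\<bar> * C + 1"
  have lam: "0 < lam" unfolding lam_def using C(1) by (simp add: add_nonneg_pos)
  have cN: "continuous_on ?K (\<lambda>z. N f i (fst z) (snd z))" if f: "continuous_on ?K f" for f i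
  proof -
    have "continuous_on ?K (\<lambda>z. M (snd z))"
      by (rule continuous_on_compose2[OF M]) (auto intro!: continuous_intros)
    from continuous_matrix_vector[OF this f] show ?thesis
      unfolding N_def by (auto intro!: continuous_intros)
  qed
  have cu: "continuous_on {0..T} (\<lambda>t. u t $ i)" for i using u by (intro continuous_intros)
  obtain f where f: "continuous_on ?K f" "\<And>z. z \<in> ?K \<Longrightarrow> \<Phi> f z = f z"
  proof (rule weighted_contraction_fixed_point[of ?K \<Phi> 1 "\<lambda>z. exp (lam * fst z)" "exp (lam * T)"])
    show "compact ?K" by (intro compact_Times compact_Icc)
    show "continuous_on ?K (\<Phi> f)" if f: "continuous_on ?K f" for f
      unfolding \<Phi>_def[abs_def]
      by (intro vec2_continuous continuous_on_add p.inflow_continuous m.inflow_continuous cu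
          p.duhamel_continuous m.duhamel_continuous cN[OF f])
    show "1 \<le> exp (lam * fst z) \<and> exp (lam * fst z) \<le> exp (lam * T)" if "z \<in> ?K" for z
      using that lam by auto
    fix f g :: "real \<times> real \<Rightarrow> real^2" and B z
    assume f: "continuous_on ?K f" and g: "continuous_on ?K g" and B: "0 \<le> B"
      and fg: "\<And>z. z \<in> ?K \<Longrightarrow> norm (f z - g z) \<le> B * exp (lam * fst z)" and z: "z \<in> ?K"
    let ?C = "\<bar>\<eta>0\<bar> * C * B"
    have tz: "fst z \<in> {0..T}" "snd z \<in> {0..L}" using z by auto
    have bN: "\<bar>N f i s y - N g i s y\<bar> \<le> ?C * exp (lam * s)" if sy: "s \<in> {0..T}" "y \<in> {0..L}" for i s y
    proof -
      have "N f i s y - N g i s y = \<eta>0 * (M y *v (f (s, y) - g (s, y))) $ i"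
        unfolding N_def by (simp add: matrix_vector_mult_diff_distrib right_diff_distrib)
      then have "\<bar>N f i s y - N g i s y\<bar> = \<bar>\<eta>0\<bar> * \<bar>(M y *v (f (s, y) - g (s, y))) $ i\<bar>" by (simp add: abs_mult)
      also have "\<dots> \<le> \<bar>\<eta>0\<bar> * (C * (B * exp (lam * s)))"
      proof (rule mult_left_mono)
        have "norm (f (s, y) - g (s, y)) \<le> B * exp (lam * s)" using fg[of "(s, y)"] sy by simp
        then have "C * norm (f (s, y) - g (s, y)) \<le> C * (B * exp (lam * s))" using C(1) by (intro mult_left_mono) auto
        then show "\<bar>(M y *v (f (s, y) - g (s, y))) $ i\<bar> \<le> C * (B * exp (lam * s))"
          using C(2)[OF sy(2), of "f (s, y) - g (s, y)" i] by linarith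
      qed simp
      finally show ?thesis by (simp add: mult.assoc)
    qed
    have cd: "continuous_on ?K (\<lambda>z. N f i (fst z) (snd z) - N g i (fst z) (snd z))" for i
      by (intro continuous_on_diff cN f g)
    have C0: "0 \<le> ?C" using C(1) B by simp
    have e1: "(\<Phi> f z - \<Phi> g z) $ 1 = p.duhamel (\<lambda>s y. N f 1 s y - N g 1 s y) (fst z) (snd z)"
      unfolding \<Phi>_def using p.duhamel_diff[of T "N f 1" "N g 1", OF cN[OF f] cN[OF g] tz] by simp
    have e2: "(\<Phi> f z - \<Phi> g z) $ 2 = m.duhamel (\<lambda>s y. N f 2 s y - N g 2 s y) (fst z) (snd z)"
      unfolding \<Phi>_def using m.duhamel_diff[of T "N f 2" "N g 2", OF cN[OF f] cN[OF g] tz] by simp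
    have "norm (\<Phi> f z - \<Phi> g z) \<le> ?C / lam * exp (lam * fst z) + ?C / lam * exp (lam * fst z)"
      using norm_le_components_2[of "\<Phi> f z - \<Phi> g z"] p.duhamel_bound[of T "\<lambda>s y. N f 1 s y - N g 1 s y", OF cd bN lam tz C0] m.duhamel_bound[of T "\<lambda>s y. N f 2 s y - N g 2 s y", OF cd bN lam tz C0]
      unfolding e1 e2 by linarith
    also have "\<dots> = (2 * (\<bar>\<eta>0\<bar> * C) / lam) * (B * exp (lam * fst z))" by (simp add: field_simps)
    also have "\<dots> \<le> (1 / 2) * (B * exp (lam * fst z))"
    proof (rule mult_right_mono)
      have "4 * (\<bar>\<eta>0\<bar> * C) \<le> lam" unfolding lam_def by simp
      then have "2 * (\<bar>\<eta>0\<bar> * C) \<le> 1 / 2 * lam" by linarith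
      then show "2 * (\<bar>\<eta>0\<bar> * C) / lam \<le> 1 / 2" by (subst pos_divide_le_eq[OF lam])
    qed (use B in simp)
    finally show "norm (\<Phi> f z - \<Phi> g z) \<le> B / 2 * exp (lam * fst z)" by simp
  qed auto
  define r where "r t x = f (t, x)" for t x
  have cr: "continuous_on ?K (\<lambda>z. r (fst z) (snd z))" using f(1) unfolding r_def by simp
  have N_r: "N f i = (\<lambda>s y. \<eta>0 * (M y *v r s y) $ i)" for i unfolding N_def r_def by simp
  have int: "integrated_at L dp dm M \<eta>0 u r t x" if t: "t \<in> {0..T}" and x: "x \<in> {0..L}" for t x
  proof -
    have t0: "0 \<le> t" using t by simp
    have fx: "r t x = \<Phi> f (t, x)" using f(2)[of "(t, x)"] t x unfolding r_def by simp
    have "r t x $ 1 = u (max 0 (t - Pp x)) $ 1 + p.duhamel (N f 1) t x"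
      "r t x $ 2 = u (max 0 (t - Pm x)) $ 2 + m.duhamel (N f 2) t x"
      unfolding fx \<Phi>_def by simp_all
    moreover have "u (max 0 (t - Pp x)) $ 1 = (if t \<le> Pp x then 0 else u (t - Pp x) $ 1)"
      "u (max 0 (t - Pm x)) $ 2 = (if t \<le> Pm x then 0 else u (t - Pm x) $ 2)"
      using u0 by (auto simp: max_def)
    ultimately show ?thesis
      unfolding integrated_at_def p.value_along_characteristic_iff[OF x t0] m.value_along_characteristic_iff[OF x t0]
      using p.integrable_along[of T "N f 1", OF cN[OF f(1)] t x] m.integrable_along[of T "N f 2", OF cN[OF f(1)] t x]
      unfolding p.duhamel_def m.duhamel_def N_r by simp
  qed
  have "set_borel_measurable lborel ?K (\<lambda>(t, x). r t x)"
  proof -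
    have "(\<lambda>z. indicator ?K z *\<^sub>R r (fst z) (snd z)) \<in> borel_measurable borel"
      by (rule borel_measurable_continuous_on_indicator[OF _ cr]) (intro borel_closed closed_Times closed_atLeastAtMost)
    then show ?thesis unfolding set_borel_measurable_def by (simp add: case_prod_unfold)
  qed
  moreover have "L2_continuous T L r" by (rule L2_continuous_of_continuous[OF cr])
  moreover have "\<forall>t\<in>{0..T}. AE x\<in>{0..L} in lborel. integrated_at L dp dm M \<eta>0 u r t x"
    using int by auto
  moreover have "\<forall>x\<in>{0, L}. AE t\<in>{0..T} in lborel. integrated_at L dp dm M \<eta>0 u r t x"
    using int p.L_pos by auto
  ultimately have "dynamic_state L dp dm M \<eta>0 T u r" unfolding dynamic_state_def by blast
  then show ?thesis by (rule that)
qed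

section \<open>Quadratic costs and the dissipation condition\<close>

lemma diag2_entries: "diag2 a b $ 1 $ 1 = a" "diag2 a b $ 1 $ 2 = 0" "diag2 a b $ 2 $ 1 = 0" "diag2 a b $ 2 $ 2 = b"
  unfolding diag2_def by simp_all

lemma inner_2: "(v :: real^2) \<bullet> w = v $ 1 * w $ 1 + v $ 2 * w $ 2"
  by (simp add: inner_vec_def sum_2)

lemma norm_squared_2: "(norm (v :: real^2))\<^sup>2 = (v $ 1)\<^sup>2 + (v $ 2)\<^sup>2"
  unfolding power2_norm_eq_inner inner_2 by (simp add: power2_eq_square)

lemma quad_form_2:
  fixes A :: "real^2^2"
  shows "w \<bullet> (A *v w) = A $ 1 $ 1 * (w $ 1 * w $ 1) + (A $ 1 $ 2 + A $ 2 $ 1) * (w $ 1 * w $ 2) + A $ 2 $ 2 * (w $ 2 * w $ 2)"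
  by (simp add: inner_2 matrix_vector_2 algebra_simps)

lemma quad_cost_expand:
  assumes "transpose A = A"
  shows "quad_cost A c (z + w) = quad_cost A c z + (A *v z + c) \<bullet> w + 1/2 * (w \<bullet> (A *v w))"
proof -
  have "z \<bullet> (A *v w) = (A *v z) \<bullet> w"
    using dot_lmul_matrix[of z A w] vector_transpose_matrix[of z A] assms transpose_matrix_vector[of A z] by simp
  moreover have "w \<bullet> (A *v z) = (A *v z) \<bullet> w" by (rule inner_commute)
  ultimately show ?thesis
    unfolding quad_cost_def by (simp add: matrix_vector_right_distrib inner_add_left inner_add_right)
qed

text \<open>
  Minimum and maximum of the quadratic form on the unit circle.
\<close>

lemma symmetric_pos_def_bounds:
  assumes "symmetric_pos_def A"
  obtains lo hi where "0 < lo" "\<And>w. lo * (norm w)\<^sup>2 \<le> w \<bullet> (A *v w)" "\<And>w. w \<bullet> (A *v w) \<le> hi * (norm w)\<^sup>2" "0 < hi"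
proof -
  let ?q = "\<lambda>w. w \<bullet> (A *v w)" and ?S = "sphere (0::real^2) 1"
  have c: "continuous_on ?S ?q"
    by (intro continuous_on_inner continuous_on_id linear_continuous_on matrix_vector_mul_bounded_linear)
  have ne: "?S \<noteq> {}" by simp
  obtain a where a: "a \<in> ?S" "\<And>w. w \<in> ?S \<Longrightarrow> ?q a \<le> ?q w"
    using continuous_attains_inf[OF compact_sphere ne c] by blast
  obtain b where b: "b \<in> ?S" "\<And>w. w \<in> ?S \<Longrightarrow> ?q w \<le> ?q b"
    using continuous_attains_sup[OF compact_sphere ne c] by blast
  have "a \<noteq> 0" using a(1) by auto
  then have a0: "0 < ?q a" using assms unfolding symmetric_pos_def_def by blast
  have scale: "?q w = (norm w)\<^sup>2 * ?q ((1 / norm w) *\<^sub>R w)" "(1 / norm w) *\<^sub>R w \<in> ?S" if "w \<noteq> 0" for w :: "real^2"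
    using that by (auto simp: matrix_vector_mult_scaleR power2_eq_square)
  show ?thesis
  proof (rule that[OF a0])
    show "?q a * (norm w)\<^sup>2 \<le> ?q w" for w
    proof (cases "w = 0")
      case False
      from mult_left_mono[OF a(2)[OF scale(2)[OF False]], of "(norm w)\<^sup>2"] scale(1)[OF False]
      show ?thesis by (simp add: mult.commute)
    qed simp
    show "?q w \<le> ?q b * (norm w)\<^sup>2" for w
    proof (cases "w = 0")
      case False
      from mult_left_mono[OF b(2)[OF scale(2)[OF False]], of "(norm w)\<^sup>2"] scale(1)[OF False]
      show ?thesis by (simp add: mult.commute)
    qed simp
    show "0 < ?q b" using a0 b(2)[OF a(1)] by linarith
  qed
qed

text \<open>
  By homogeneity the supremum over the ellipse \<open>n v = 1\<close> controls \<open>q\<close> everywhere.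
\<close>

lemma homogeneous_sup_bound:
  fixes q n :: "real^2 \<Rightarrow> real"
  assumes q: "\<And>v. q v = \<alpha> * (v $ 1)\<^sup>2 + \<beta> * (v $ 1 * v $ 2) + \<gamma> * (v $ 2)\<^sup>2"
    and n: "\<And>v. n v = e1 * (v $ 1)\<^sup>2 + e2 * (v $ 2)\<^sup>2" and e: "0 < e1" "0 < e2"
    and sup: "(SUP v\<in>{v. n v = 1}. q v) \<le> \<nu>"
  shows "q v \<le> \<nu> * n v"
proof (cases "v = 0")
  case True
  then show ?thesis unfolding q n by simp
next
  case False
  \<comment> \<open>on unbounded sets of reals the supremum carries no information\<close>
  have bdd: "bdd_above (q ` {v. n v = 1})"
  proof (rule bdd_aboveI2)
    fix v assume "v \<in> {v. n v = 1}"
    then have n1: "e1 * (v $ 1)\<^sup>2 + e2 * (v $ 2)\<^sup>2 = 1" using n by simp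
    have p: "0 \<le> e1 * (v $ 1)\<^sup>2" "0 \<le> e2 * (v $ 2)\<^sup>2" using e by simp_all
    have "e1 * (v $ 1)\<^sup>2 \<le> 1" "e2 * (v $ 2)\<^sup>2 \<le> 1" using n1 p by linarith+
    then have v: "(v $ 1)\<^sup>2 \<le> 1 / e1" "(v $ 2)\<^sup>2 \<le> 1 / e2"
      using e by (simp_all add: pos_le_divide_eq mult.commute)
    have "\<beta> * (v $ 1 * v $ 2) \<le> \<bar>\<beta>\<bar> * ((v $ 1)\<^sup>2 + (v $ 2)\<^sup>2)"
    proof -
      have "\<bar>v $ 1 * v $ 2\<bar> \<le> (v $ 1)\<^sup>2 + (v $ 2)\<^sup>2"
        using sum_squares_bound[of "\<bar>v $ 1\<bar>" "\<bar>v $ 2\<bar>"] mult_nonneg_nonneg[OF abs_ge_zero abs_ge_zero, of "v $ 1" "v $ 2"]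
        unfolding abs_mult power2_abs by linarith
      then have "\<bar>\<beta>\<bar> * \<bar>v $ 1 * v $ 2\<bar> \<le> \<bar>\<beta>\<bar> * ((v $ 1)\<^sup>2 + (v $ 2)\<^sup>2)" by (rule mult_left_mono) simp
      then show ?thesis using abs_ge_self[of "\<beta> * (v $ 1 * v $ 2)"] by (simp only: abs_mult)
    qed
    moreover have "\<alpha> * (v $ 1)\<^sup>2 \<le> \<bar>\<alpha>\<bar> * (v $ 1)\<^sup>2" "\<gamma> * (v $ 2)\<^sup>2 \<le> \<bar>\<gamma>\<bar> * (v $ 2)\<^sup>2" by (simp_all add: mult_right_mono)
    moreover have "(\<bar>\<alpha>\<bar> + \<bar>\<beta>\<bar>) * (v $ 1)\<^sup>2 \<le> (\<bar>\<alpha>\<bar> + \<bar>\<beta>\<bar>) * (1 / e1)" "(\<bar>\<gamma>\<bar> + \<bar>\<beta>\<bar>) * (v $ 2)\<^sup>2 \<le> (\<bar>\<gamma>\<bar> + \<bar>\<beta>\<bar>) * (1 / e2)"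
      by (intro mult_left_mono v; simp)+
    ultimately show "q v \<le> (\<bar>\<alpha>\<bar> + \<bar>\<beta>\<bar>) * (1 / e1) + (\<bar>\<gamma>\<bar> + \<bar>\<beta>\<bar>) * (1 / e2)"
      unfolding q distrib_left distrib_right by linarith
  qed
  have "v $ 1 \<noteq> 0 \<or> v $ 2 \<noteq> 0" using False by (auto simp: vec_eq_iff forall_2)
  then have np: "0 < n v" unfolding n using e by (auto intro: add_pos_nonneg add_nonneg_pos)
  let ?w = "(1 / sqrt (n v)) *\<^sub>R v"
  have sq: "(1 / sqrt (n v)) * (1 / sqrt (n v)) = 1 / n v" using np by simp
  have nw: "n ?w = 1" and qw: "q ?w = q v / n v"
  proof -
    have hom: "n (r *\<^sub>R v) = r * r * n v" "q (r *\<^sub>R v) = r * r * q v" for r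
      unfolding n q by (simp_all add: power2_eq_square algebra_simps)
    have "n ?w = ((1 / sqrt (n v)) * (1 / sqrt (n v))) * n v" by (rule hom)
    then show "n ?w = 1" using sq np by simp
    have "q ?w = ((1 / sqrt (n v)) * (1 / sqrt (n v))) * q v" by (rule hom)
    then show "q ?w = q v / n v" using sq by simp
  qed
  have "q ?w \<le> \<nu>" using cSUP_upper[OF _ bdd, of ?w] nw sup by simp
  then show ?thesis unfolding qw using np by (simp add: pos_divide_le_eq)
qed

text \<open>
  The quadratic form of the dissipation condition, written out. The left-hand side is the integrand
  that \<open>balance\<close> produces for the two components of \<open>v\<close> with the weights \<open>exp (- \<mu>p x)\<close> and \<open>exp (\<mu>m x)\<close>.
\<close>

lemma Lyapunov_inequality:
  fixes M :: "real \<Rightarrow> real^2^2"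
  assumes L: "0 < L" and x: "x \<in> {0..L}" and \<eta>0: "\<eta>0 \<le> 0"
    and dp: "(dp has_real_derivative dp') (at x within {0..L})"
    and dm: "(dm has_real_derivative dm') (at x within {0..L})"
    and sup: "(let E = weight_matrix \<mu>p \<mu>m; D = (\<lambda>y. diag2 (dp y) (dm y)) in
            (SUP v\<in>{v. v \<bullet> (E x *v v) = 1}.
               v \<bullet> ((vector_derivative (\<lambda>y. E y ** D y) (at x within {0..L})
                      - \<bar>\<eta>0\<bar> *\<^sub>R (E x ** M x + transpose (M x) ** E x)) *v v)) \<le> \<nu>)"
  shows "(exp (- \<mu>p * x) * dp' - \<mu>p * exp (- \<mu>p * x) * dp x) * (v $ 1)\<^sup>2
      + (exp (\<mu>m * x) * dm' + \<mu>m * exp (\<mu>m * x) * dm x) * (v $ 2)\<^sup>2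
      + 2 * (exp (- \<mu>p * x) * (v $ 1 * (\<eta>0 * (M x *v v) $ 1)) + exp (\<mu>m * x) * (v $ 2 * (\<eta>0 * (M x *v v) $ 2)))
    \<le> \<nu> * (exp (- \<mu>p * x) * (v $ 1)\<^sup>2 + exp (\<mu>m * x) * (v $ 2)\<^sup>2)"
proof -
  let ?k1 = "exp (- \<mu>p * x) * dp' - \<mu>p * exp (- \<mu>p * x) * dp x"
  let ?k2 = "exp (\<mu>m * x) * dm' + \<mu>m * exp (\<mu>m * x) * dm x"
  have dec: "diag2 a b = a *\<^sub>R diag2 1 0 + b *\<^sub>R diag2 0 1" for a b
    by (simp add: vec_eq_iff forall_2 diag2_entries)
  have prod: "weight_matrix \<mu>p \<mu>m y ** diag2 (dp y) (dm y) = diag2 (exp (- \<mu>p * y) * dp y) (exp (\<mu>m * y) * dm y)" for y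
    unfolding weight_matrix_def by (simp add: vec_eq_iff forall_2 diag2_entries matrix_matrix_mult_def sum_2)
  have r1: "((\<lambda>y. exp (- \<mu>p * y) * dp y) has_real_derivative ?k1) (at x within {0..L})"
    by (auto intro!: derivative_eq_intros dp)
  have r2: "((\<lambda>y. exp (\<mu>m * y) * dm y) has_real_derivative ?k2) (at x within {0..L})"
    by (auto intro!: derivative_eq_intros dm)
  have "((\<lambda>y. weight_matrix \<mu>p \<mu>m y ** diag2 (dp y) (dm y)) has_vector_derivative diag2 ?k1 ?k2) (at x within {0..L})"
    unfolding prod
    unfolding dec[of "exp (- \<mu>p * _) * dp _" "exp (\<mu>m * _) * dm _"] dec[of ?k1 ?k2]
    by (intro has_vector_derivative_add has_vector_derivative_scaleR[OF _ has_vector_derivative_const, simplified] r1 r2)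
  then have vd: "vector_derivative (\<lambda>y. weight_matrix \<mu>p \<mu>m y ** diag2 (dp y) (dm y)) (at x within {0..L}) = diag2 ?k1 ?k2"
    using vector_derivative_within_cbox[of 0 L] L x by simp
  define q where "q v = v \<bullet> ((diag2 ?k1 ?k2 - \<bar>\<eta>0\<bar> *\<^sub>R (weight_matrix \<mu>p \<mu>m x ** M x + transpose (M x) ** weight_matrix \<mu>p \<mu>m x)) *v v)" for v
  define n where "n v = v \<bullet> (weight_matrix \<mu>p \<mu>m x *v v)" for v
  have qe: "q v = ?k1 * (v $ 1)\<^sup>2 + ?k2 * (v $ 2)\<^sup>2 + 2 * (exp (- \<mu>p * x) * (v $ 1 * (\<eta>0 * (M x *v v) $ 1)) + exp (\<mu>m * x) * (v $ 2 * (\<eta>0 * (M x *v v) $ 2)))" for v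
    unfolding q_def weight_matrix_def using \<eta>0
    by (simp add: inner_2 matrix_vector_2 diag2_entries matrix_matrix_mult_def sum_2 transpose_def power2_eq_square algebra_simps)
  have ne: "n v = exp (- \<mu>p * x) * (v $ 1)\<^sup>2 + exp (\<mu>m * x) * (v $ 2)\<^sup>2" for v
    unfolding n_def weight_matrix_def
    by (simp add: inner_2 matrix_vector_2 diag2_entries power2_eq_square algebra_simps)
  have "(SUP v\<in>{v. n v = 1}. q v) \<le> \<nu>"
    using sup unfolding Let_def vd q_def n_def .
  from homogeneous_sup_bound[OF _ ne _ _ this, of
      "?k1 + 2 * exp (- \<mu>p * x) * \<eta>0 * M x $ 1 $ 1"
      "2 * exp (- \<mu>p * x) * \<eta>0 * M x $ 1 $ 2 + 2 * exp (\<mu>m * x) * \<eta>0 * M x $ 2 $ 1"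
      "?k2 + 2 * exp (\<mu>m * x) * \<eta>0 * M x $ 2 $ 2" v]
  have "q v \<le> \<nu> * n v" unfolding qe matrix_vector_2 by (simp add: power2_eq_square algebra_simps)
  then show ?thesis unfolding qe ne .
qed

lemma L2_on_component:
  assumes "L2_on {0..T} u"
  shows "square_integrable lborel {0..T} (\<lambda>t. u t $ i)"
proof -
  have m: "(\<lambda>t. (indicator {0..T} t *\<^sub>R u t) $ i) \<in> borel_measurable lborel"
    using assms unfolding L2_on_def set_borel_measurable_def
    by (intro measurable_compose[OF _ borel_measurable_continuous_onI[OF continuous_on_component[OF continuous_on_id]]]) auto
  then have mi: "(\<lambda>t. indicator {0..T} t * (u t $ i)) \<in> borel_measurable lborel" by simp
  have "integrable lborel (\<lambda>t. (indicator {0..T} t * (u t $ i))\<^sup>2)"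
  proof (rule Bochner_Integration.integrable_bound)
    show "integrable lborel (\<lambda>t. indicator {0..T} t *\<^sub>R (norm (u t))\<^sup>2)"
      using assms unfolding L2_on_def set_integrable_def by simp
    show "(\<lambda>t. (indicator {0..T} t * (u t $ i))\<^sup>2) \<in> borel_measurable lborel" using borel_measurable_power[OF mi] .
    show "AE t in lborel. norm ((indicator {0..T} t * (u t $ i))\<^sup>2) \<le> norm (indicator {0..T} t *\<^sub>R (norm (u t))\<^sup>2)"
    proof (rule AE_I2)
      fix t
      have "(u t $ i)\<^sup>2 \<le> (norm (u t))\<^sup>2"
        using power_mono[OF component_le_norm_cart[of "u t" i] abs_ge_zero, of 2] by (simp only: power2_abs)
      then show "norm ((indicator {0..T} t * (u t $ i))\<^sup>2) \<le> norm (indicator {0..T} t *\<^sub>R (norm (u t))\<^sup>2)"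
        by (cases "t \<in> {0..T}") simp_all
    qed
  qed
  then show ?thesis unfolding square_integrable_iff using mi by blast
qed

lemma L2_rect_mult_integrable:
  "L2_rect T L f \<Longrightarrow> L2_rect T L g \<Longrightarrow> set_integrable lborel ({0..T} \<times> {0..L}) (\<lambda>(t, x). f t x * g t x)"
  using square_integrable_mult[of lborel "{0..T} \<times> {0..L}" "\<lambda>(t, x). f t x" "\<lambda>(t, x). g t x"]
  unfolding L2_rect_square_integrable by (simp add: case_prod_unfold)

lemma linear_term_zero:
  fixes a b :: real
  assumes "\<And>\<epsilon>. 0 \<le> \<epsilon> * a + \<epsilon>\<^sup>2 * b"
  shows "a = 0"
proof (rule ccontr)
  assume a: "a \<noteq> 0"
  define B where "B = \<bar>b\<bar> + 1"
  have B: "0 < B" "b \<le> B" unfolding B_def by linarith+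
  define \<epsilon> where "\<epsilon> = - a / (2 * B)"
  have "\<epsilon> * a = - (a\<^sup>2 / (2 * B))" unfolding \<epsilon>_def by (simp add: power2_eq_square)
  moreover have "\<epsilon>\<^sup>2 * b \<le> a\<^sup>2 / (2 * B) / 2"
  proof -
    have "\<epsilon>\<^sup>2 * b \<le> \<epsilon>\<^sup>2 * B" using B(2) by (intro mult_left_mono) auto
    also have "\<dots> = a\<^sup>2 / (2 * B) / 2"
      unfolding \<epsilon>_def using B(1) by (simp add: power2_eq_square field_simps)
    finally show ?thesis .
  qed
  moreover have "0 < a\<^sup>2 / (2 * B)" using a B(1) by (intro divide_pos_pos) auto
  moreover have "\<not> 0 \<le> p" if "p = r + s" "r = - q" "s \<le> q / 2" "0 < q" for p q r s :: real
    using that by linarith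
  ultimately show False using assms[of \<epsilon>] by blast
qed

section \<open>The deviation from the static state\<close>

text \<open>
  Besides the two families of characteristics a static state \<open>R\<close> is fixed. The components of \<open>r - R\<close>
  solve two transport equations that are coupled only through their sources.
\<close>

locale deviation = p: travel L Yp 0 L 1 dp Pp Xp + m: travel L Ym L 0 "-1" dm Pm Xm
  for L Yp Ym :: real and dp dm Pp Xp Pm Xm :: "real \<Rightarrow> real" +
  fixes M :: "real \<Rightarrow> real^2^2" and \<eta>0 :: real and R :: "real \<Rightarrow> real^2"
  assumes M_cont: "continuous_on {0..L} M" and R_cont: "continuous_on {0..L} R"
    and R_der1: "\<And>x. x \<in> {0<..<L} \<Longrightarrow> ((\<lambda>x. R x $ 1) has_real_derivative \<eta>0 * (M x *v R x) $ 1 / dp x) (at x)"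
    and R_der2: "\<And>x. x \<in> {0<..<L} \<Longrightarrow> ((\<lambda>x. R x $ 2) has_real_derivative \<eta>0 * (M x *v R x) $ 2 / dm x) (at x)"
begin

definition admissible :: "real \<Rightarrow> (real \<Rightarrow> real^2) \<Rightarrow> (real \<Rightarrow> real \<Rightarrow> real^2) \<Rightarrow> bool" where
  "admissible T u r \<longleftrightarrow> 0 < T \<and> L2_on {0..T} u \<and> dynamic_state L dp dm M \<eta>0 T u r"

lemma R_comp_cont: "continuous_on {0..L} (\<lambda>x. R x $ i)"
  using R_cont by (intro continuous_intros)

lemma M_comp_cont: "continuous_on {0..L} (\<lambda>x. M x $ i $ j)"
  using M_cont by (rule continuous_on_entry)

lemma L2_rect_source:
  assumes r: "\<And>i. L2_rect T L (\<lambda>t x. r t x $ i)"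
  shows "L2_rect T L (\<lambda>t x. \<eta>0 * (M x *v r t x) $ i)"
proof -
  have c: "continuous_on {0..L} (\<lambda>x. \<eta>0 * M x $ i $ j)" for j
    by (intro continuous_intros M_comp_cont)
  have "L2_rect T L (\<lambda>t x. \<eta>0 * M x $ i $ 1 * r t x $ 1 + \<eta>0 * M x $ i $ 2 * r t x $ 2)"
    by (intro L2_rect_add L2_rect_mult_continuous r c)
  moreover have "\<eta>0 * (M x *v r t x) $ i = \<eta>0 * M x $ i $ 1 * r t x $ 1 + \<eta>0 * M x $ i $ 2 * r t x $ 2" for t x
    by (simp add: matrix_vector_mult_def sum_2 algebra_simps)
  ultimately show ?thesis by simp
qed

lemma deviation_regularity:
  assumes adm: "admissible T u r"
  shows "L2_rect T L (\<lambda>t x. r t x $ i - R x $ i)"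
    and "L2_rect T L (\<lambda>t x. \<eta>0 * (M x *v (r t x - R x)) $ i)"
    and "square_integrable lborel {0..L} (\<lambda>x. r T x $ i - R x $ i)"
    and "square_integrable lborel {0..T} (\<lambda>t. u t $ i - k)"
proof -
  have T: "0 < T" and u: "L2_on {0..T} u" and ds: "dynamic_state L dp dm M \<eta>0 T u r"
    using adm unfolding admissible_def by auto
  have mr: "set_borel_measurable lborel ({0..T} \<times> {0..L}) (\<lambda>(t, x). r t x)" and cr: "L2_continuous T L r"
    using ds unfolding dynamic_state_def by auto
  have r: "L2_rect T L (\<lambda>t x. r t x $ i)" for i by (rule L2_rect_component[OF mr cr])
  show z: "L2_rect T L (\<lambda>t x. r t x $ i - R x $ i)" for i
    by (intro L2_rect_diff r L2_rect_continuous R_comp_cont)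
  show "L2_rect T L (\<lambda>t x. \<eta>0 * (M x *v (r t x - R x)) $ i)"
    by (rule L2_rect_source) (use z in simp)
  have "L2_on {0..L} (r T)" using cr T unfolding L2_continuous_def by simp
  then show "square_integrable lborel {0..L} (\<lambda>x. r T x $ i - R x $ i)"
    by (intro square_integrable_diff L2_on_component square_integrable_continuous R_comp_cont)
  show "square_integrable lborel {0..T} (\<lambda>t. u t $ i - k)"
    by (intro square_integrable_diff L2_on_component[OF u] square_integrable_continuous continuous_on_const)
qed

lemma deviation_solution:
  assumes adm: "admissible T u r"
  shows "p.solution T (\<lambda>x. - R x $ 1) (\<lambda>t. u t $ 1 - R 0 $ 1)
      (\<lambda>t x. \<eta>0 * (M x *v (r t x - R x)) $ 1) (\<lambda>t x. r t x $ 1 - R x $ 1)"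
    and "m.solution T (\<lambda>x. - R x $ 2) (\<lambda>t. u t $ 2 - R L $ 2)
      (\<lambda>t x. \<eta>0 * (M x *v (r t x - R x)) $ 2) (\<lambda>t x. r t x $ 2 - R x $ 2)"
proof -
  have T: "0 < T" and u: "L2_on {0..T} u" and ds: "dynamic_state L dp dm M \<eta>0 T u r"
    using adm unfolding admissible_def by auto
  have mr: "set_borel_measurable lborel ({0..T} \<times> {0..L}) (\<lambda>(t, x). r t x)" and cr: "L2_continuous T L r"
    and ia: "\<And>t. t \<in> {0..T} \<Longrightarrow> AE x\<in>{0..L} in lborel. integrated_at L dp dm M \<eta>0 u r t x"
    and ib: "AE t\<in>{0..T} in lborel. integrated_at L dp dm M \<eta>0 u r t 0" "AE t\<in>{0..T} in lborel. integrated_at L dp dm M \<eta>0 u r t L"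
    using ds unfolding dynamic_state_def by auto
  have r: "L2_rect T L (\<lambda>t x. r t x $ i)" for i by (rule L2_rect_component[OF mr cr])
  note w = L2_rect_source[of T r, OF r]
  have Wc: "continuous_on {0..L} (\<lambda>x. \<eta>0 * (M x *v R x) $ i)" for i
    by (intro continuous_intros continuous_matrix_vector M_cont R_cont)
  have split: "\<eta>0 * (M x *v (r t x - R x)) $ i = \<eta>0 * (M x *v r t x) $ i - \<eta>0 * (M x *v R x) $ i" for t x i
    by (simp add: matrix_vector_mult_diff_distrib right_diff_distrib)
  have sq: "square_integrable lborel {0..T} (\<lambda>t. u t $ i)" for i by (rule L2_on_component[OF u])
  show "p.solution T (\<lambda>x. - R x $ 1) (\<lambda>t. u t $ 1 - R 0 $ 1)
      (\<lambda>t x. \<eta>0 * (M x *v (r t x - R x)) $ 1) (\<lambda>t x. r t x $ 1 - R x $ 1)"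
    unfolding split
  proof (rule p.solution_minus_profile[OF T R_comp_cont Wc R_der1 sq w r])
    show "AE x\<in>{0..L} in lborel. value_along_characteristic L dp 0 (\<lambda>t. u t $ 1) (\<lambda>t x. \<eta>0 * (M x *v r t x) $ 1) t x (r t x $ 1)"
      if "t \<in> {0..T}" for t
      by (rule eventually_mono[OF ia[OF that]]) (simp add: integrated_at_def)
    show "AE t\<in>{0..T} in lborel. value_along_characteristic L dp 0 (\<lambda>t. u t $ 1) (\<lambda>t x. \<eta>0 * (M x *v r t x) $ 1) t L (r t L $ 1)"
      by (rule eventually_mono[OF ib(2)]) (simp add: integrated_at_def)
  qed
  show "m.solution T (\<lambda>x. - R x $ 2) (\<lambda>t. u t $ 2 - R L $ 2)
      (\<lambda>t x. \<eta>0 * (M x *v (r t x - R x)) $ 2) (\<lambda>t x. r t x $ 2 - R x $ 2)"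
    unfolding split
  proof (rule m.solution_minus_profile[OF T R_comp_cont Wc R_der2 sq w r])
    show "AE x\<in>{0..L} in lborel. value_along_characteristic L dm L (\<lambda>t. u t $ 2) (\<lambda>t x. \<eta>0 * (M x *v r t x) $ 2) t x (r t x $ 2)"
      if "t \<in> {0..T}" for t
      by (rule eventually_mono[OF ia[OF that]]) (simp add: integrated_at_def)
    show "AE t\<in>{0..T} in lborel. value_along_characteristic L dm L (\<lambda>t. u t $ 2) (\<lambda>t x. \<eta>0 * (M x *v r t x) $ 2) t 0 (r t 0 $ 2)"
      by (rule eventually_mono[OF ib(1)]) (simp add: integrated_at_def)
  qed
qed

text \<open>
  With the weight \<open>1 / d\<close> the derivative \<open>(e d)'\<close> vanishes, which makes the hypotheses of \<open>balance\<close> immediate.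
\<close>

lemma trace_square_integrable:
  assumes adm: "admissible T u r"
  shows "square_integrable lborel {0..T} (\<lambda>t. r t L $ 1 - R L $ 1)"
    and "square_integrable lborel {0..T} (\<lambda>t. r t 0 $ 2 - R 0 $ 2)"
proof -
  have T: "0 < T" using adm unfolding admissible_def by auto
  note z = deviation_regularity(1)[OF adm, unfolded L2_rect_def, THEN conjunct1]
  have one: "continuous_on {0..L} (\<lambda>x. inverse (d x))" "\<And>x. x \<in> {0..L} \<Longrightarrow> inverse (d x) * d x = 1"
    if "continuous_on {0..L} d" "\<And>x. x \<in> {0..L} \<Longrightarrow> d x \<noteq> 0" for d :: "real \<Rightarrow> real"
    using that by (auto intro!: continuous_intros)
  have der: "((\<lambda>x. inverse (d x) * d x) has_real_derivative 0) (at x within {0..L})"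
    if "x \<in> {0..L}" "\<And>x. x \<in> {0..L} \<Longrightarrow> d x \<noteq> 0" for d :: "real \<Rightarrow> real" and x
    by (rule has_field_derivative_transform_within[OF DERIV_const[of 1] zero_less_one that(1)]) (use that(2) in simp)
  note dpn = p.d_nonzero and dmn = m.d_nonzero
  have "set_integrable lborel {0..T} (\<lambda>t. (r t L $ 1 - R L $ 1) * (r t L $ 1 - R L $ 1))"
    by (rule p.balance(1)[OF T deviation_solution(1)[OF adm] deviation_solution(1)[OF adm] one(1)[OF p.d_cont dpn] continuous_on_const der[OF _ dpn]])
  moreover have "set_borel_measurable lborel {0..T} (\<lambda>t. r t L $ 1 - R L $ 1)"
    by (rule set_borel_measurable_section(2)[OF z]) (use p.L_pos in simp)
  ultimately show "square_integrable lborel {0..T} (\<lambda>t. r t L $ 1 - R L $ 1)"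
    unfolding square_integrable_def by (simp add: power2_eq_square)
  have "set_integrable lborel {0..T} (\<lambda>t. (r t 0 $ 2 - R 0 $ 2) * (r t 0 $ 2 - R 0 $ 2))"
    by (rule m.balance(1)[OF T deviation_solution(2)[OF adm] deviation_solution(2)[OF adm] one(1)[OF m.d_cont dmn] continuous_on_const der[OF _ dmn]])
  moreover have "set_borel_measurable lborel {0..T} (\<lambda>t. r t 0 $ 2 - R 0 $ 2)"
    by (rule set_borel_measurable_section(2)[OF z]) (use p.L_pos in simp)
  ultimately show "square_integrable lborel {0..T} (\<lambda>t. r t 0 $ 2 - R 0 $ 2)"
    unfolding square_integrable_def by (simp add: power2_eq_square)
qed

text \<open>
  The balance laws of both components with \<open>\<rho>1 = \<rho>2\<close>, added up. The coupling makes the integrand a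
  quadratic form in \<open>r - R\<close>, which the assumption \<open>lyap\<close> bounds from above.
\<close>

lemma energy_inequality:
  assumes adm: "admissible T u r"
    and e: "continuous_on {0..L} e1" "continuous_on {0..L} e2" and k: "continuous_on {0..L} k1" "continuous_on {0..L} k2"
    and ed1: "\<And>x. x \<in> {0..L} \<Longrightarrow> ((\<lambda>x. e1 x * dp x) has_real_derivative k1 x) (at x within {0..L})"
    and ed2: "\<And>x. x \<in> {0..L} \<Longrightarrow> ((\<lambda>x. e2 x * dm x) has_real_derivative k2 x) (at x within {0..L})"
    and lyap: "\<And>x v. x \<in> {0..L} \<Longrightarrow> k1 x * (v $ 1)\<^sup>2 + k2 x * (v $ 2)\<^sup>2
        + 2 * (e1 x * (v $ 1 * (\<eta>0 * (M x *v v) $ 1)) + e2 x * (v $ 2 * (\<eta>0 * (M x *v v) $ 2)))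
        \<le> - (c * (norm v)\<^sup>2)"
  shows "(LBINT x:{0..L}. e1 x * (r T x $ 1 - R x $ 1)\<^sup>2) + (LBINT x:{0..L}. e2 x * (r T x $ 2 - R x $ 2)\<^sup>2)
      + e1 L * dp L * (LBINT t:{0..T}. (r t L $ 1 - R L $ 1)\<^sup>2) - e2 0 * dm 0 * (LBINT t:{0..T}. (r t 0 $ 2 - R 0 $ 2)\<^sup>2)
      + c * (LBINT t:{0..T}. LBINT x:{0..L}. (norm (r t x - R x))\<^sup>2)
    \<le> (LBINT x:{0..L}. e1 x * (R x $ 1)\<^sup>2) + (LBINT x:{0..L}. e2 x * (R x $ 2)\<^sup>2)
      + e1 0 * dp 0 * (LBINT t:{0..T}. (u t $ 1 - R 0 $ 1)\<^sup>2) - e2 L * dm L * (LBINT t:{0..T}. (u t $ 2 - R L $ 2)\<^sup>2)"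
proof -
  have T: "0 < T" using adm unfolding admissible_def by auto
  note s1 = deviation_solution(1)[OF adm] and s2 = deviation_solution(2)[OF adm]
  let ?z = "\<lambda>i t x. r t x $ i - R x $ i" and ?w = "\<lambda>i t x. \<eta>0 * (M x *v (r t x - R x)) $ i"
  note z = deviation_regularity(1)[OF adm] and w = deviation_regularity(2)[OF adm]
  let ?G1 = "\<lambda>t x. k1 x * (?z 1 t x * ?z 1 t x) + e1 x * (?w 1 t x * ?z 1 t x + ?z 1 t x * ?w 1 t x)"
  let ?G2 = "\<lambda>t x. k2 x * (?z 2 t x * ?z 2 t x) + e2 x * (?w 2 t x * ?z 2 t x + ?z 2 t x * ?w 2 t x)"
  have GI: "set_integrable lborel ({0..T} \<times> {0..L}) (\<lambda>(t, x). k x * (?z i t x * ?z i t x) + e x * (?w i t x * ?z i t x + ?z i t x * ?w i t x))"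
    if "continuous_on {0..L} e" "continuous_on {0..L} k" for e k i
  proof -
    have "set_integrable lborel ({0..T} \<times> {0..L}) (\<lambda>p. (case p of (t, x) \<Rightarrow> (k x * ?z i t x) * ?z i t x) + (case p of (t, x) \<Rightarrow> (2 * e x * ?w i t x) * ?z i t x))"
      by (intro set_integral_add(1) L2_rect_mult_integrable L2_rect_mult_continuous z w continuous_on_mult continuous_on_const that)
    then show ?thesis by (simp add: case_prod_unfold algebra_simps)
  qed
  note I1 = GI[OF e(1) k(1), of 1] and I2 = GI[OF e(2) k(2), of 2]
  have IN: "set_integrable lborel ({0..T} \<times> {0..L}) (\<lambda>(t, x). (norm (r t x - R x))\<^sup>2)"
  proof -
    have "set_integrable lborel ({0..T} \<times> {0..L}) (\<lambda>p. (case p of (t, x) \<Rightarrow> ?z 1 t x * ?z 1 t x) + (case p of (t, x) \<Rightarrow> ?z 2 t x * ?z 2 t x))"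
      by (intro set_integral_add(1) L2_rect_mult_integrable z)
    moreover have "(norm (r t x - R x))\<^sup>2 = ?z 1 t x * ?z 1 t x + ?z 2 t x * ?z 2 t x" for t x
      using norm_squared_2[of "r t x - R x"] by (simp only: power2_eq_square vector_minus_component)
    ultimately show ?thesis by (simp only: case_prod_unfold)
  qed
  have "(LBINT t:{0..T}. LBINT x:{0..L}. ?G1 t x) + (LBINT t:{0..T}. LBINT x:{0..L}. ?G2 t x)
      = (LBINT p:{0..T} \<times> {0..L}. (case p of (t, x) \<Rightarrow> ?G1 t x) + (case p of (t, x) \<Rightarrow> ?G2 t x))"
    unfolding set_integral_product(1)[OF I1, symmetric] set_integral_product(1)[OF I2, symmetric]
    by (rule set_integral_add(2)[OF I1 I2, symmetric])
  also have "\<dots> \<le> (LBINT p:{0..T} \<times> {0..L}. - c * (case p of (t, x) \<Rightarrow> (norm (r t x - R x))\<^sup>2))"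
  proof (rule set_integral_mono)
    show "set_integrable lborel ({0..T} \<times> {0..L}) (\<lambda>p. (case p of (t, x) \<Rightarrow> ?G1 t x) + (case p of (t, x) \<Rightarrow> ?G2 t x))"
      by (rule set_integral_add(1)[OF I1 I2])
    show "set_integrable lborel ({0..T} \<times> {0..L}) (\<lambda>p. - c * (case p of (t, x) \<Rightarrow> (norm (r t x - R x))\<^sup>2))"
      by (rule set_integrable_mult_right) (use IN in simp)
    fix p assume "p \<in> {0..T} \<times> {0..L}"
    then obtain t x where p: "p = (t, x)" and x: "x \<in> {0..L}" by blast
    show "(case p of (t, x) \<Rightarrow> ?G1 t x) + (case p of (t, x) \<Rightarrow> ?G2 t x) \<le> - c * (case p of (t, x) \<Rightarrow> (norm (r t x - R x))\<^sup>2)"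
      using lyap[OF x, of "r t x - R x"] unfolding p by (simp add: power2_eq_square algebra_simps)
  qed
  also have "\<dots> = - c * (LBINT t:{0..T}. LBINT x:{0..L}. (norm (r t x - R x))\<^sup>2)"
    unfolding set_integral_mult_right set_integral_product(1)[OF IN] ..
  finally have src: "(LBINT t:{0..T}. LBINT x:{0..L}. ?G1 t x) + (LBINT t:{0..T}. LBINT x:{0..L}. ?G2 t x)
      \<le> - c * (LBINT t:{0..T}. LBINT x:{0..L}. (norm (r t x - R x))\<^sup>2)" .
  from p.balance(2)[OF T s1 s1 e(1) k(1) ed1] m.balance(2)[OF T s2 s2 e(2) k(2) ed2] src
  show ?thesis by (simp add: power2_eq_square)
qed

text \<open>
  The balance laws with \<open>\<rho>2 = 1\<close> and the weights \<open>p = D\<^sup>-\<^sup>1 y\<close>. The adjoint equation makes the sum of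
  the two integrands vanish, so only values at the boundary of the space-time rectangle remain.
\<close>

lemma linear_identity:
  assumes adm: "admissible T u r"
    and yc: "continuous_on {0..L} y1" "continuous_on {0..L} y2"
    and y1: "\<And>x. x \<in> {0..L} \<Longrightarrow> (y1 has_real_derivative - \<eta>0 * (M x $ 1 $ 1 * (y1 x / dp x) + M x $ 2 $ 1 * (y2 x / dm x))) (at x within {0..L})"
    and y2: "\<And>x. x \<in> {0..L} \<Longrightarrow> (y2 has_real_derivative - \<eta>0 * (M x $ 1 $ 2 * (y1 x / dp x) + M x $ 2 $ 2 * (y2 x / dm x))) (at x within {0..L})"
  shows "y1 L * (LBINT t:{0..T}. r t L $ 1 - R L $ 1) + y2 L * (LBINT t:{0..T}. u t $ 2 - R L $ 2)
      - y1 0 * (LBINT t:{0..T}. u t $ 1 - R 0 $ 1) - y2 0 * (LBINT t:{0..T}. r t 0 $ 2 - R 0 $ 2)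
    = - (LBINT x:{0..L}. y1 x / dp x * R x $ 1) - (LBINT x:{0..L}. y2 x / dm x * R x $ 2)
      - (LBINT x:{0..L}. y1 x / dp x * (r T x $ 1 - R x $ 1)) - (LBINT x:{0..L}. y2 x / dm x * (r T x $ 2 - R x $ 2))"
proof -
  have T: "0 < T" using adm unfolding admissible_def by auto
  note s1 = deviation_solution(1)[OF adm] and s2 = deviation_solution(2)[OF adm]
  let ?z = "\<lambda>i t x. r t x $ i - R x $ i" and ?w = "\<lambda>i t x. \<eta>0 * (M x *v (r t x - R x)) $ i"
  let ?k1 = "\<lambda>x. - \<eta>0 * (M x $ 1 $ 1 * (y1 x / dp x) + M x $ 2 $ 1 * (y2 x / dm x))"
  let ?k2 = "\<lambda>x. - \<eta>0 * (M x $ 1 $ 2 * (y1 x / dp x) + M x $ 2 $ 2 * (y2 x / dm x))"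
  note z = deviation_regularity(1)[OF adm] and w = deviation_regularity(2)[OF adm]
  have ec: "continuous_on {0..L} (\<lambda>x. y1 x / dp x)" "continuous_on {0..L} (\<lambda>x. y2 x / dm x)"
    by (intro continuous_on_divide yc p.d_cont m.d_cont ballI p.d_nonzero m.d_nonzero; assumption)+
  have kc: "continuous_on {0..L} ?k1" "continuous_on {0..L} ?k2"
    by (intro continuous_intros ec M_comp_cont)+
  have ed1: "((\<lambda>x. y1 x / dp x * dp x) has_real_derivative ?k1 x) (at x within {0..L})" if x: "x \<in> {0..L}" for x
    by (rule has_field_derivative_transform_within[OF y1[OF x] zero_less_one x]) (use p.d_nonzero in simp)
  have ed2: "((\<lambda>x. y2 x / dm x * dm x) has_real_derivative ?k2 x) (at x within {0..L})" if x: "x \<in> {0..L}" for x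
    by (rule has_field_derivative_transform_within[OF y2[OF x] zero_less_one x]) (use m.d_nonzero in simp)
  let ?G1 = "\<lambda>t x. ?k1 x * (?z 1 t x * 1) + y1 x / dp x * (?w 1 t x * 1 + ?z 1 t x * 0)"
  let ?G2 = "\<lambda>t x. ?k2 x * (?z 2 t x * 1) + y2 x / dm x * (?w 2 t x * 1 + ?z 2 t x * 0)"
  have GI: "set_integrable lborel ({0..T} \<times> {0..L}) (\<lambda>(t, x). k x * (?z i t x * 1) + e x * (?w i t x * 1 + ?z i t x * 0))"
    if "continuous_on {0..L} e" "continuous_on {0..L} k" for e k i
  proof -
    have "set_integrable lborel ({0..T} \<times> {0..L}) (\<lambda>p. (case p of (t, x) \<Rightarrow> (k x * ?z i t x) * 1) + (case p of (t, x) \<Rightarrow> (e x * ?w i t x) * 1))"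
      by (intro set_integral_add(1) L2_rect_mult_integrable L2_rect_mult_continuous z w L2_rect_one that)
    then show ?thesis by (simp add: case_prod_unfold)
  qed
  note I1 = GI[OF ec(1) kc(1), of 1] and I2 = GI[OF ec(2) kc(2), of 2]
  have pw: "?G1 t x + ?G2 t x = 0" if "x \<in> {0..L}" for t x
    using p.d_nonzero[OF that] m.d_nonzero[OF that] by (simp add: matrix_vector_2 field_simps)
  have "(LBINT t:{0..T}. LBINT x:{0..L}. ?G1 t x) + (LBINT t:{0..T}. LBINT x:{0..L}. ?G2 t x)
      = (LBINT p:{0..T} \<times> {0..L}. (case p of (t, x) \<Rightarrow> ?G1 t x) + (case p of (t, x) \<Rightarrow> ?G2 t x))"
    unfolding set_integral_product(1)[OF I1, symmetric] set_integral_product(1)[OF I2, symmetric]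
    by (rule set_integral_add(2)[OF I1 I2, symmetric])
  also have "\<dots> = 0"
    unfolding set_lebesgue_integral_def
  proof (rule integral_eq_zero_AE, rule AE_I2)
    fix p :: "real \<times> real"
    obtain t x where p: "p = (t, x)" by (cases p)
    show "indicator ({0..T} \<times> {0..L}) p *\<^sub>R ((case p of (t, x) \<Rightarrow> ?G1 t x) + (case p of (t, x) \<Rightarrow> ?G2 t x)) = 0"
    proof (cases "p \<in> {0..T} \<times> {0..L}")
      case True
      then have "x \<in> {0..L}" using p by simp
      from pw[OF this, of t] show ?thesis unfolding p prod.case by (simp only: scaleR_zero_right)
    next
      case False
      then have "indicator ({0..T} \<times> {0..L}) p = (0::real)" by simp
      then show ?thesis by (simp only: scaleR_zero_left)
    qed
  qed
  finally have src: "(LBINT t:{0..T}. LBINT x:{0..L}. ?G1 t x) + (LBINT t:{0..T}. LBINT x:{0..L}. ?G2 t x) = 0" .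
  have nz: "dp 0 \<noteq> 0" "dp L \<noteq> 0" "dm 0 \<noteq> 0" "dm L \<noteq> 0"
    using p.d_nonzero[of 0] p.d_nonzero[of L] m.d_nonzero[of 0] m.d_nonzero[of L] p.L_pos by simp_all
  have neg: "(LBINT x:{0..L}. f x * - g x) = - (LBINT x:{0..L}. f x * g x)" for f g :: "real \<Rightarrow> real"
    unfolding set_lebesgue_integral_def by simp
  show ?thesis
    using p.balance(2)[OF T s1 p.solution_one ec(1) kc(1) ed1] m.balance(2)[OF T s2 m.solution_one ec(2) kc(2) ed2] src nz
    unfolding mult_1_right neg by simp
qed

end

section \<open>Two-sided bounds for the cost\<close>

lemma integral_product_Young:
  assumes f: "square_integrable N A f" and g: "square_integrable N A g" and \<theta>: "0 < \<theta>"
  shows "\<bar>LINT x:A|N. f x * g x\<bar> \<le> \<theta> * (LINT x:A|N. (g x)\<^sup>2) + (LINT x:A|N. (f x)\<^sup>2) / (4 * \<theta>)"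
proof -
  have f2: "set_integrable N A (\<lambda>x. (f x)\<^sup>2)" and g2: "set_integrable N A (\<lambda>x. (g x)\<^sup>2)"
    using f g unfolding square_integrable_def by auto
  have fg: "set_integrable N A (\<lambda>x. f x * g x)" by (rule square_integrable_mult[OF f g])
  have pw: "\<bar>p * q\<bar> \<le> \<theta> * q\<^sup>2 + p\<^sup>2 / (4 * \<theta>)" for p q
  proof -
    have "0 \<le> (2 * \<theta> * \<bar>q\<bar> - \<bar>p\<bar>)\<^sup>2 / (4 * \<theta>)" using \<theta> by simp
    also have "\<dots> = \<theta> * q\<^sup>2 + p\<^sup>2 / (4 * \<theta>) - \<bar>p * q\<bar>"
      using \<theta> by (simp add: power2_diff power_mult_distrib abs_mult field_simps power2_eq_square)
    finally show ?thesis by simp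
  qed
  have "\<bar>LINT x:A|N. f x * g x\<bar> \<le> (LINT x:A|N. \<bar>f x * g x\<bar>)"
    unfolding set_lebesgue_integral_def
    using integral_abs_bound[of N "\<lambda>x. indicator A x *\<^sub>R (f x * g x)"] by (simp add: abs_mult)
  also have "\<dots> \<le> (LINT x:A|N. \<theta> * (g x)\<^sup>2 + (f x)\<^sup>2 / (4 * \<theta>))"
    by (rule set_integral_mono[OF set_integrable_abs[OF fg] _ pw])
      (intro set_integral_add(1) set_integrable_mult_right set_integrable_divide impI f2 g2)
  also have "\<dots> = \<theta> * (LINT x:A|N. (g x)\<^sup>2) + (LINT x:A|N. (f x)\<^sup>2) / (4 * \<theta>)"
    using f2 g2 by (subst set_integral_add(2)) auto
  finally show ?thesis .
qed

lemma square_integrable_integrable: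
  fixes f :: "real \<Rightarrow> real"
  assumes "square_integrable lborel {a..b} f"
  shows "set_integrable lborel {a..b} f"
  using square_integrable_mult[OF assms square_integrable_continuous[OF continuous_on_const[of _ 1]]] by simp

lemma quad_form_integrable:
  fixes A :: "real^2^2"
  assumes f: "square_integrable lborel {a..b} f" and g: "square_integrable lborel {a..b} g"
  shows "set_integrable lborel {a..b} (\<lambda>t. vector [f t, g t] \<bullet> (A *v vector [f t, g t]))"
  unfolding quad_form_2 vector_2
  by (intro set_integral_add(1) set_integrable_mult_right impI square_integrable_mult f g)

lemma vec2_eqI: "(v :: real^2) $ 1 = w $ 1 \<Longrightarrow> v $ 2 = w $ 2 \<Longrightarrow> v = w"
  by (simp add: vec_eq_iff forall_2)

context deviation
begin

text \<open>
  The static control is \<open>(R 0 $ 1, R L $ 2)\<close>, the pair of boundary values of \<open>R\<close> at the inflow ends.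
\<close>

definition control_dev where
  "control_dev T u = (LBINT t:{0..T}. (u t $ 1 - R 0 $ 1)\<^sup>2) + (LBINT t:{0..T}. (u t $ 2 - R L $ 2)\<^sup>2)"

definition final_dev where
  "final_dev T r = (LBINT x:{0..L}. (r T x $ 1 - R x $ 1)\<^sup>2) + (LBINT x:{0..L}. (r T x $ 2 - R x $ 2)\<^sup>2)"

definition trace_dev where
  "trace_dev T r = (LBINT t:{0..T}. (r t L $ 1 - R L $ 1)\<^sup>2) + (LBINT t:{0..T}. (r t 0 $ 2 - R 0 $ 2)\<^sup>2)"

definition interior_dev where
  "interior_dev T r = (LBINT t:{0..T}. LBINT x:{0..L}. (norm (r t x - R x))\<^sup>2)"

lemma dev_nonneg: "0 \<le> control_dev T u" "0 \<le> final_dev T r" "0 \<le> trace_dev T r" "0 \<le> interior_dev T r"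
  unfolding control_dev_def final_dev_def trace_dev_def interior_dev_def
  by (intro add_nonneg_nonneg set_integral_nonneg_real; simp add: set_integral_nonneg_real)+

text \<open>
  The weights stay above \<open>\<epsilon>\<close> and the speeds at the outflow ends above some \<open>\<delta> > 0\<close>, so each term on the left of the
  energy inequality controls one of the three quantities.
\<close>

lemma dissipation_bound:
  assumes e: "continuous_on {0..L} e1" "continuous_on {0..L} e2" and k: "continuous_on {0..L} k1" "continuous_on {0..L} k2"
    and ed1: "\<And>x. x \<in> {0..L} \<Longrightarrow> ((\<lambda>x. e1 x * dp x) has_real_derivative k1 x) (at x within {0..L})"
    and ed2: "\<And>x. x \<in> {0..L} \<Longrightarrow> ((\<lambda>x. e2 x * dm x) has_real_derivative k2 x) (at x within {0..L})"
    and lyap: "\<And>x v. x \<in> {0..L} \<Longrightarrow> k1 x * (v $ 1)\<^sup>2 + k2 x * (v $ 2)\<^sup>2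
        + 2 * (e1 x * (v $ 1 * (\<eta>0 * (M x *v v) $ 1)) + e2 x * (v $ 2 * (\<eta>0 * (M x *v v) $ 2)))
        \<le> - (c * (norm v)\<^sup>2)"
    and c: "0 < c" and \<epsilon>: "0 < \<epsilon>" "\<And>x. x \<in> {0..L} \<Longrightarrow> \<epsilon> \<le> e1 x" "\<And>x. x \<in> {0..L} \<Longrightarrow> \<epsilon> \<le> e2 x"
  shows "\<exists>K>0. \<forall>T u r. admissible T u r \<longrightarrow>
     final_dev T r \<le> K * (1 + control_dev T u) \<and> trace_dev T r \<le> K * (1 + control_dev T u)
     \<and> interior_dev T r \<le> K * (1 + control_dev T u)"
proof -
  define A where "A = (LBINT x:{0..L}. e1 x * (R x $ 1)\<^sup>2) + (LBINT x:{0..L}. e2 x * (R x $ 2)\<^sup>2)"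
  define B where "B = e1 0 * dp 0 + e2 L * - dm L"
  define \<delta> where "\<delta> = min (dp L) (- dm 0)"
  define m where "m = min c (min \<epsilon> (\<epsilon> * \<delta>))"
  have x0: "0 \<in> {0..L}" "L \<in> {0..L}" using p.L_pos by auto
  have sg: "0 < dp 0" "0 < dp L" "dm 0 < 0" "dm L < 0"
    using p.d_sign[OF x0(1)] p.d_sign[OF x0(2)] m.d_sign[OF x0(1)] m.d_sign[OF x0(2)] by auto
  have ep: "0 < e1 x" "0 < e2 x" if "x \<in> {0..L}" for x using \<epsilon> that by (force intro: less_le_trans)+
  have A0: "0 \<le> A" unfolding A_def
    by (intro add_nonneg_nonneg set_integral_nonneg_real mult_nonneg_nonneg less_imp_le[OF ep(1)] less_imp_le[OF ep(2)]) auto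
  have B12: "0 \<le> e1 0 * dp 0" "0 \<le> e2 L * - dm L"
    using mult_pos_pos[OF ep(1)[OF x0(1)] sg(1)] mult_pos_neg[OF ep(2)[OF x0(2)] sg(4)] by simp_all
  have \<delta>0: "0 < \<delta>" unfolding \<delta>_def using sg by simp
  have m0: "0 < m" unfolding m_def using c \<epsilon>(1) \<delta>0 by simp
  have mb: "m \<le> c" "m \<le> \<epsilon>" "m \<le> \<epsilon> * \<delta>" unfolding m_def by auto
  define K where "K = (A + B + 1) / m"
  have K0: "0 < K" unfolding K_def B_def using A0 B12 m0 by (intro divide_pos_pos) auto
  have main: "m * final_dev T r + m * trace_dev T r + m * interior_dev T r \<le> (A + B + 1) * (1 + control_dev T u)"
    if adm: "admissible T u r" for T u r
  proof -
    let ?I = "\<lambda>i. LBINT x:{0..L}. (r T x $ i - R x $ i)\<^sup>2"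
    have fz: "m * (LBINT x:{0..L}. (r T x $ i - R x $ i)\<^sup>2) \<le> (LBINT x:{0..L}. e x * (r T x $ i - R x $ i)\<^sup>2)"
      if e: "continuous_on {0..L} e" "\<And>x. x \<in> {0..L} \<Longrightarrow> \<epsilon> \<le> e x" for e i
    proof -
      note sq = deviation_regularity(3)[OF adm, of i]
      have "square_integrable lborel {0..L} (\<lambda>x. e x * (r T x $ i - R x $ i))"
      proof -
        obtain C where "\<And>x. x \<in> {0..L} \<Longrightarrow> \<bar>e x\<bar> \<le> C" using continuous_bounded_interval[OF e(1)] by blast
        from square_integrable_mult_bounded[OF sq set_borel_measurable_continuous_interval[OF e(1)] this] show ?thesis .
      qed
      from square_integrable_mult[OF this sq]
      have i: "set_integrable lborel {0..L} (\<lambda>x. e x * (r T x $ i - R x $ i)\<^sup>2)" by (simp add: power2_eq_square mult.assoc)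
      have "(LBINT x:{0..L}. m * (r T x $ i - R x $ i)\<^sup>2) \<le> (LBINT x:{0..L}. e x * (r T x $ i - R x $ i)\<^sup>2)"
      proof (rule set_integral_mono[OF _ i])
        show "set_integrable lborel {0..L} (\<lambda>x. m * (r T x $ i - R x $ i)\<^sup>2)"
          using sq unfolding square_integrable_def by simp
        show "m * (r T x $ i - R x $ i)\<^sup>2 \<le> e x * (r T x $ i - R x $ i)\<^sup>2" if "x \<in> {0..L}" for x
          by (rule mult_right_mono) (use e(2)[OF that] mb(2) in auto)
      qed
      then show ?thesis by simp
    qed
    have tr: "m * (LBINT t:{0..T}. f t) \<le> q * (LBINT t:{0..T}. f t)"
      if "\<And>t. 0 \<le> f t" "m \<le> q" for q and f :: "real \<Rightarrow> real"
      by (rule mult_right_mono[OF that(2)]) (rule set_integral_nonneg_real, rule that(1))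
    have q1: "m \<le> e1 L * dp L"
    proof -
      have "\<epsilon> * \<delta> \<le> e1 L * dp L" unfolding \<delta>_def
        using \<epsilon>(1) \<epsilon>(2)[OF x0(2)] sg by (intro mult_mono) auto
      then show ?thesis using mb(3) by linarith
    qed
    have q2: "m \<le> - (e2 0 * dm 0)"
    proof -
      have "\<epsilon> * \<delta> \<le> e2 0 * - dm 0" unfolding \<delta>_def
        using \<epsilon>(1) \<epsilon>(3)[OF x0(1)] sg by (intro mult_mono) auto
      then show ?thesis using mb(3) by linarith
    qed
    have cc: "m * interior_dev T r \<le> c * interior_dev T r" by (rule mult_right_mono[OF mb(1) dev_nonneg(4)])
    have u1: "e1 0 * dp 0 * (LBINT t:{0..T}. (u t $ 1 - R 0 $ 1)\<^sup>2) \<le> B * (LBINT t:{0..T}. (u t $ 1 - R 0 $ 1)\<^sup>2)"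
      by (intro mult_right_mono set_integral_nonneg_real) (use B12 in \<open>auto simp: B_def\<close>)
    have u2: "- (e2 L * dm L) * (LBINT t:{0..T}. (u t $ 2 - R L $ 2)\<^sup>2) \<le> B * (LBINT t:{0..T}. (u t $ 2 - R L $ 2)\<^sup>2)"
      by (intro mult_right_mono set_integral_nonneg_real) (use B12 in \<open>auto simp: B_def\<close>)
    have AU: "0 \<le> A * control_dev T u" "0 \<le> control_dev T u" "0 \<le> B"
      using mult_nonneg_nonneg[OF A0 dev_nonneg(1)] dev_nonneg(1) B12 unfolding B_def by auto
    have energy: "(LBINT x:{0..L}. e1 x * (r T x $ 1 - R x $ 1)\<^sup>2) + (LBINT x:{0..L}. e2 x * (r T x $ 2 - R x $ 2)\<^sup>2)
      + e1 L * dp L * (LBINT t:{0..T}. (r t L $ 1 - R L $ 1)\<^sup>2) - e2 0 * dm 0 * (LBINT t:{0..T}. (r t 0 $ 2 - R 0 $ 2)\<^sup>2)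
      + c * interior_dev T r
      \<le> A + e1 0 * dp 0 * (LBINT t:{0..T}. (u t $ 1 - R 0 $ 1)\<^sup>2) - e2 L * dm L * (LBINT t:{0..T}. (u t $ 2 - R L $ 2)\<^sup>2)"
      unfolding A_def interior_dev_def by (rule energy_inequality[OF adm e k ed1 ed2 lyap])
    have z1: "m * (LBINT x:{0..L}. (r T x $ 1 - R x $ 1)\<^sup>2) \<le> (LBINT x:{0..L}. e1 x * (r T x $ 1 - R x $ 1)\<^sup>2)"
      by (rule fz[OF e(1) \<epsilon>(2)])
    have z2: "m * (LBINT x:{0..L}. (r T x $ 2 - R x $ 2)\<^sup>2) \<le> (LBINT x:{0..L}. e2 x * (r T x $ 2 - R x $ 2)\<^sup>2)"
      by (rule fz[OF e(2) \<epsilon>(3)])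
    have t1: "m * (LBINT t:{0..T}. (r t L $ 1 - R L $ 1)\<^sup>2) \<le> e1 L * dp L * (LBINT t:{0..T}. (r t L $ 1 - R L $ 1)\<^sup>2)"
      by (rule tr[OF zero_le_power2 q1])
    have t2: "m * (LBINT t:{0..T}. (r t 0 $ 2 - R 0 $ 2)\<^sup>2) \<le> - (e2 0 * dm 0 * (LBINT t:{0..T}. (r t 0 $ 2 - R 0 $ 2)\<^sup>2))"
      using tr[OF zero_le_power2 q2, of "\<lambda>t. r t 0 $ 2 - R 0 $ 2"] by (simp only: mult_minus_left)
    have "m * final_dev T r + m * trace_dev T r + m * interior_dev T r \<le> A + B * control_dev T u"
      using energy z1 z2 t1 t2 cc u1 u2[unfolded mult_minus_left]
      unfolding final_dev_def trace_dev_def control_dev_def distrib_left by linarith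
    also have "\<dots> \<le> (A + B + 1) * (1 + control_dev T u)" using AU by (simp add: algebra_simps)
    finally show ?thesis .
  qed
  show ?thesis
  proof (intro exI[of _ K] conjI[OF K0] allI impI)
    fix T u r assume adm: "admissible T u r"
    have n: "0 \<le> m * final_dev T r" "0 \<le> m * trace_dev T r" "0 \<le> m * interior_dev T r"
      by (intro mult_nonneg_nonneg less_imp_le[OF m0] dev_nonneg)+
    have KK: "K * (1 + control_dev T u) = (A + B + 1) * (1 + control_dev T u) / m" unfolding K_def by simp
    show "final_dev T r \<le> K * (1 + control_dev T u) \<and> trace_dev T r \<le> K * (1 + control_dev T u)
       \<and> interior_dev T r \<le> K * (1 + control_dev T u)"
      unfolding KK pos_le_divide_eq[OF m0] using main[OF adm] n by (simp only: mult.commute[of _ m]) linarith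
  qed
qed

text \<open>
  Taylor's formula for the quadratic costs at the boundary values of the static state, integrated
  over time.
\<close>

lemma cost_expansion:
  fixes A0 AL :: "real^2^2" and c0 cL :: "real^2"
  assumes adm: "admissible T u r" and A0: "symmetric_pos_def A0" and AL: "symmetric_pos_def AL"
  defines "g0 \<equiv> A0 *v vector [R 0 $ 1, R 0 $ 2] + c0" and "gL \<equiv> AL *v vector [R L $ 2, R L $ 1] + cL"
  defines "J \<equiv> quad_cost A0 c0 (vector [R 0 $ 1, R 0 $ 2]) + quad_cost AL cL (vector [R L $ 2, R L $ 1])"
  defines "w0 \<equiv> \<lambda>t. vector [u t $ 1 - R 0 $ 1, r t 0 $ 2 - R 0 $ 2] :: real^2"
    and "wL \<equiv> \<lambda>t. vector [u t $ 2 - R L $ 2, r t L $ 1 - R L $ 1] :: real^2"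
  shows "dynamic_cost L (quad_cost A0 c0) (quad_cost AL cL) T u r = T * J
      + (g0 $ 1 * (LBINT t:{0..T}. u t $ 1 - R 0 $ 1) + g0 $ 2 * (LBINT t:{0..T}. r t 0 $ 2 - R 0 $ 2)
       + gL $ 1 * (LBINT t:{0..T}. u t $ 2 - R L $ 2) + gL $ 2 * (LBINT t:{0..T}. r t L $ 1 - R L $ 1))
      + 1/2 * ((LBINT t:{0..T}. w0 t \<bullet> (A0 *v w0 t)) + (LBINT t:{0..T}. wL t \<bullet> (AL *v wL t)))"
    and "set_integrable lborel {0..T} (\<lambda>t. w0 t \<bullet> (A0 *v w0 t))"
    and "set_integrable lborel {0..T} (\<lambda>t. wL t \<bullet> (AL *v wL t))"
    and "(LBINT t:{0..T}. (norm (w0 t))\<^sup>2) + (LBINT t:{0..T}. (norm (wL t))\<^sup>2) = control_dev T u + trace_dev T r"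
    and "set_integrable lborel {0..T} (\<lambda>t. (norm (w0 t))\<^sup>2)" and "set_integrable lborel {0..T} (\<lambda>t. (norm (wL t))\<^sup>2)"
proof -
  have T: "0 < T" using adm unfolding admissible_def by auto
  note su = deviation_regularity(4)[OF adm] and st = trace_square_integrable[OF adm]
  let ?a = "\<lambda>t. u t $ 1 - R 0 $ 1" and ?b = "\<lambda>t. u t $ 2 - R L $ 2" and ?c = "\<lambda>t. r t 0 $ 2 - R 0 $ 2" and ?e = "\<lambda>t. r t L $ 1 - R L $ 1"
  note sqi = square_integrable_integrable
  note ia = sqi[OF su[of 1 "R 0 $ 1"]] and ib = sqi[OF su[of 2 "R L $ 2"]] and ic = sqi[OF st(2)] and ie = sqi[OF st(1)]
  show q0: "set_integrable lborel {0..T} (\<lambda>t. w0 t \<bullet> (A0 *v w0 t))"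
    unfolding w0_def by (rule quad_form_integrable[OF su st(2)])
  show qL: "set_integrable lborel {0..T} (\<lambda>t. wL t \<bullet> (AL *v wL t))"
    unfolding wL_def by (rule quad_form_integrable[OF su st(1)])
  have sqs: "set_integrable lborel {0..T} (\<lambda>t. (?a t)\<^sup>2)" "set_integrable lborel {0..T} (\<lambda>t. (?b t)\<^sup>2)"
    "set_integrable lborel {0..T} (\<lambda>t. (?c t)\<^sup>2)" "set_integrable lborel {0..T} (\<lambda>t. (?e t)\<^sup>2)"
    using su st unfolding square_integrable_def by auto
  have n0: "(norm (w0 t))\<^sup>2 = (?a t)\<^sup>2 + (?c t)\<^sup>2" and nL: "(norm (wL t))\<^sup>2 = (?b t)\<^sup>2 + (?e t)\<^sup>2" for t
    unfolding w0_def wL_def norm_squared_2 by simp_all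
  show "set_integrable lborel {0..T} (\<lambda>t. (norm (w0 t))\<^sup>2)" "set_integrable lborel {0..T} (\<lambda>t. (norm (wL t))\<^sup>2)"
    unfolding n0 nL using set_integral_add(1)[OF sqs(1,3)] set_integral_add(1)[OF sqs(2,4)] by simp_all
  show "(LBINT t:{0..T}. (norm (w0 t))\<^sup>2) + (LBINT t:{0..T}. (norm (wL t))\<^sup>2) = control_dev T u + trace_dev T r"
    unfolding n0 nL set_integral_add(2)[OF sqs(1,3)] set_integral_add(2)[OF sqs(2,4)] control_dev_def trace_dev_def by simp
  have sym: "transpose A0 = A0" "transpose AL = AL" using A0 AL unfolding symmetric_pos_def_def by auto
  have int: "quad_cost A0 c0 (vector [u t $ 1, r t 0 $ 2]) + quad_cost AL cL (vector [u t $ 2, r t L $ 1])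
      = J + (g0 $ 1 * ?a t + g0 $ 2 * ?c t + (gL $ 1 * ?b t + gL $ 2 * ?e t)) + (1/2 * (w0 t \<bullet> (A0 *v w0 t)) + 1/2 * (wL t \<bullet> (AL *v wL t)))" for t
  proof -
    have e0: "vector [u t $ 1, r t 0 $ 2] = vector [R 0 $ 1, R 0 $ 2] + w0 t" and eL: "vector [u t $ 2, r t L $ 1] = vector [R L $ 2, R L $ 1] + wL t"
      unfolding w0_def wL_def by (rule vec2_eqI; simp)+
    have d: "g0 \<bullet> w0 t = g0 $ 1 * ?a t + g0 $ 2 * ?c t" "gL \<bullet> wL t = gL $ 1 * ?b t + gL $ 2 * ?e t"
      unfolding w0_def wL_def inner_2 by simp_all
    show ?thesis unfolding e0 eL quad_cost_expand[OF sym(1)] quad_cost_expand[OF sym(2)]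
      using d unfolding J_def g0_def gL_def by simp
  qed
  have cst: "set_integrable lborel {0..T} (\<lambda>_. J)" "(LBINT t:{0..T}. J) = T * J"
    using T borel_integrable_atLeastAtMost'[of 0 T "\<lambda>_. J"] by (auto simp: set_lebesgue_integral_def)
  have l0: "set_integrable lborel {0..T} (\<lambda>t. g0 $ 1 * ?a t)" "set_integrable lborel {0..T} (\<lambda>t. g0 $ 2 * ?c t)"
     "set_integrable lborel {0..T} (\<lambda>t. gL $ 1 * ?b t)" "set_integrable lborel {0..T} (\<lambda>t. gL $ 2 * ?e t)"
     "set_integrable lborel {0..T} (\<lambda>t. 1/2 * (w0 t \<bullet> (A0 *v w0 t)))" "set_integrable lborel {0..T} (\<lambda>t. 1/2 * (wL t \<bullet> (AL *v wL t)))"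
    by (intro set_integrable_mult_right impI ia ib ic ie q0 qL)+
  note add = set_integral_add
  show "dynamic_cost L (quad_cost A0 c0) (quad_cost AL cL) T u r = T * J
      + (g0 $ 1 * (LBINT t:{0..T}. ?a t) + g0 $ 2 * (LBINT t:{0..T}. ?c t)
       + gL $ 1 * (LBINT t:{0..T}. ?b t) + gL $ 2 * (LBINT t:{0..T}. ?e t))
      + 1/2 * ((LBINT t:{0..T}. w0 t \<bullet> (A0 *v w0 t)) + (LBINT t:{0..T}. wL t \<bullet> (AL *v wL t)))"
    unfolding dynamic_cost_def int
      add(2)[OF add(1)[OF cst(1) add(1)[OF add(1)[OF l0(1,2)] add(1)[OF l0(3,4)]]] add(1)[OF l0(5,6)]]
      add(2)[OF cst(1) add(1)[OF add(1)[OF l0(1,2)] add(1)[OF l0(3,4)]]]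
      add(2)[OF add(1)[OF l0(1,2)] add(1)[OF l0(3,4)]] add(2)[OF l0(1,2)] add(2)[OF l0(3,4)] add(2)[OF l0(5,6)] cst(2)
      set_integral_mult_right
    by simp
qed

text \<open>
  The boundary values prescribed for \<open>y\<close> make the linear term of the cost equal to the left-hand side
  of \<open>linear_identity\<close>. Young's inequality splits what remains at time \<open>T\<close> into a constant and a multiple
  of \<open>U = control_dev T u\<close> that is so small that the quadratic term absorbs it.
\<close>

lemma cost_bounds:
  fixes A0 AL :: "real^2^2" and c0 cL :: "real^2"
  assumes A0: "symmetric_pos_def A0" and AL: "symmetric_pos_def AL"
    and K: "0 < K" "\<And>T u r. admissible T u r \<Longrightarrow>
     final_dev T r \<le> K * (1 + control_dev T u) \<and> trace_dev T r \<le> K * (1 + control_dev T u)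
     \<and> interior_dev T r \<le> K * (1 + control_dev T u)"
    and yc: "continuous_on {0..L} y1" "continuous_on {0..L} y2"
    and y1: "\<And>x. x \<in> {0..L} \<Longrightarrow> (y1 has_real_derivative - \<eta>0 * (M x $ 1 $ 1 * (y1 x / dp x) + M x $ 2 $ 1 * (y2 x / dm x))) (at x within {0..L})"
    and y2: "\<And>x. x \<in> {0..L} \<Longrightarrow> (y2 has_real_derivative - \<eta>0 * (M x $ 1 $ 2 * (y1 x / dp x) + M x $ 2 $ 2 * (y2 x / dm x))) (at x within {0..L})"
    and yL: "y1 L = (AL *v vector [R L $ 2, R L $ 1] + cL) $ 2" "y2 L = (AL *v vector [R L $ 2, R L $ 1] + cL) $ 1"
    and y0: "y1 0 = - (A0 *v vector [R 0 $ 1, R 0 $ 2] + c0) $ 1" "y2 0 = - (A0 *v vector [R 0 $ 1, R 0 $ 2] + c0) $ 2"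
  defines "J \<equiv> quad_cost A0 c0 (vector [R 0 $ 1, R 0 $ 2]) + quad_cost AL cL (vector [R L $ 2, R L $ 1])"
  shows "\<exists>\<kappa> K'. 0 < \<kappa> \<and> 0 < K' \<and> (\<forall>T u r. admissible T u r \<longrightarrow>
      T * J + \<kappa> * control_dev T u - K' \<le> dynamic_cost L (quad_cost A0 c0) (quad_cost AL cL) T u r \<and>
      dynamic_cost L (quad_cost A0 c0) (quad_cost AL cL) T u r \<le> T * J + K' * (1 + control_dev T u))"
proof -
  obtain l0 h0 where b0: "0 < l0" "\<And>w. l0 * (norm w)\<^sup>2 \<le> w \<bullet> (A0 *v w)" "\<And>w. w \<bullet> (A0 *v w) \<le> h0 * (norm w)\<^sup>2" "0 < h0"
    by (rule symmetric_pos_def_bounds[OF A0]) blast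
  obtain lL hL where bL: "0 < lL" "\<And>w. lL * (norm w)\<^sup>2 \<le> w \<bullet> (AL *v w)" "\<And>w. w \<bullet> (AL *v w) \<le> hL * (norm w)\<^sup>2" "0 < hL"
    by (rule symmetric_pos_def_bounds[OF AL]) blast
  define lo where "lo = min l0 lL"
  define hi where "hi = h0 + hL"
  have lo0: "0 < lo" and hi0: "0 < hi" unfolding lo_def hi_def using b0 bL by auto
  have p1: "square_integrable lborel {0..L} (\<lambda>x. y1 x / dp x)" and p2: "square_integrable lborel {0..L} (\<lambda>x. y2 x / dm x)"
    by (intro square_integrable_continuous continuous_on_divide yc p.d_cont m.d_cont ballI p.d_nonzero m.d_nonzero; assumption)+
  define C0 where "C0 = \<bar>LBINT x:{0..L}. y1 x / dp x * R x $ 1\<bar> + \<bar>LBINT x:{0..L}. y2 x / dm x * R x $ 2\<bar>"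
  define C1 where "C1 = (LBINT x:{0..L}. (y1 x / dp x)\<^sup>2) + (LBINT x:{0..L}. (y2 x / dm x)\<^sup>2)"
  have C00: "0 \<le> C0" unfolding C0_def by simp
  have C10: "0 \<le> C1" unfolding C1_def by (intro add_nonneg_nonneg set_integral_nonneg_real) auto
  define lin where "lin T u r = y1 L * (LBINT t:{0..T}. r t L $ 1 - R L $ 1) + y2 L * (LBINT t:{0..T}. u t $ 2 - R L $ 2)
      - y1 0 * (LBINT t:{0..T}. u t $ 1 - R 0 $ 1) - y2 0 * (LBINT t:{0..T}. r t 0 $ 2 - R 0 $ 2)" for T and u :: "real \<Rightarrow> real^2" and r :: "real \<Rightarrow> real \<Rightarrow> real^2"
  have lin: "\<bar>lin T u r\<bar> \<le> C0 + \<theta> * (K * (1 + control_dev T u)) + C1 / (4 * \<theta>)" if adm: "admissible T u r" and \<theta>: "0 < \<theta>" for T u r \<theta>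
  proof -
    note z = deviation_regularity(3)[OF adm]
    have "\<theta> * final_dev T r \<le> \<theta> * (K * (1 + control_dev T u))"
      by (rule mult_left_mono) (use K(2)[OF adm] \<theta> in auto)
    moreover have "lin T u r = - (LBINT x:{0..L}. y1 x / dp x * R x $ 1) - (LBINT x:{0..L}. y2 x / dm x * R x $ 2)
      - (LBINT x:{0..L}. y1 x / dp x * (r T x $ 1 - R x $ 1)) - (LBINT x:{0..L}. y2 x / dm x * (r T x $ 2 - R x $ 2))"
      unfolding lin_def by (rule linear_identity[OF adm yc y1 y2])
    ultimately show ?thesis
      unfolding C0_def
      using integral_product_Young[OF p1 z[of 1] \<theta>] integral_product_Young[OF p2 z[of 2] \<theta>]
      unfolding final_dev_def C1_def distrib_left add_divide_distrib by linarith
  qed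
  let ?cost = "dynamic_cost L (quad_cost A0 c0) (quad_cost AL cL)"
  have cost: "lo / 2 * control_dev T u \<le> ?cost T u r - T * J - lin T u r \<and> ?cost T u r - T * J - lin T u r \<le> hi / 2 * (control_dev T u + trace_dev T r)"
    if adm: "admissible T u r" for T u r
  proof -
    define w0 :: "real \<Rightarrow> real^2" where "w0 t = vector [u t $ 1 - R 0 $ 1, r t 0 $ 2 - R 0 $ 2]" for t
    define wL :: "real \<Rightarrow> real^2" where "wL t = vector [u t $ 2 - R L $ 2, r t L $ 1 - R L $ 1]" for t
    note ce = cost_expansion[OF adm A0 AL, folded w0_def wL_def]
    note ce1 = cost_expansion(1)[OF adm A0 AL, where ?c0.0 = c0 and cL = cL, folded w0_def wL_def J_def]
    have "?cost T u r - T * J - lin T u r = 1/2 * ((LBINT t:{0..T}. w0 t \<bullet> (A0 *v w0 t)) + (LBINT t:{0..T}. wL t \<bullet> (AL *v wL t)))"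
      unfolding ce1 lin_def yL y0 by (simp add: algebra_simps)
    moreover have "lo * (LBINT t:{0..T}. (norm (w t))\<^sup>2) \<le> (LBINT t:{0..T}. w t \<bullet> (A *v w t)) \<and>
        (LBINT t:{0..T}. w t \<bullet> (A *v w t)) \<le> hi * (LBINT t:{0..T}. (norm (w t))\<^sup>2)"
      if i: "set_integrable lborel {0..T} (\<lambda>t. w t \<bullet> (A *v w t))" "set_integrable lborel {0..T} (\<lambda>t. (norm (w t))\<^sup>2)"
        and b: "\<And>w. l * (norm w)\<^sup>2 \<le> w \<bullet> (A *v w)" "\<And>w. w \<bullet> (A *v w) \<le> h * (norm w)\<^sup>2" "lo \<le> l" "h \<le> hi" for w :: "real \<Rightarrow> real^2" and A l h
    proof
      have "(LBINT t:{0..T}. lo * (norm (w t))\<^sup>2) \<le> (LBINT t:{0..T}. w t \<bullet> (A *v w t))"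
      proof (rule set_integral_mono[OF _ i(1)])
        show "lo * (norm (w t))\<^sup>2 \<le> w t \<bullet> (A *v w t)" for t
          using b(1)[of "w t"] mult_right_mono[OF b(3), of "(norm (w t))\<^sup>2"] by simp
      qed (use i(2) in simp)
      then show "lo * (LBINT t:{0..T}. (norm (w t))\<^sup>2) \<le> (LBINT t:{0..T}. w t \<bullet> (A *v w t))" by simp
      have "(LBINT t:{0..T}. w t \<bullet> (A *v w t)) \<le> (LBINT t:{0..T}. hi * (norm (w t))\<^sup>2)"
      proof (rule set_integral_mono[OF i(1)])
        show "w t \<bullet> (A *v w t) \<le> hi * (norm (w t))\<^sup>2" for t
          using b(2)[of "w t"] mult_right_mono[OF b(4), of "(norm (w t))\<^sup>2"] by simp
      qed (use i(2) in simp)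
      then show "(LBINT t:{0..T}. w t \<bullet> (A *v w t)) \<le> hi * (LBINT t:{0..T}. (norm (w t))\<^sup>2)" by simp
    qed
    from this[OF ce(2) ce(5) b0(2,3)] this[OF ce(3) ce(6) bL(2,3)]
    have "lo * (LBINT t:{0..T}. (norm (w0 t))\<^sup>2) \<le> (LBINT t:{0..T}. w0 t \<bullet> (A0 *v w0 t))"
      "(LBINT t:{0..T}. w0 t \<bullet> (A0 *v w0 t)) \<le> hi * (LBINT t:{0..T}. (norm (w0 t))\<^sup>2)"
      "lo * (LBINT t:{0..T}. (norm (wL t))\<^sup>2) \<le> (LBINT t:{0..T}. wL t \<bullet> (AL *v wL t))"
      "(LBINT t:{0..T}. wL t \<bullet> (AL *v wL t)) \<le> hi * (LBINT t:{0..T}. (norm (wL t))\<^sup>2)"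
      using b0(4) bL(4) unfolding lo_def hi_def by auto
    moreover have "lo * (LBINT t:{0..T}. (norm (w0 t))\<^sup>2) + lo * (LBINT t:{0..T}. (norm (wL t))\<^sup>2) = lo * control_dev T u + lo * trace_dev T r"
      "hi * (LBINT t:{0..T}. (norm (w0 t))\<^sup>2) + hi * (LBINT t:{0..T}. (norm (wL t))\<^sup>2) = hi * (control_dev T u + trace_dev T r)"
      unfolding distrib_left[symmetric] ce(4) by simp_all
    moreover have "0 \<le> lo * trace_dev T r" by (rule mult_nonneg_nonneg[OF less_imp_le[OF lo0] dev_nonneg(3)])
    ultimately show ?thesis unfolding distrib_left by (intro conjI) linarith+
  qed
  \<comment> \<open>then \<open>\<theta> K (1 + U) = lo / 4 * (1 + U)\<close>, and half of the quadratic lower bound \<open>lo / 2 * U\<close> is left\<close>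
  define \<theta> where "\<theta> = lo / (4 * K)"
  have \<theta>0: "0 < \<theta>" unfolding \<theta>_def using lo0 K(1) by simp
  have \<theta>K: "\<theta> * (K * z) = lo / 4 * z" for z unfolding \<theta>_def using K(1) by simp
  define K' where "K' = C0 + C1 / (4 * \<theta>) + lo / 4 + hi / 2 * (1 + K)"
  have K'0: "0 < K'" unfolding K'_def using C00 C10 \<theta>0 lo0 hi0 K(1) by (intro add_nonneg_pos add_nonneg_nonneg) auto
  have t0: "0 \<le> C1 / (4 * \<theta>)" using C10 \<theta>0 by simp
  show ?thesis
  proof (rule exI[of _ "lo / 4"], rule exI[of _ K'], intro conjI allI impI)
    show "0 < lo / 4" using lo0 by simp
    fix T u r assume adm: "admissible T u r"
    have U: "0 \<le> control_dev T u" by (rule dev_nonneg)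
    have l: "\<bar>lin T u r\<bar> \<le> C0 + (lo / 4 + lo / 4 * control_dev T u) + C1 / (4 * \<theta>)"
      using lin[OF adm \<theta>0] unfolding \<theta>K distrib_left by simp
    have hK: "0 \<le> hi / 2 * (1 + K)" using hi0 K(1) by simp
    show "T * J + lo / 4 * control_dev T u - K' \<le> ?cost T u r"
      using cost[OF adm] l hK unfolding K'_def by linarith
    have "hi / 2 * (control_dev T u + trace_dev T r) \<le> hi / 2 * ((1 + control_dev T u) + K * (1 + control_dev T u))"
      by (rule mult_left_mono) (use K(2)[OF adm] hi0 in auto)
    also have "\<dots> = hi / 2 * (1 + K) + hi / 2 * (1 + K) * control_dev T u" by (simp add: algebra_simps add_divide_distrib)
    finally have h: "hi / 2 * (control_dev T u + trace_dev T r) \<le> hi / 2 * (1 + K) + hi / 2 * (1 + K) * control_dev T u" .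
    have ex: "K' * (1 + control_dev T u) = K' + (C0 * control_dev T u + C1 / (4 * \<theta>) * control_dev T u + lo / 4 * control_dev T u + hi / 2 * (1 + K) * control_dev T u)"
      unfolding K'_def by (simp only: distrib_left distrib_right mult_1_right)
    have n: "0 \<le> C0 * control_dev T u" "0 \<le> C1 / (4 * \<theta>) * control_dev T u"
      by (rule mult_nonneg_nonneg[OF C00 U], rule mult_nonneg_nonneg[OF t0 U])
    have "?cost T u r \<le> T * J + (C0 + (lo / 4 + lo / 4 * control_dev T u) + C1 / (4 * \<theta>)) + (hi / 2 * (1 + K) + hi / 2 * (1 + K) * control_dev T u)"
      using cost[OF adm] l h by linarith
    also have "\<dots> \<le> T * J + K' * (1 + control_dev T u)"
      unfolding ex using n unfolding K'_def by linarith
    finally show "?cost T u r \<le> T * J + K' * (1 + control_dev T u)" .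
  qed (rule K'0)
qed

end

section \<open>The adjoint of the static problem\<close>

definition mat2 :: "real \<Rightarrow> real \<Rightarrow> real \<Rightarrow> real \<Rightarrow> real^2^2" where
  "mat2 a b c d = (\<chi> i. if i = 1 then (\<chi> j. if j = 1 then a else b) else (\<chi> j. if j = 1 then c else d))"

lemma mat2_vector: "(mat2 a b c d *v v) $ 1 = a * v $ 1 + b * v $ 2" "(mat2 a b c d *v v) $ 2 = c * v $ 1 + d * v $ 2"
  unfolding mat2_def matrix_vector_2 by simp_all

lemma mat2_continuous:
  fixes a b c d :: "'a::t2_space \<Rightarrow> real"
  assumes "continuous_on S a" "continuous_on S b" "continuous_on S c" "continuous_on S d"
  shows "continuous_on S (\<lambda>x. mat2 (a x) (b x) (c x) (d x))"
  unfolding mat2_def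
proof (rule continuous_on_vec_lambda)
  fix i :: 2
  show "continuous_on S (\<lambda>x. if i = 1 then (\<chi> j. if j = 1 then a x else b x) else (\<chi> j. if j = 1 then c x else d x) :: real^2)"
    using vec2_continuous[OF assms(1,2)] vec2_continuous[OF assms(3,4)] by (cases "i = 1") auto
qed

lemma diag2_vector: "(diag2 a b *v v) $ 1 = a * v $ 1" "(diag2 a b *v v) $ 2 = b * v $ 2"
  unfolding matrix_vector_2 by (simp_all add: diag2_entries)

lemma component_derivative:
  assumes "(S has_vector_derivative S') (at x within A)"
  shows "((\<lambda>x. (S x :: real^2) $ i) has_real_derivative S' $ i) (at x within A)"
  using bounded_linear.has_vector_derivative[OF bounded_linear_vec_nth assms]
  by (simp add: has_real_derivative_iff_has_vector_derivative)

lemma static_state_derivative: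
  assumes st: "static_state L dp dm M \<eta>0 u R" and x: "x \<in> {0<..<L}" and nz: "dp x \<noteq> 0" "dm x \<noteq> 0"
  shows "((\<lambda>x. R x $ 1) has_real_derivative \<eta>0 * (M x *v R x) $ 1 / dp x) (at x)"
    and "((\<lambda>x. R x $ 2) has_real_derivative \<eta>0 * (M x *v R x) $ 2 / dm x) (at x)"
proof -
  let ?R' = "vector_derivative R (at x)"
  have d: "(R has_vector_derivative ?R') (at x)" and e: "diag2 (dp x) (dm x) *v ?R' = \<eta>0 *\<^sub>R (M x *v R x)"
    using st x unfolding static_state_def by (auto simp: vector_derivative_works)
  have "dp x * ?R' $ 1 = \<eta>0 * (M x *v R x) $ 1" "dm x * ?R' $ 2 = \<eta>0 * (M x *v R x) $ 2"
    using arg_cong[OF e, of "\<lambda>v. v $ 1"] arg_cong[OF e, of "\<lambda>v. v $ 2"] unfolding diag2_vector by simp_all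
  then have "?R' $ 1 = \<eta>0 * (M x *v R x) $ 1 / dp x" "?R' $ 2 = \<eta>0 * (M x *v R x) $ 2 / dm x"
    using nz by (simp_all add: eq_divide_eq mult.commute)
  then show "((\<lambda>x. R x $ 1) has_real_derivative \<eta>0 * (M x *v R x) $ 1 / dp x) (at x)"
    "((\<lambda>x. R x $ 2) has_real_derivative \<eta>0 * (M x *v R x) $ 2 / dm x) (at x)"
    using component_derivative[OF d, of 1] component_derivative[OF d, of 2] by simp_all
qed

text \<open>
  Adding a multiple \<open>\<epsilon>\<close> of a static solution to the optimal one changes the cost by a quadratic
  polynomial in \<open>\<epsilon>\<close> that is nonnegative, so its linear coefficient vanishes.
\<close>

lemma static_stationarity:
  assumes A0: "symmetric_pos_def A0" and AL: "symmetric_pos_def AL"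
    and opt: "static_optimum L dp dm M \<eta>0 (quad_cost A0 c0) (quad_cost AL cL) u R"
    and S: "continuous_on {0..L} S"
    and Sd: "\<And>x. x \<in> {0<..<L} \<Longrightarrow> S differentiable (at x) \<and> diag2 (dp x) (dm x) *v vector_derivative S (at x) = \<eta>0 *\<^sub>R (M x *v S x)"
  shows "(A0 *v vector [R 0 $ 1, R 0 $ 2] + c0) \<bullet> S 0
      + (AL *v vector [R L $ 2, R L $ 1] + cL) \<bullet> vector [S L $ 2, S L $ 1] = 0"
proof -
  have st: "static_state L dp dm M \<eta>0 u R" and bc: "u $ 1 = R 0 $ 1" "u $ 2 = R L $ 2"
    and min: "\<And>v S. static_state L dp dm M \<eta>0 v S \<Longrightarrow>
        static_cost L (quad_cost A0 c0) (quad_cost AL cL) u R \<le> static_cost L (quad_cost A0 c0) (quad_cost AL cL) v S"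
    using opt unfolding static_optimum_def static_state_def by auto
  have sym: "transpose A0 = A0" "transpose AL = AL" using A0 AL unfolding symmetric_pos_def_def by auto
  define w :: "real^2" where "w = vector [S L $ 2, S L $ 1]"
  let ?g0 = "A0 *v vector [R 0 $ 1, R 0 $ 2] + c0" and ?gL = "AL *v vector [R L $ 2, R L $ 1] + cL"
  let ?b = "1/2 * (S 0 \<bullet> (A0 *v S 0)) + 1/2 * (w \<bullet> (AL *v w))"
  have "0 \<le> \<epsilon> * (?g0 \<bullet> S 0 + ?gL \<bullet> w) + \<epsilon>\<^sup>2 * ?b" for \<epsilon>
  proof -
    define v :: "real^2" where "v = vector [R 0 $ 1 + \<epsilon> * S 0 $ 1, R L $ 2 + \<epsilon> * S L $ 2]"
    let ?Q = "\<lambda>x. R x + \<epsilon> *\<^sub>R S x"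
    have "static_state L dp dm M \<eta>0 v ?Q"
      unfolding static_state_def
    proof (intro conjI ballI)
      show "continuous_on {0..L} ?Q" using st S unfolding static_state_def by (intro continuous_intros) auto
      show "?Q 0 $ 1 = v $ 1" "?Q L $ 2 = v $ 2" unfolding v_def by simp_all
      fix x assume x: "x \<in> {0<..<L}"
      have dR: "(R has_vector_derivative vector_derivative R (at x)) (at x)"
        and eR: "diag2 (dp x) (dm x) *v vector_derivative R (at x) = \<eta>0 *\<^sub>R (M x *v R x)"
        using st x unfolding static_state_def by (auto simp: vector_derivative_works)
      have dS: "(S has_vector_derivative vector_derivative S (at x)) (at x)"
        and eS: "diag2 (dp x) (dm x) *v vector_derivative S (at x) = \<eta>0 *\<^sub>R (M x *v S x)"
        using Sd[OF x] by (auto simp: vector_derivative_works)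
      have d: "(?Q has_vector_derivative (vector_derivative R (at x) + \<epsilon> *\<^sub>R vector_derivative S (at x))) (at x)"
        by (intro has_vector_derivative_add dR bounded_linear.has_vector_derivative[OF bounded_linear_scaleR_right dS])
      show "?Q differentiable (at x)" using d by (rule differentiableI_vector)
      show "diag2 (dp x) (dm x) *v vector_derivative ?Q (at x) = \<eta>0 *\<^sub>R (M x *v ?Q x)"
        unfolding vector_derivative_at[OF d]
        by (simp add: matrix_vector_right_distrib matrix_vector_mult_scaleR eR eS scaleR_add_right mult.commute)
    qed
    from min[OF this]
    have le: "static_cost L (quad_cost A0 c0) (quad_cost AL cL) u R \<le> static_cost L (quad_cost A0 c0) (quad_cost AL cL) v ?Q" .
    have e0: "vector [v $ 1, ?Q 0 $ 2] = vector [R 0 $ 1, R 0 $ 2] + \<epsilon> *\<^sub>R S 0"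
      and eL: "vector [v $ 2, ?Q L $ 1] = vector [R L $ 2, R L $ 1] + \<epsilon> *\<^sub>R w"
      unfolding v_def w_def by (rule vec2_eqI; simp)+
    show ?thesis
      using le unfolding static_cost_def e0 eL quad_cost_expand[OF sym(1)] quad_cost_expand[OF sym(2)] bc
      by (simp add: matrix_vector_mult_scaleR power2_eq_square algebra_simps)
  qed
  from linear_term_zero[OF this] show ?thesis unfolding w_def .
qed

text \<open>
  Let \<open>y\<close> be the adjoint solution with the prescribed values at \<open>L\<close>. For every static solution \<open>S\<close> the
  product \<open>y \<bullet> S\<close> is constant, so stationarity reads \<open>(g + y 0) \<bullet> S 0 = 0\<close>, where \<open>g\<close> is the
  gradient at the end \<open>0\<close>. Since \<open>S 0\<close> is arbitrary, the choice \<open>S 0 = g + y 0\<close> gives \<open>y 0 = - g\<close>.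
\<close>

lemma static_adjoint:
  fixes M :: "real \<Rightarrow> real^2^2"
  assumes L: "0 < L" and dpc: "continuous_on {0..L} dp" and dmc: "continuous_on {0..L} dm"
    and nonzero: "\<forall>x\<in>{0..L}. dp x \<noteq> 0 \<and> dm x \<noteq> 0"
    and M: "continuous_on {0..L} M"
    and A0: "symmetric_pos_def A0" and AL: "symmetric_pos_def AL"
    and opt: "static_optimum L dp dm M \<eta>0 (quad_cost A0 c0) (quad_cost AL cL) u R"
  shows "\<exists>y1 y2.
    (\<forall>x\<in>{0..L}. (y1 has_real_derivative - \<eta>0 * (M x $ 1 $ 1 * (y1 x / dp x) + M x $ 2 $ 1 * (y2 x / dm x))) (at x within {0..L})) \<and>
    (\<forall>x\<in>{0..L}. (y2 has_real_derivative - \<eta>0 * (M x $ 1 $ 2 * (y1 x / dp x) + M x $ 2 $ 2 * (y2 x / dm x))) (at x within {0..L})) \<and>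
    y1 L = (AL *v vector [R L $ 2, R L $ 1] + cL) $ 2 \<and> y2 L = (AL *v vector [R L $ 2, R L $ 1] + cL) $ 1 \<and>
    y1 0 = - (A0 *v vector [R 0 $ 1, R 0 $ 2] + c0) $ 1 \<and> y2 0 = - (A0 *v vector [R 0 $ 1, R 0 $ 2] + c0) $ 2"
proof -
  have nz: "dp x \<noteq> 0" "dm x \<noteq> 0" if "x \<in> {0..L}" for x using nonzero that by auto
  let ?g0 = "A0 *v vector [R 0 $ 1, R 0 $ 2] + c0" and ?gL = "AL *v vector [R L $ 2, R L $ 1] + cL"
  have mc: "continuous_on {0..L} (\<lambda>x. M x $ i $ j)" for i j by (rule continuous_on_entry[OF M])
  have ep: "continuous_on {0..L} (\<lambda>x. \<eta>0 * M x $ i $ j / dp x)" for i j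
    by (intro continuous_on_divide continuous_on_mult continuous_on_const mc dpc) (use nz(1) in blast)
  have em: "continuous_on {0..L} (\<lambda>x. \<eta>0 * M x $ i $ j / dm x)" for i j
    by (intro continuous_on_divide continuous_on_mult continuous_on_const mc dmc) (use nz(2) in blast)
  have refl: "continuous_on {0..L} (\<lambda>x. f (L - x))" if "continuous_on {0..L} f" for f :: "real \<Rightarrow> real"
    by (rule continuous_on_compose2[OF that]) (auto intro!: continuous_intros)
  have mem: "L - x \<in> {0..L}" if "x \<in> {0..L}" for x using that by auto
  \<comment> \<open>the adjoint equation is solved backwards from \<open>L\<close>, hence the reflected coefficients\<close>
  define B where "B x = mat2 (\<eta>0 * M (L - x) $ 1 $ 1 / dp (L - x)) (\<eta>0 * M (L - x) $ 2 $ 1 / dm (L - x))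
      (\<eta>0 * M (L - x) $ 1 $ 2 / dp (L - x)) (\<eta>0 * M (L - x) $ 2 $ 2 / dm (L - x))" for x
  have Bc: "continuous_on {0..L} B"
    unfolding B_def[abs_def]
    by (rule mat2_continuous[OF refl[OF ep] refl[OF em] refl[OF ep] refl[OF em]])
  have "\<exists>Y. Y 0 = vector [?gL $ 2, ?gL $ 1] \<and> (\<forall>x\<in>{0..L}. (Y has_vector_derivative B x *v Y x) (at x within {0..L}))"
    by (rule linear_ode_solution[OF L Bc, where ?s0.0 = "vector [?gL $ 2, ?gL $ 1]"]) (intro exI conjI ballI)
  then obtain Y where Y: "Y 0 = vector [?gL $ 2, ?gL $ 1]" "\<And>x. x \<in> {0..L} \<Longrightarrow> (Y has_vector_derivative B x *v Y x) (at x within {0..L})"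
    by auto
  define y where "y i x = Y (L - x) $ i" for i :: 2 and x
  have yd: "(y i has_real_derivative - ((B (L - x) *v Y (L - x)) $ i)) (at x within {0..L})" if x: "x \<in> {0..L}" for x i
  proof -
    have "((\<lambda>x. Y x $ i) has_real_derivative (B (L - x) *v Y (L - x)) $ i) (at (L - x) within (\<lambda>x. L - x) ` {0..L})"
      by (rule DERIV_subset[OF component_derivative[OF Y(2)[OF mem[OF x]]]]) (use mem in blast)
    moreover have "((\<lambda>x. L - x) has_real_derivative -1) (at x within {0..L})"
      by (auto intro!: derivative_eq_intros)
    ultimately have "((\<lambda>x. Y x $ i) \<circ> (\<lambda>x. L - x) has_real_derivative (B (L - x) *v Y (L - x)) $ i * (-1)) (at x within {0..L})"
      by (rule DERIV_image_chain)
    then show ?thesis unfolding y_def[abs_def] by (simp add: o_def)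
  qed
  have y1: "(y 1 has_real_derivative - \<eta>0 * (M x $ 1 $ 1 * (y 1 x / dp x) + M x $ 2 $ 1 * (y 2 x / dm x))) (at x within {0..L})" if x: "x \<in> {0..L}" for x
    using yd[OF x, of 1] unfolding B_def mat2_vector y_def by (simp add: algebra_simps)
  have y2: "(y 2 has_real_derivative - \<eta>0 * (M x $ 1 $ 2 * (y 1 x / dp x) + M x $ 2 $ 2 * (y 2 x / dm x))) (at x within {0..L})" if x: "x \<in> {0..L}" for x
    using yd[OF x, of 2] unfolding B_def mat2_vector y_def by (simp add: algebra_simps)
  have yL: "y 1 L = ?gL $ 2" "y 2 L = ?gL $ 1" unfolding y_def by (simp_all add: Y(1))
  define s0 :: "real^2" where "s0 = ?g0 + vector [y 1 0, y 2 0]"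
  define A where "A x = mat2 (\<eta>0 * M x $ 1 $ 1 / dp x) (\<eta>0 * M x $ 1 $ 2 / dp x) (\<eta>0 * M x $ 2 $ 1 / dm x) (\<eta>0 * M x $ 2 $ 2 / dm x)" for x
  have Ac: "continuous_on {0..L} A"
    unfolding A_def[abs_def] by (rule mat2_continuous[OF ep ep em em])
  have "\<exists>S. S 0 = s0 \<and> (\<forall>x\<in>{0..L}. (S has_vector_derivative A x *v S x) (at x within {0..L}))"
    by (rule linear_ode_solution[OF L Ac, where ?s0.0 = s0]) (intro exI conjI ballI)
  then obtain S where S: "S 0 = s0" "\<And>x. x \<in> {0..L} \<Longrightarrow> (S has_vector_derivative A x *v S x) (at x within {0..L})"
    by auto
  have Sc: "continuous_on {0..L} S"
    unfolding continuous_on_eq_continuous_within using has_vector_derivative_continuous[OF S(2)] by (intro ballI)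
  have AS: "(A x *v S x) $ 1 = \<eta>0 * (M x *v S x) $ 1 / dp x" "(A x *v S x) $ 2 = \<eta>0 * (M x *v S x) $ 2 / dm x" for x
    unfolding A_def mat2_vector unfolding matrix_vector_2 by (simp_all add: algebra_simps add_divide_distrib)
  have stat: "?g0 \<bullet> S 0 + ?gL \<bullet> vector [S L $ 2, S L $ 1] = 0"
  proof (rule static_stationarity[OF A0 AL opt Sc])
    fix x assume x: "x \<in> {0<..<L}"
    then have xx: "x \<in> {0..L}" by simp
    have d: "(S has_vector_derivative A x *v S x) (at x)"
      using S(2)[OF xx] x at_within_Icc_at[of 0 x L] by simp
    have "diag2 (dp x) (dm x) *v (A x *v S x) = \<eta>0 *\<^sub>R (M x *v S x)"
    proof (rule vec2_eqI)
      show "(diag2 (dp x) (dm x) *v (A x *v S x)) $ 1 = (\<eta>0 *\<^sub>R (M x *v S x)) $ 1"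
        unfolding diag2_vector AS using nz(1)[OF xx] by simp
      show "(diag2 (dp x) (dm x) *v (A x *v S x)) $ 2 = (\<eta>0 *\<^sub>R (M x *v S x)) $ 2"
        unfolding diag2_vector AS using nz(2)[OF xx] by simp
    qed
    then show "S differentiable (at x) \<and> diag2 (dp x) (dm x) *v vector_derivative S (at x) = \<eta>0 *\<^sub>R (M x *v S x)"
      unfolding vector_derivative_at[OF d] using differentiableI_vector[OF d] by simp
  qed
  have "((\<lambda>x. y 1 x * S x $ 1 + y 2 x * S x $ 2) has_real_derivative 0) (at x within {0..L})" if x: "x \<in> {0..L}" for x
  proof -
    have s: "((\<lambda>x. S x $ 1) has_real_derivative \<eta>0 * (M x *v S x) $ 1 / dp x) (at x within {0..L})"
      "((\<lambda>x. S x $ 2) has_real_derivative \<eta>0 * (M x *v S x) $ 2 / dm x) (at x within {0..L})"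
      using component_derivative[OF S(2)[OF x], of 1] component_derivative[OF S(2)[OF x], of 2] unfolding AS by simp_all
    have "- \<eta>0 * (M x $ 1 $ 1 * (y 1 x / dp x) + M x $ 2 $ 1 * (y 2 x / dm x)) * S x $ 1 + \<eta>0 * (M x *v S x) $ 1 / dp x * y 1 x
      + (- \<eta>0 * (M x $ 1 $ 2 * (y 1 x / dp x) + M x $ 2 $ 2 * (y 2 x / dm x)) * S x $ 2 + \<eta>0 * (M x *v S x) $ 2 / dm x * y 2 x) = 0"
      unfolding matrix_vector_2 divide_inverse by (simp add: algebra_simps)
    from DERIV_cong[OF DERIV_add[OF DERIV_mult[OF y1[OF x] s(1)] DERIV_mult[OF y2[OF x] s(2)]] this]
    show ?thesis .
  qed
  then have "\<exists>k. \<forall>x\<in>{0..L}. y 1 x * S x $ 1 + y 2 x * S x $ 2 = k"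
    by (rule has_field_derivative_zero_constant[OF convex_real_interval(5)])
  then obtain k where k: "\<forall>x\<in>{0..L}. y 1 x * S x $ 1 + y 2 x * S x $ 2 = k" ..
  have "y 1 0 * s0 $ 1 + y 2 0 * s0 $ 2 = y 1 L * S L $ 1 + y 2 L * S L $ 2"
    using bspec[OF k, of 0] bspec[OF k, of L] L S(1) by simp
  moreover have "?g0 $ 1 * s0 $ 1 + ?g0 $ 2 * s0 $ 2 + (?gL $ 1 * S L $ 2 + ?gL $ 2 * S L $ 1) = 0"
    using stat unfolding S(1) inner_2 vector_2 .
  moreover have "s0 $ 1 = ?g0 $ 1 + y 1 0" "s0 $ 2 = ?g0 $ 2 + y 2 0" unfolding s0_def by simp_all
  moreover have "p * p + q * q = 0" if "p = g1 + a1" "q = g2 + a2" "a1 * p + a2 * q = b1 * z1 + b2 * z2"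
      "g1 * p + g2 * q + (b2 * z2 + b1 * z1) = 0" for p q g1 g2 a1 a2 b1 b2 z1 z2 :: real
  proof -
    have "p * p + q * q = (g1 * p + g2 * q) + (a1 * p + a2 * q)" unfolding that(1,2) by (simp add: algebra_simps)
    then show ?thesis using that(3,4) by linarith
  qed
  ultimately have "s0 \<bullet> s0 = 0" unfolding inner_2 yL by blast
  then have "s0 = 0" by simp
  then have "s0 $ 1 = 0" "s0 $ 2 = 0" by simp_all
  then have "y 1 0 = - ?g0 $ 1" "y 2 0 = - ?g0 $ 2" unfolding s0_def by simp_all
  then show ?thesis using y1 y2 yL by (intro exI[of _ "y 1"] exI[of _ "y 2"] conjI ballI)
qed

section \<open>The turnpike estimate\<close>

theorem theorem1:
  fixes L \<eta>0 :: real
    and dp dm dp' dm' :: "real \<Rightarrow> real"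
    and M :: "real \<Rightarrow> real^2^2"
    and A0 AL :: "real^2^2"
    and c0 cL :: "real^2"
    and u\<sigma> :: "real^2"
    and r\<sigma> :: "real \<Rightarrow> real^2"
  assumes "L > 0"
    and "\<forall>x\<in>{0..L}. (dp has_real_derivative dp' x) (at x within {0..L})"
    and "continuous_on {0..L} dp'"
    and "\<forall>x\<in>{0..L}. (dm has_real_derivative dm' x) (at x within {0..L})"
    and "continuous_on {0..L} dm'"
    and "\<forall>x\<in>{0..L}. dm x < 0 \<and> 0 < dp x"
    and "continuous_on {0..L} M"
    and "\<eta>0 \<le> 0"
    and "\<exists>\<mu>p>0. \<exists>\<mu>m>0. \<exists>\<nu>a<0. \<forall>x\<in>{0..L}.
           (let E = weight_matrix \<mu>p \<mu>m; D = (\<lambda>y. diag2 (dp y) (dm y)) in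
            (SUP v\<in>{v. v \<bullet> (E x *v v) = 1}.
               v \<bullet> ((vector_derivative (\<lambda>y. E y ** D y) (at x within {0..L})
                      - \<bar>\<eta>0\<bar> *\<^sub>R (E x ** M x + transpose (M x) ** E x)) *v v)) \<le> \<nu>a)"
    and "\<exists>\<mu>p<0. \<exists>\<mu>m<0. \<exists>\<nu>0>0. \<forall>x\<in>{0..L}.
           (let E = weight_matrix \<mu>p \<mu>m; D = (\<lambda>y. diag2 (dp y) (dm y));
                D' = (\<lambda>y. diag2 (dp' y) (dm' y)) in
            (INF v\<in>{v. v \<bullet> (E x *v v) = 1}.
               v \<bullet> ((vector_derivative E (at x within {0..L}) ** D x - E x ** D' x
                      + \<bar>\<eta>0\<bar> *\<^sub>R (E x ** M x + transpose (M x) ** E x)) *v v)) \<ge> \<nu>0)"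
    and "symmetric_pos_def A0"
    and "symmetric_pos_def AL"
    and "static_optimum L dp dm M \<eta>0 (quad_cost A0 c0) (quad_cost AL cL) u\<sigma> r\<sigma>"
  shows "(\<exists>C>0. \<forall>T>0. \<forall>u r.
            dynamic_optimum L dp dm M \<eta>0 (quad_cost A0 c0) (quad_cost AL cL) T u r \<longrightarrow>
            1 / T * (LBINT \<tau>:{0..T}. (norm (u \<tau> - u\<sigma>))\<^sup>2) \<le> C / T \<and>
            (LBINT s:{0..1}. (norm (u (T * s) - u\<sigma>))\<^sup>2) \<le> C / T) \<and>
         (\<exists>Dt>0. \<forall>T>0. \<forall>u r.
            dynamic_optimum L dp dm M \<eta>0 (quad_cost A0 c0) (quad_cost AL cL) T u r \<longrightarrow>
            (LBINT \<tau>:{0..T}. (LBINT x:{0..L}. (norm (r \<tau> x - r\<sigma> x))\<^sup>2)) \<le> Dt)"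
proof -
  note L = assms(1) and A0 = assms(11) and AL = assms(12) and opt = assms(13)
  have dpc: "continuous_on {0..L} dp" and dmc: "continuous_on {0..L} dm"
    using assms(2,4) by (meson DERIV_continuous continuous_on_eq_continuous_within)+
  have sg: "0 < dp x" "dm x < 0" if "x \<in> {0..L}" for x using assms(6) that by auto
  have nz: "dp x \<noteq> 0" "dm x \<noteq> 0" if "x \<in> {0..L}" for x using sg[OF that] by auto
  have nonzero: "\<forall>x\<in>{0..L}. dp x \<noteq> 0 \<and> dm x \<noteq> 0" using nz by blast
  obtain Yp Pp Xp where tp: "travel L Yp 0 L 1 dp Pp Xp" using travel_rightward[OF L dpc sg(1)] by blast
  obtain Ym Pm Xm where tm: "travel L Ym L 0 (-1) dm Pm Xm" using travel_leftward[OF L dmc sg(2)] by blast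
  have st: "static_state L dp dm M \<eta>0 u\<sigma> r\<sigma>" using opt unfolding static_optimum_def by blast
  have us: "u\<sigma> $ 1 = r\<sigma> 0 $ 1" "u\<sigma> $ 2 = r\<sigma> L $ 2" and rc: "continuous_on {0..L} r\<sigma>" using st unfolding static_state_def by auto
  interpret deviation L Yp Ym dp dm Pp Xp Pm Xm M \<eta>0 r\<sigma>
  proof (intro deviation.intro tp tm deviation_axioms.intro assms(7) rc)
    fix x assume x: "x \<in> {0<..<L}"
    then have "x \<in> {0..L}" by simp
    from static_state_derivative[OF st x nz[OF this]]
    show "((\<lambda>x. r\<sigma> x $ 1) has_real_derivative \<eta>0 * (M x *v r\<sigma> x) $ 1 / dp x) (at x)"
      "((\<lambda>x. r\<sigma> x $ 2) has_real_derivative \<eta>0 * (M x *v r\<sigma> x) $ 2 / dm x) (at x)" .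
  qed
  obtain \<mu>p \<mu>m \<nu> where \<mu>: "0 < \<mu>p" "0 < \<mu>m" "\<nu> < 0" and sup: "\<And>x. x \<in> {0..L} \<Longrightarrow>
           (let E = weight_matrix \<mu>p \<mu>m; D = (\<lambda>y. diag2 (dp y) (dm y)) in
            (SUP v\<in>{v. v \<bullet> (E x *v v) = 1}.
               v \<bullet> ((vector_derivative (\<lambda>y. E y ** D y) (at x within {0..L})
                      - \<bar>\<eta>0\<bar> *\<^sub>R (E x ** M x + transpose (M x) ** E x)) *v v)) \<le> \<nu>)"
    using assms(9) by blast
  define e1 where "e1 x = exp (- \<mu>p * x)" for x
  define e2 where "e2 x = exp (\<mu>m * x)" for x
  define k1 where "k1 x = exp (- \<mu>p * x) * dp' x - \<mu>p * exp (- \<mu>p * x) * dp x" for x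
  define k2 where "k2 x = exp (\<mu>m * x) * dm' x + \<mu>m * exp (\<mu>m * x) * dm x" for x
  define \<epsilon> where "\<epsilon> = exp (- \<mu>p * L)"
  have \<epsilon>: "0 < \<epsilon>" "\<epsilon> \<le> e1 x" "\<epsilon> \<le> e2 x" if "x \<in> {0..L}" for x
  proof -
    show "0 < \<epsilon>" "\<epsilon> \<le> e1 x" unfolding \<epsilon>_def e1_def using that \<mu> by auto
    have "- \<mu>p * L \<le> 0" "0 \<le> \<mu>m * x" using that \<mu> L by auto
    then have "- \<mu>p * L \<le> \<mu>m * x" by linarith
    then show "\<epsilon> \<le> e2 x" unfolding \<epsilon>_def e2_def by simp
  qed
  have L0: "0 \<in> {0..L}" using L by simp
  have lyap: "k1 x * (v $ 1)\<^sup>2 + k2 x * (v $ 2)\<^sup>2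
        + 2 * (e1 x * (v $ 1 * (\<eta>0 * (M x *v v) $ 1)) + e2 x * (v $ 2 * (\<eta>0 * (M x *v v) $ 2)))
        \<le> - ((- \<nu> * \<epsilon>) * (norm v)\<^sup>2)" if x: "x \<in> {0..L}" for x v
  proof -
    have "\<epsilon> * (norm v)\<^sup>2 \<le> e1 x * (v $ 1)\<^sup>2 + e2 x * (v $ 2)\<^sup>2"
      unfolding norm_squared_2 distrib_left using \<epsilon>[OF x] by (intro add_mono mult_right_mono) auto
    then have "\<nu> * (e1 x * (v $ 1)\<^sup>2 + e2 x * (v $ 2)\<^sup>2) \<le> \<nu> * (\<epsilon> * (norm v)\<^sup>2)"
      using \<mu>(3) by (intro mult_left_mono_neg) auto
    moreover have "k1 x * (v $ 1)\<^sup>2 + k2 x * (v $ 2)\<^sup>2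
        + 2 * (e1 x * (v $ 1 * (\<eta>0 * (M x *v v) $ 1)) + e2 x * (v $ 2 * (\<eta>0 * (M x *v v) $ 2)))
        \<le> \<nu> * (e1 x * (v $ 1)\<^sup>2 + e2 x * (v $ 2)\<^sup>2)"
      unfolding k1_def k2_def e1_def e2_def
      by (rule Lyapunov_inequality[where dp = dp and dm = dm and dp' = "dp' x" and dm' = "dm' x" and M = M and v = v and \<nu> = \<nu>,
          OF L x assms(8) bspec[OF assms(2) x] bspec[OF assms(4) x] sup[OF x]])
    ultimately show ?thesis by (simp add: mult.assoc)
  qed
  have "\<exists>K>0. \<forall>T u r. admissible T u r \<longrightarrow>
     final_dev T r \<le> K * (1 + control_dev T u) \<and> trace_dev T r \<le> K * (1 + control_dev T u)
     \<and> interior_dev T r \<le> K * (1 + control_dev T u)"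
  proof (rule dissipation_bound[of e1 e2 k1 k2 "- \<nu> * \<epsilon>" \<epsilon>])
    show "continuous_on {0..L} e1" "continuous_on {0..L} e2" "continuous_on {0..L} k1" "continuous_on {0..L} k2"
      unfolding e1_def[abs_def] e2_def[abs_def] k1_def[abs_def] k2_def[abs_def]
      by (intro continuous_intros dpc dmc assms(3,5))+
    show "((\<lambda>x. e1 x * dp x) has_real_derivative k1 x) (at x within {0..L})" if x: "x \<in> {0..L}" for x
      unfolding e1_def k1_def by (auto intro!: derivative_eq_intros bspec[OF assms(2) x])
    show "((\<lambda>x. e2 x * dm x) has_real_derivative k2 x) (at x within {0..L})" if x: "x \<in> {0..L}" for x
      unfolding e2_def k2_def by (auto intro!: derivative_eq_intros bspec[OF assms(4) x])
    show "0 < - \<nu> * \<epsilon>" using mult_pos_pos[of "- \<nu>" \<epsilon>] \<mu>(3) \<epsilon>(1)[OF L0] by simp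
  qed (fact lyap \<epsilon>(1)[OF L0] \<epsilon>(2) \<epsilon>(3))+
  then obtain K where K: "0 < K" "\<And>T u r. admissible T u r \<Longrightarrow>
     final_dev T r \<le> K * (1 + control_dev T u) \<and> trace_dev T r \<le> K * (1 + control_dev T u)
     \<and> interior_dev T r \<le> K * (1 + control_dev T u)"
    by auto
  obtain y1 y2 where
    "\<forall>x\<in>{0..L}. (y1 has_real_derivative - \<eta>0 * (M x $ 1 $ 1 * (y1 x / dp x) + M x $ 2 $ 1 * (y2 x / dm x))) (at x within {0..L})"
    "\<forall>x\<in>{0..L}. (y2 has_real_derivative - \<eta>0 * (M x $ 1 $ 2 * (y1 x / dp x) + M x $ 2 $ 2 * (y2 x / dm x))) (at x within {0..L})" and
    yL: "y1 L = (AL *v vector [r\<sigma> L $ 2, r\<sigma> L $ 1] + cL) $ 2" "y2 L = (AL *v vector [r\<sigma> L $ 2, r\<sigma> L $ 1] + cL) $ 1" and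
    y0: "y1 0 = - (A0 *v vector [r\<sigma> 0 $ 1, r\<sigma> 0 $ 2] + c0) $ 1" "y2 0 = - (A0 *v vector [r\<sigma> 0 $ 1, r\<sigma> 0 $ 2] + c0) $ 2"
    using static_adjoint[OF L dpc dmc nonzero assms(7) A0 AL opt] by (elim exE conjE) (rule that)
  note y1 = bspec[OF this(1)] and y2 = bspec[OF this(2)]
  have yc: "continuous_on {0..L} y1" "continuous_on {0..L} y2"
    using y1 y2 by (meson DERIV_continuous continuous_on_eq_continuous_within)+
  define J where "J = quad_cost A0 c0 (vector [r\<sigma> 0 $ 1, r\<sigma> 0 $ 2]) + quad_cost AL cL (vector [r\<sigma> L $ 2, r\<sigma> L $ 1])"
  let ?cost = "dynamic_cost L (quad_cost A0 c0) (quad_cost AL cL)"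
  have "\<exists>\<kappa> K'. 0 < \<kappa> \<and> 0 < K' \<and> (\<forall>T u r. admissible T u r \<longrightarrow>
      T * J + \<kappa> * control_dev T u - K' \<le> ?cost T u r \<and> ?cost T u r \<le> T * J + K' * (1 + control_dev T u))"
    unfolding J_def by (rule cost_bounds[OF A0 AL K yc y1 y2 yL y0])
  then obtain \<kappa> K' where \<kappa>: "0 < \<kappa>" "0 < K'"
    and lower: "\<And>T u r. admissible T u r \<Longrightarrow> T * J + \<kappa> * control_dev T u - K' \<le> ?cost T u r"
    and upper: "\<And>T u r. admissible T u r \<Longrightarrow> ?cost T u r \<le> T * J + K' * (1 + control_dev T u)"
    by auto
  define C where "C = (K' * (1 + (norm u\<sigma>)\<^sup>2) + K') / \<kappa> + 1"
  have C0: "0 < C"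
  proof -
    have "0 \<le> K' * (1 + (norm u\<sigma>)\<^sup>2) + K'" using \<kappa>(2) by (intro add_nonneg_nonneg mult_nonneg_nonneg) auto
    then show ?thesis unfolding C_def using \<kappa>(1) by (simp add: add_nonneg_pos)
  qed
  have norm_dev: "(norm (v - u\<sigma>))\<^sup>2 = (v $ 1 - r\<sigma> 0 $ 1)\<^sup>2 + (v $ 2 - r\<sigma> L $ 2)\<^sup>2" for v
    unfolding norm_squared_2 using us by simp
  have control_dev: "(LBINT t:{0..T}. (norm (u t - u\<sigma>))\<^sup>2) = control_dev T u" if "admissible T u r" for T u r
    unfolding norm_dev control_dev_def
    using deviation_regularity(4)[OF that] unfolding square_integrable_def by (intro set_integral_add(2)) auto
  have bound: "control_dev T u \<le> C" and adm: "admissible T u r"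
    if T: "0 < T" and opt: "dynamic_optimum L dp dm M \<eta>0 (quad_cost A0 c0) (quad_cost AL cL) T u r" for T u r
  proof -
    show adm: "admissible T u r" using T opt unfolding admissible_def dynamic_optimum_def by blast
    \<comment> \<open>it differs from \<open>u\<sigma>\<close> only before time \<open>1\<close>, so its deviation stays bounded as \<open>T\<close> grows\<close>
    define v where "v t = min t 1 *\<^sub>R u\<sigma>" for t :: real
    have vc: "continuous_on {0..T} v" unfolding v_def[abs_def] by (intro continuous_intros)
    obtain s where s: "dynamic_state L dp dm M \<eta>0 T v s"
      by (rule dynamic_state_exists[OF tp tm assms(7) vc]) (auto simp: v_def)
    have v2: "L2_on {0..T} v"
    proof -
      have "(\<lambda>t. indicator {0..T} t *\<^sub>R v t) \<in> borel_measurable borel"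
        by (rule borel_measurable_continuous_on_indicator[OF _ vc]) simp
      moreover have "set_integrable lborel {0..T} (\<lambda>t. (norm (v t))\<^sup>2)"
        by (rule borel_integrable_atLeastAtMost') (intro continuous_intros vc)
      ultimately show ?thesis unfolding L2_on_def set_borel_measurable_def by simp
    qed
    have admv: "admissible T v s" unfolding admissible_def using T v2 s by blast
    have dv: "control_dev T v \<le> (norm u\<sigma>)\<^sup>2"
    proof -
      have "control_dev T v = (LBINT t:{0..T}. (norm (v t - u\<sigma>))\<^sup>2)" by (rule control_dev[OF admv, symmetric])
      also have "\<dots> \<le> (LBINT t:{0..1::real}. (norm u\<sigma>)\<^sup>2)"
        unfolding set_lebesgue_integral_def
      proof (rule integral_mono')
        show "integrable lborel (\<lambda>t. indicator {0..1::real} t *\<^sub>R (norm u\<sigma>)\<^sup>2)"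
          by simp
        show "indicator {0..T} t *\<^sub>R (norm (v t - u\<sigma>))\<^sup>2 \<le> indicator {0..1} t *\<^sub>R (norm u\<sigma>)\<^sup>2" for t
        proof (cases "t \<in> {0..T} \<and> t < 1")
          case True
          have "v t - u\<sigma> = (t - 1) *\<^sub>R u\<sigma>" unfolding v_def using True by (simp add: scaleR_diff_left)
          then have "norm (v t - u\<sigma>) \<le> 1 * norm u\<sigma>" using True by (simp add: mult_left_le_one_le)
          then have "(norm (v t - u\<sigma>))\<^sup>2 \<le> (norm u\<sigma>)\<^sup>2" by (intro power_mono) auto
          then show ?thesis using True by simp
        next
          case False
          then show ?thesis by (auto simp: v_def indicator_def)
        qed
      qed simp
      also have "\<dots> = (norm u\<sigma>)\<^sup>2" unfolding set_lebesgue_integral_def by simp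
      finally show ?thesis .
    qed
    have "T * J + \<kappa> * control_dev T u - K' \<le> ?cost T u r" by (rule lower[OF adm])
    also have "\<dots> \<le> ?cost T v s" using opt v2 s unfolding dynamic_optimum_def by blast
    also have "\<dots> \<le> T * J + K' * (1 + control_dev T v)" by (rule upper[OF admv])
    also have "\<dots> \<le> T * J + K' * (1 + (norm u\<sigma>)\<^sup>2)" using dv \<kappa>(2) by simp
    finally have "\<kappa> * control_dev T u \<le> K' * (1 + (norm u\<sigma>)\<^sup>2) + K'" by linarith
    then have "control_dev T u \<le> (K' * (1 + (norm u\<sigma>)\<^sup>2) + K') / \<kappa>"
      using \<kappa>(1) by (simp add: pos_le_divide_eq mult.commute)
    then show "control_dev T u \<le> C" unfolding C_def by simp
  qed
  have controls: "1 / T * (LBINT \<tau>:{0..T}. (norm (u \<tau> - u\<sigma>))\<^sup>2) \<le> C / T \<and> (LBINT s:{0..1}. (norm (u (T * s) - u\<sigma>))\<^sup>2) \<le> C / T"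
    if T: "0 < T" and opt: "dynamic_optimum L dp dm M \<eta>0 (quad_cost A0 c0) (quad_cost AL cL) T u r" for T u r
  proof -
    have le: "(LBINT \<tau>:{0..T}. (norm (u \<tau> - u\<sigma>))\<^sup>2) \<le> C"
      unfolding control_dev[OF adm[OF T opt]] by (rule bound[OF T opt])
    have "(LBINT \<tau>:{0..T}. (norm (u \<tau> - u\<sigma>))\<^sup>2) = T * (LBINT s. indicator {0..T} (T * s) *\<^sub>R (norm (u (T * s) - u\<sigma>))\<^sup>2)"
      unfolding set_lebesgue_integral_def
      using lborel_integral_real_affine[of T "\<lambda>\<tau>. indicator {0..T} \<tau> *\<^sub>R (norm (u \<tau> - u\<sigma>))\<^sup>2" 0] T by simp
    also have "(\<lambda>s. indicator {0..T} (T * s) *\<^sub>R (norm (u (T * s) - u\<sigma>))\<^sup>2) = (\<lambda>s. indicator {0..1} s *\<^sub>R (norm (u (T * s) - u\<sigma>))\<^sup>2)"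
      using T mult_le_cancel_left_pos[OF T, of _ 1] by (auto simp: indicator_def fun_eq_iff zero_le_mult_iff)
    finally have "(LBINT \<tau>:{0..T}. (norm (u \<tau> - u\<sigma>))\<^sup>2) = T * (LBINT s:{0..1}. (norm (u (T * s) - u\<sigma>))\<^sup>2)"
      unfolding set_lebesgue_integral_def .
    with le T show ?thesis by (simp add: divide_right_mono pos_le_divide_eq mult.commute)
  qed
  have states: "(LBINT \<tau>:{0..T}. (LBINT x:{0..L}. (norm (r \<tau> x - r\<sigma> x))\<^sup>2)) \<le> K * (1 + C)"
    if T: "0 < T" and opt: "dynamic_optimum L dp dm M \<eta>0 (quad_cost A0 c0) (quad_cost AL cL) T u r" for T u r
  proof -
    have "interior_dev T r \<le> K * (1 + control_dev T u)" using K(2)[OF adm[OF T opt]] by blast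
    also have "\<dots> \<le> K * (1 + C)" using bound[OF T opt] K(1) by simp
    finally show ?thesis unfolding interior_dev_def .
  qed
  have "0 < K * (1 + C)" using K(1) C0 by simp
  then show ?thesis using C0 controls states by blast
qed

end
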